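(* Let $q$ be a prime power with $2 \le q \le 101$. Then $A_q(7,4) \leq F(q)$, where $F(q) = (q^2-q+1)\begin{bmatrix}7\\1\end{bmatrix}_q + q^4-2q^3+3q^2-4q+3$ for $q\in\{2,3\}$, and $F(q) = (q^2-q+1)\begin{bmatrix}7\\1\end{bmatrix}_q + q^4-2q^3+3q^2-4q+4$ for $q\ge 4$.
   Context: $\begin{bmatrix}n\\1\end{bmatrix}_q=\frac{q^n-1}{q-1}$. For $V=\mathbb{F}_q^n$, $\mathcal{P}(V)$ is the set of all subspaces of $V$ with the subspace metric $d_s(U,W)=\dim(U+W)-\dim(U\cap W)$. $A_q(n,d)$ denotes the maximum cardinality of a subset $\mathcal{C}\subseteq\mathcal{P}(\mathbb{F}_q^n)$ with $d_s(U,W)\ge d$ for all distinct $U,W\in\mathcal{C}$. *)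

theory Defs
  imports
    "HOL-Analysis.Cartesian_Space"
    "HOL-Library.Numeral_Type"
    "HOL-Library.Set_Algebras"
    "HOL-Number_Theory.Prime_Powers"
begin

text \<open>
  The field \<open>\<bbbF>\<^sub>q\<close> is any type \<open>'a\<close> of classes \<open>field\<close> and \<open>finite\<close> with \<open>CARD('a) = q\<close>, and
  \<open>\<bbbF>\<^sub>q\<^sup>n\<close> is \<open>'a ^ 'n\<close> with \<open>CARD('n) = n\<close>.
\<close>

definition subspaces :: "('a::field ^ 'n::finite) set set" where
  "subspaces = {U. vec.subspace U}"

text \<open>
  \<open>U + W\<close> is the elementwise sum of sets. On subspaces the difference does not truncate,
  because \<open>U \<inter> W \<subseteq> U + W\<close>.
\<close>

definition subspace_dist :: "('a::field ^ 'n::finite) set \<Rightarrow> ('a ^ 'n) set \<Rightarrow> nat" where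
  "subspace_dist U W = vec.dim (U + W) - vec.dim (U \<inter> W)"

definition subspace_code :: "nat \<Rightarrow> ('a::field ^ 'n::finite) set set \<Rightarrow> bool" where
  "subspace_code d C \<longleftrightarrow>
     C \<subseteq> subspaces \<and> (\<forall>U\<in>C. \<forall>W\<in>C. U \<noteq> W \<longrightarrow> d \<le> subspace_dist U W)"

text \<open>
  \<open>A_max TYPE('a) TYPE('n) d\<close> is \<open>A\<^sub>q(n,d)\<close>. The maximum is over a finite set, which is
  nonempty because the empty code always qualifies.
\<close>

definition A_max :: "'a::{field,finite} itself \<Rightarrow> 'n::finite itself \<Rightarrow> nat \<Rightarrow> nat" where
  "A_max _ _ d = Max {card C | C :: ('a ^ 'n) set set. subspace_code d C}"

definition gauss_bracket1 :: "nat \<Rightarrow> nat \<Rightarrow> real" where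
  "gauss_bracket1 n q = (real q ^ n - 1) / (real q - 1)"

definition F_bound :: "nat \<Rightarrow> real" where
  "F_bound q =
     (real q ^ 2 - real q + 1) * gauss_bracket1 7 q
       + real q ^ 4 - 2 * real q ^ 3 + 3 * real q ^ 2 - 4 * real q
       + (if q \<in> {2, 3} then 3 else 4)"

end

theory Submission
  imports Defs
begin

text \<open>
  Let \<open>N\<close> be the number of two-dimensional subspaces, \<open>s = q\<^sup>2 + q + 1\<close>, \<open>\<mu> = q\<^sup>2 + 1\<close>, and let \<open>x, y, z, w\<close>
  be the numbers of codewords of dimensions 3, 4, 2 and 5. The defect of a two-dimensional
  subspace \<open>L\<close> is 1 minus the number of codewords of dimensions 2 and 3 containing \<open>L\<close> minus \<open>1/\<mu>\<close> times the
  number of those of dimension 4. Codewords of two different dimensions among 2, 3, 4 never share such an \<open>L\<close>,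
  and two of dimension 2 or 3 do not either. Hence the sum of the squares of the defects is determined by
  \<open>x, y, z\<close> and the number of pairs of four-dimensional codewords meeting in dimension 2.
  Counting the vectors on three-dimensional codewords of the dual code bounds that number. The outcome is
  that the sum of the squares of the defects is at most \<open>s (N/s - x - y) - z - s y w / (q \<mu>\<^sup>2)\<close>, so
  \<open>x + y \<le> N/s\<close> and only the codewords of the remaining dimensions cause an excess.

  A codeword \<open>W\<close> of dimension 5 defines a weight function on the two-dimensional subspaces which
  sums to 0 over those contained in any codeword of dimension 3 or 4; the weights of different codewords are
  orthogonal. By the Cauchy-Schwarz inequality, \<open>N/s - x - y\<close> is at least \<open>w (1 - q\<^sup>4/D)\<close> with
  \<open>D = q\<^sup>5 + 2q\<^sup>4 + 2q\<^sup>3 + 2q\<^sup>2 + q + 1\<close>, up to a small error if \<open>z > 0\<close>; testing also against the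
  subspaces that meet a codeword of dimension 1 or 2 absorbs this error. As the duals of the
  codewords of dimension 5 form a partial spread, \<open>w \<le> q\<^sup>5 + q\<^sup>3 + 1\<close>, and \<open>w q\<^sup>4/D\<close> is less than
  \<open>F(q) + 1 - N/s\<close>.
\<close>



section \<open>Subspaces over a finite field\<close>

text \<open>Each element of \<open>U\<close> is \<open>k *s b + y\<close> for exactly one scalar
  \<open>k\<close> and one \<open>y\<close> in \<open>K\<close>. This serves both to adjoin a basis
  vector to a span and to split a subspace along the kernel of a linear functional.\<close>

lemma card_direct_line:
  fixes b :: "'a::{field,finite} ^ 'n::finite"
  assumes K: "vec.subspace K" and U: "vec.subspace U" and KU: "K \<subseteq> U"
    and b: "b \<in> U" "b \<notin> K" and ex: "\<And>u. u \<in> U \<Longrightarrow> \<exists>k. u - k *s b \<in> K"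
  shows "card U = CARD('a) * card K"
proof -
  let ?f = "\<lambda>(k, y). k *s b + y"
  have "bij_betw ?f (UNIV \<times> K) U"
  proof (rule bij_betw_imageI)
    show "inj_on ?f (UNIV \<times> K)"
    proof (rule inj_onI, clarsimp)
      fix k y k' y' assume y: "y \<in> K" "y' \<in> K" and eq: "k *s b + y = k' *s b + y'"
      have "(k - k') *s b = y' - y" using eq by (simp add: vec.scale_left_diff_distrib algebra_simps)
      then have *: "(k - k') *s b \<in> K" using y K vec.subspace_diff by metis
      have "k = k'"
      proof (rule ccontr)
        assume "k \<noteq> k'"
        then have "b = inverse (k - k') *s ((k - k') *s b)" by simp
        then show False using * K b(2) vec.subspace_scale by metis
      qed
      then show "k = k' \<and> y = y'" using eq by simp
    qed
    show "?f ` (UNIV \<times> K) = U"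
    proof
      show "?f ` (UNIV \<times> K) \<subseteq> U"
        using KU b U by (auto intro!: vec.subspace_add vec.subspace_scale)
      show "U \<subseteq> ?f ` (UNIV \<times> K)"
      proof
        fix u assume "u \<in> U"
        then obtain k where "u - k *s b \<in> K" using ex by blast
        then have "(k, u - k *s b) \<in> UNIV \<times> K" "u = ?f (k, u - k *s b)" by auto
        then show "u \<in> ?f ` (UNIV \<times> K)" by blast
      qed
    qed
  qed
  then have "card (UNIV \<times> K :: ('a \<times> _) set) = card U" by (rule bij_betw_same_card)
  then show ?thesis by (simp add: card_cartesian_product)
qed

lemma card_span_independent:
  fixes B :: "('a::{field,finite} ^ 'n::finite) set"
  assumes "finite B" "vec.independent B"
  shows "card (vec.span B) = CARD('a) ^ card B"
  using assms
proof (induction B rule: finite_induct)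
  case empty then show ?case by simp
next
  case (insert b B)
  have "vec.independent B" and b: "b \<notin> vec.span B"
    using insert.prems insert.hyps vec.independent_insert[of b B] by auto
  have "card (vec.span (insert b B)) = CARD('a) * card (vec.span B)"
    by (rule card_direct_line[where b = b])
      (use b in \<open>auto simp: vec.span_breakdown_eq[symmetric] intro: vec.span_base vec.span_mono[THEN subsetD]\<close>)
  then show ?case using insert \<open>vec.independent B\<close> by simp
qed

lemma card_subspace:
  fixes U :: "('a::{field,finite} ^ 'n::finite) set"
  assumes "vec.subspace U"
  shows "card U = CARD('a) ^ vec.dim U"
proof -
  obtain B where B: "B \<subseteq> U" "vec.independent B" "U \<subseteq> vec.span B" "card B = vec.dim U"
    using vec.basis_exists[of U] by blast
  have "vec.span B = U" using B assms vec.span_subspace by blast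
  then show ?thesis using card_span_independent[of B] B(2,4) by simp
qed

lemma two_le_card_field: "2 \<le> CARD('a::{field,finite})"
proof -
  have "card {0, 1 :: 'a} \<le> CARD('a)" by (rule card_mono) auto
  then show ?thesis by simp
qed

section \<open>Orthogonal complements for the standard bilinear form\<close>

definition dotp :: "'a::field ^ 'n::finite \<Rightarrow> 'a ^ 'n \<Rightarrow> 'a" where
  "dotp h u = (\<Sum>i\<in>UNIV. h $ i * u $ i)"

definition orth :: "('a::field ^ 'n::finite) set \<Rightarrow> ('a ^ 'n) set" where
  "orth U = {h. \<forall>u\<in>U. dotp h u = 0}"

lemma dotp_commute: "dotp h u = dotp u h"
  unfolding dotp_def by (simp add: mult.commute)

lemma dotp_simps:
  "dotp h 0 = 0" "dotp 0 h = 0" "dotp h (u + v) = dotp h u + dotp h v" "dotp h (u - v) = dotp h u - dotp h v"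
  "dotp h (c *s u) = c * dotp h u" "dotp (h + k) u = dotp h u + dotp k u"
  "dotp (c *s h) u = c * dotp h u"
  unfolding dotp_def by (simp_all add: algebra_simps sum.distrib sum_subtractf sum_distrib_left)

lemma subspace_orth: "vec.subspace (orth U)"
  unfolding orth_def by (rule vec.subspaceI) (auto simp: dotp_simps)

lemma subspace_dotp_kernel:
  assumes "vec.subspace U"
  shows "vec.subspace {u \<in> U. dotp h u = 0}"
  using assms by (auto simp: vec.subspace_def dotp_simps)

lemma card_dotp_kernel:
  fixes U :: "('a::{field,finite} ^ 'n::finite) set"
  assumes U: "vec.subspace U" and u0: "u0 \<in> U" "dotp h u0 \<noteq> 0"
  shows "card U = CARD('a) * card {u \<in> U. dotp h u = 0}"
proof (rule card_direct_line[where b = u0])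
  fix u assume u: "u \<in> U"
  have "u - (dotp h u / dotp h u0) *s u0 \<in> {u \<in> U. dotp h u = 0}"
    using u u0 U by (auto simp: dotp_simps intro!: vec.subspace_diff vec.subspace_scale)
  then show "\<exists>k. u - k *s u0 \<in> {u \<in> U. dotp h u = 0}" by blast
qed (use U u0 subspace_dotp_kernel[OF U] in auto)

lemma card_dotp_hyperplane:
  fixes u :: "'a::{field,finite} ^ 'n::finite"
  assumes "u \<noteq> 0"
  shows "CARD('a ^ 'n) = CARD('a) * card {h. dotp u h = 0}"
proof -
  obtain i where i: "u $ i \<noteq> 0" using assms by (auto simp: vec_eq_iff)
  have "dotp u (axis i 1) = u $ i"
    unfolding dotp_def axis_def by (simp add: if_distrib cong: if_cong)
  then show ?thesis using card_dotp_kernel[of UNIV "axis i 1" u] i by simp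
qed

text \<open>Double counting of the pairs \<open>(h, u)\<close> with \<open>u\<close> in
  \<open>U\<close> and \<open>dotp h u = 0\<close>. For fixed \<open>h\<close> the solutions form
  all of \<open>U\<close> or a fraction 1/q of it, according to whether \<open>h\<close> lies in
  \<open>orth U\<close>; for fixed \<open>u\<close> they form the whole space or a fraction 1/q of
  it, according to whether \<open>u\<close> is zero. Both counts are multiplied by q to avoid
  division.\<close>

lemma card_orth:
  fixes U :: "('a::{field,finite} ^ 'n::finite) set"
  assumes U: "vec.subspace U"
  shows "card U * card (orth U) = CARD('a) ^ CARD('n)"
proof -
  let ?q = "CARD('a)" and ?Q = "CARD('a ^ 'n)"
  have Q: "?Q = ?q ^ CARD('n)" by (simp add: CARD_vec)
  have 0: "0 \<in> U" using U vec.subspace_0 by blast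
  have "(\<Sum>h\<in>UNIV. real (?q * card {u \<in> U. dotp h u = 0})) =
        (\<Sum>h\<in>UNIV. real (card U) + (if h \<in> orth U then (real ?q - 1) * real (card U) else 0))"
  proof (rule sum.cong[OF refl])
    fix h :: "'a ^ 'n"
    show "real (?q * card {u \<in> U. dotp h u = 0}) =
      real (card U) + (if h \<in> orth U then (real ?q - 1) * real (card U) else 0)"
    proof (cases "h \<in> orth U")
      case True
      then have "{u \<in> U. dotp h u = 0} = U" unfolding orth_def by auto
      then show ?thesis using True by (simp add: algebra_simps)
    next
      case False
      then obtain u0 where "u0 \<in> U" "dotp h u0 \<noteq> 0" unfolding orth_def by auto
      from card_dotp_kernel[OF U this] have "?q * card {u \<in> U. dotp h u = 0} = card U" by (rule sym)
      then show ?thesis using False by (simp only: if_False add_0_right)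
    qed
  qed
  also have "\<dots> = real ?Q * real (card U) + real (card (orth U)) * (real ?q - 1) * real (card U)"
    by (simp add: sum.distrib sum.If_cases)
  finally have 1: "(\<Sum>h\<in>UNIV. real (?q * card {u \<in> U. dotp h u = 0})) =
    real ?Q * real (card U) + real (card (orth U)) * (real ?q - 1) * real (card U)" .
  have "(\<Sum>h\<in>UNIV. card {u \<in> U. dotp h u = 0}) = (\<Sum>u\<in>U. card {h. dotp h u = 0})"
    using sum.swap_restrict[of "UNIV :: ('a^'n) set" U "\<lambda>_ _. 1 :: nat" "\<lambda>h u. dotp h u = 0"]
    by simp
  then have "(\<Sum>h\<in>UNIV. ?q * card {u \<in> U. dotp h u = 0}) = (\<Sum>u\<in>U. ?q * card {h. dotp h u = 0})"
    by (simp only: sum_distrib_left[symmetric])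
  then have "(\<Sum>h\<in>UNIV. real (?q * card {u \<in> U. dotp h u = 0})) = (\<Sum>u\<in>U. real (?q * card {h. dotp h u = 0}))"
    by (simp only: of_nat_sum[symmetric])
  also have "\<dots> = (\<Sum>u\<in>U. real ?Q + (if u = 0 then (real ?q - 1) * real ?Q else 0))"
  proof (rule sum.cong[OF refl])
    fix u :: "'a ^ 'n"
    show "real (?q * card {h. dotp h u = 0}) = real ?Q + (if u = 0 then (real ?q - 1) * real ?Q else 0)"
      using card_dotp_hyperplane[of u] by (cases "u = 0") (auto simp: dotp_simps dotp_commute[of _ u] algebra_simps)
  qed
  also have "\<dots> = real (card U) * real ?Q + (real ?q - 1) * real ?Q"
    using 0 by (simp add: sum.distrib)
  finally have "(\<Sum>h\<in>UNIV. real (?q * card {u \<in> U. dotp h u = 0})) =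
    real (card U) * real ?Q + (real ?q - 1) * real ?Q" .
  then have "real (card (orth U)) * (real ?q - 1) * real (card U) = (real ?q - 1) * real ?Q"
    using 1 by algebra
  moreover have "real ?q - 1 \<noteq> 0" using two_le_card_field[where 'a='a] by simp
  ultimately have "real (card (orth U)) * real (card U) = real ?Q"
    by (simp add: mult.assoc mult.left_commute)
  then have "real (card U * card (orth U)) = real ?Q" by (simp add: mult.commute)
  then show ?thesis using Q by (simp only: of_nat_eq_iff)
qed

lemma dim_orth:
  fixes U :: "('a::{field,finite} ^ 'n::finite) set"
  assumes U: "vec.subspace U"
  shows "vec.dim U + vec.dim (orth U) = CARD('n)"
proof -
  have "CARD('a) ^ (vec.dim U + vec.dim (orth U)) = CARD('a) ^ CARD('n)"
    using card_orth[OF U] card_subspace[OF U] card_subspace[OF subspace_orth[of U]]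
    by (simp add: power_add)
  then show ?thesis using two_le_card_field[where 'a='a] by simp
qed

text \<open>The form may have isotropic vectors, so \<open>orth U\<close> can meet \<open>U\<close>
  nontrivially; the obvious inclusion and the equality of dimensions still give the result.\<close>

lemma orth_orth:
  fixes U :: "('a::{field,finite} ^ 'n::finite) set"
  assumes U: "vec.subspace U"
  shows "orth (orth U) = U"
proof -
  have sub: "U \<subseteq> orth (orth U)" unfolding orth_def by (auto simp: dotp_commute)
  have "vec.dim (orth (orth U)) = vec.dim U"
    using dim_orth[OF U] dim_orth[OF subspace_orth[of U]] by simp
  then show ?thesis
    using vec.subspace_dim_equal[OF U subspace_orth sub] by simp
qed

lemma orth_mono: "U \<subseteq> W \<Longrightarrow> orth W \<subseteq> orth U"
  unfolding orth_def by auto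

section \<open>Sums of subspaces and the subspace distance\<close>

lemma set_plus_eq_sums: "U + W = {x + y |x y. x \<in> U \<and> y \<in> W}"
  by (auto simp: set_plus_def)

lemma subspace_plus: "vec.subspace U \<Longrightarrow> vec.subspace W \<Longrightarrow> vec.subspace (U + W)"
  using vec.subspace_sums[of U W] by (simp add: set_plus_eq_sums)

lemma dim_plus:
  assumes "vec.subspace U" "vec.subspace W"
  shows "vec.dim (U + W) + vec.dim (U \<inter> W) = vec.dim U + vec.dim W"
proof -
  show ?thesis using vec.dim_sums_Int[OF assms] by (simp add: set_plus_eq_sums)
qed

lemma orth_plus:
  assumes "vec.subspace U" "vec.subspace W"
  shows "orth (U + W) = orth U \<inter> orth W"
proof
  have "0 \<in> U" "0 \<in> W" using assms vec.subspace_0 by blast+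
  have "U \<subseteq> U + W" using \<open>0 \<in> W\<close> by (metis add.commute set_zero_plus2)
  moreover have "W \<subseteq> U + W" using \<open>0 \<in> U\<close> by (rule set_zero_plus2)
  ultimately show "orth (U + W) \<subseteq> orth U \<inter> orth W" using orth_mono by blast
  show "orth U \<inter> orth W \<subseteq> orth (U + W)"
    unfolding orth_def by (auto simp: set_plus_def dotp_simps)
qed

text \<open>The intersection of the complements is the complement of \<open>U + W\<close>. As its
  dimension is nonnegative, the equation also bounds \<open>vec.dim (U \<inter> W)\<close> from
  below.\<close>

lemma dim_orth_Int:
  fixes U W :: "('a::{field,finite} ^ 'n::finite) set"
  assumes "vec.subspace U" "vec.subspace W"
  shows "vec.dim (orth U \<inter> orth W) + vec.dim U + vec.dim W = CARD('n) + vec.dim (U \<inter> W)"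
  using dim_orth[OF subspace_plus[OF assms]] dim_plus[OF assms] by (simp add: orth_plus[OF assms])

lemma subspace_dist_eq:
  assumes "vec.subspace U" "vec.subspace W"
  shows "int (subspace_dist U W) = int (vec.dim U) + int (vec.dim W) - 2 * int (vec.dim (U \<inter> W))"
proof -
  have "vec.dim (U \<inter> W) \<le> vec.dim U" "vec.dim (U \<inter> W) \<le> vec.dim W"
    by (auto intro: vec.dim_subset)
  then show ?thesis using dim_plus[OF assms] unfolding subspace_dist_def by simp
qed

lemma subspace_dist_orth:
  fixes U W :: "('a::{field,finite} ^ 'n::finite) set"
  assumes "vec.subspace U" "vec.subspace W"
  shows "subspace_dist (orth U) (orth W) = subspace_dist U W"
proof -
  have "int (subspace_dist (orth U) (orth W)) = int (subspace_dist U W)"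
    using subspace_dist_eq[OF assms] subspace_dist_eq[OF subspace_orth subspace_orth, of U W]
      dim_orth_Int[OF assms] dim_orth[OF assms(1)] dim_orth[OF assms(2)] by linarith
  then show ?thesis by simp
qed


section \<open>Counting two-dimensional subspaces\<close>

text \<open>These are the lines of the associated projective space. In the same language, subspaces
  of dimension 3 and 4 are called planes and solids below.\<close>

definition lines_in :: "('a::field ^ 'n::finite) set \<Rightarrow> ('a ^ 'n) set set" where
  "lines_in X = {L. vec.subspace L \<and> vec.dim L = 2 \<and> L \<subseteq> X}"

lemma lines_in_mono: "X \<subseteq> Y \<Longrightarrow> lines_in X = {L \<in> lines_in Y. L \<subseteq> X}"
  unfolding lines_in_def by auto

lemma card_line_span:
  fixes u :: "'a::{field,finite} ^ 'n::finite"
  assumes "u \<noteq> 0"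
  shows "card (vec.span {u}) = CARD('a)"
  using card_span_independent[of "{u}"] assms by (simp add: vec.dependent_single)

lemma dim_span_pair:
  fixes u v :: "'a::{field,finite} ^ 'n::finite"
  assumes "u \<noteq> 0" "v \<notin> vec.span {u}"
  shows "vec.dim (vec.span {u, v}) = 2"
proof -
  have "vec.independent {v, u}"
    using assms vec.independent_insert[of v "{u}"] by (auto simp: vec.dependent_single)
  moreover have "v \<noteq> u" using assms(2) vec.span_base by blast
  ultimately show ?thesis
    using vec.dim_span_eq_card_independent[of "{v, u}"] by (simp add: insert_commute)
qed

lemma line_eq_span_pair:
  fixes u v :: "'a::{field,finite} ^ 'n::finite"
  assumes "L \<in> lines_in X" "u \<in> L" "v \<in> L" "u \<noteq> 0" "v \<notin> vec.span {u}"
  shows "L = vec.span {u, v}"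
proof -
  have L: "vec.subspace L" "vec.dim L = 2" using assms(1) unfolding lines_in_def by auto
  have "vec.span {u, v} \<subseteq> L" by (rule vec.span_minimal) (use assms L in auto)
  then show ?thesis
    using vec.subspace_dim_equal[OF vec.subspace_span L(1), of "{u, v}"] L(2) dim_span_pair[OF assms(4,5)] by auto
qed

lemma span_pair_in_lines:
  fixes u v :: "'a::{field,finite} ^ 'n::finite"
  assumes "vec.subspace X" "u \<in> X" "v \<in> X" "u \<noteq> 0" "v \<notin> vec.span {u}"
  shows "vec.span {u, v} \<in> lines_in X"
  using assms dim_span_pair[OF assms(4,5)] vec.span_minimal[of "{u, v}" X]
  unfolding lines_in_def by auto

text \<open>The lines through \<open>u\<close> partition the vectors of \<open>X\<close> outside
  \<open>vec.span {u}\<close>, and each of them contributes q^2 - q vectors.\<close>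

lemma card_lines_through_nat:
  fixes X :: "('a::{field,finite} ^ 'n::finite) set"
  assumes X: "vec.subspace X" and u: "u \<in> X" "u \<noteq> 0"
  shows "card {L \<in> lines_in X. u \<in> L} * (CARD('a)^2 - CARD('a)) = CARD('a) ^ vec.dim X - CARD('a)"
proof -
  let ?S = "vec.span {u}" and ?F = "{L \<in> lines_in X. u \<in> L}"
  have eq: "X - ?S = (\<Union>L\<in>?F. L - ?S)"
  proof
    show "X - ?S \<subseteq> (\<Union>L\<in>?F. L - ?S)"
    proof
      fix v assume v: "v \<in> X - ?S"
      then have "vec.span {u, v} \<in> ?F" using span_pair_in_lines[OF X u(1)] u(2) vec.span_base[of u "{u, v}"] by auto
      moreover have "v \<in> vec.span {u, v} - ?S" using v vec.span_base[of v "{u, v}"] by auto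
      ultimately show "v \<in> (\<Union>L\<in>?F. L - ?S)" by blast
    qed
  qed (auto simp: lines_in_def)
  have "card (X - ?S) = (\<Sum>L\<in>?F. card (L - ?S))"
    unfolding eq
  proof (rule card_UN_disjoint)
    show "\<forall>L\<in>?F. \<forall>L'\<in>?F. L \<noteq> L' \<longrightarrow> (L - ?S) \<inter> (L' - ?S) = {}"
      using line_eq_span_pair[OF _ _ _ u(2)] by blast
  qed auto
  also have "\<dots> = (\<Sum>L\<in>?F. CARD('a)^2 - CARD('a))"
  proof (rule sum.cong[OF refl])
    fix L assume "L \<in> ?F"
    then have L: "vec.subspace L" "vec.dim L = 2" "u \<in> L" unfolding lines_in_def by auto
    have "?S \<subseteq> L" using L by (intro vec.span_minimal) auto
    then show "card (L - ?S) = CARD('a)^2 - CARD('a)"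
      using card_subspace[OF L(1)] L(2) card_line_span[OF u(2)] by (simp add: card_Diff_subset)
  qed
  also have "\<dots> = card ?F * (CARD('a)^2 - CARD('a))" by simp
  finally have "card (X - ?S) = \<dots>" .
  moreover have "?S \<subseteq> X" using X u by (intro vec.span_minimal) auto
  ultimately show ?thesis
    using card_subspace[OF X] card_line_span[OF u(2)] by (simp add: card_Diff_subset)
qed

lemma Suc_card_minus_zero:
  fixes A :: "('b::{zero,finite}) set"
  shows "0 \<in> A \<Longrightarrow> Suc (card (A - {0})) = card A"
  by (rule card_Suc_Diff1) simp_all

text \<open>Exchange of summation over incident pairs of a vector and a set, the sets being weighted
  by \<open>F\<close>.\<close>

lemma sum_card_Int:
  fixes F :: "'b set \<Rightarrow> real"
  assumes "finite \<L>" "finite A"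
  shows "(\<Sum>L\<in>\<L>. F L * real (card (L \<inter> A))) = (\<Sum>v\<in>A. \<Sum>L | L \<in> \<L> \<and> v \<in> L. F L)"
proof -
  have "(\<Sum>L\<in>\<L>. F L * real (card (L \<inter> A))) = (\<Sum>L\<in>\<L>. \<Sum>v | v \<in> A \<and> v \<in> L. F L)"
  proof (rule sum.cong[OF refl])
    fix L
    have "{v. v \<in> A \<and> v \<in> L} = L \<inter> A" by auto
    then show "F L * real (card (L \<inter> A)) = (\<Sum>v | v \<in> A \<and> v \<in> L. F L)" by simp
  qed
  also have "\<dots> = (\<Sum>v\<in>A. \<Sum>L | L \<in> \<L> \<and> v \<in> L. F L)"
    by (rule sum.swap_restrict[OF assms])
  finally show ?thesis .
qed

lemma sum_incidence:
  fixes F :: "'b \<Rightarrow> real"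
  assumes "finite \<L>" "finite P"
  shows "(\<Sum>L\<in>\<L>. F L * real (card {S \<in> P. R L S})) = (\<Sum>S\<in>P. \<Sum>L | L \<in> \<L> \<and> R L S. F L)"
proof -
  have "(\<Sum>L\<in>\<L>. F L * real (card {S \<in> P. R L S})) = (\<Sum>L\<in>\<L>. \<Sum>S | S \<in> P \<and> R L S. F L)"
    by (simp add: mult.commute)
  also have "\<dots> = (\<Sum>S\<in>P. \<Sum>L | L \<in> \<L> \<and> R L S. F L)"
    by (rule sum.swap_restrict[OF assms])
  finally show ?thesis .
qed

section \<open>Gaussian counts with \<open>q\<close> as a real number\<close>

locale finite_field_size =
  fixes q :: real and F :: "'a::{field,finite} itself"
  assumes q_eq: "q = real CARD('a)"
begin

lemma q_ge_2: "2 \<le> q"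
  using two_le_card_field[where 'a='a] unfolding q_eq by simp

lemma q_pos: "0 < q" "1 < q" "q \<noteq> 0" "q - 1 \<noteq> 0" "0 < q - 1" "q + 1 \<noteq> 0" "0 < q + 1"
  using q_ge_2 by auto

lemma real_card_subspace:
  fixes U :: "('a ^ 'n::finite) set"
  shows "vec.subspace U \<Longrightarrow> real (card U) = q ^ vec.dim U"
  using card_subspace[of U] unfolding q_eq by simp

lemma real_card_nonzero:
  fixes U :: "('a ^ 'n::finite) set"
  assumes "vec.subspace U"
  shows "real (card (U - {0})) = q ^ vec.dim U - 1"
proof -
  have "0 \<in> U" using assms vec.subspace_0 by blast
  from Suc_card_minus_zero[OF this] have "real (card (U - {0})) = real (card U) - 1" by linarith
  then show ?thesis using real_card_subspace[OF assms] by simp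
qed

lemma card_lines_through:
  fixes X :: "('a ^ 'n::finite) set"
  assumes X: "vec.subspace X" "vec.dim X = Suc k" and u: "u \<in> X" "u \<noteq> 0"
  shows "(q - 1) * real (card {L \<in> lines_in X. u \<in> L}) = q ^ k - 1"
proof -
  let ?c = "card {L \<in> lines_in X. u \<in> L}" and ?r = "CARD('a)"
  have "?r \<le> ?r ^ 2" "?r \<le> ?r ^ Suc k"
    using two_le_card_field[where 'a='a] by (simp_all only: self_le_power zero_less_Suc pos2)
  then have r: "real (?r ^ 2 - ?r) = q ^ 2 - q" "real (?r ^ Suc k - ?r) = q ^ Suc k - q"
    unfolding q_eq by (simp_all only: of_nat_diff of_nat_power)
  have "real ?c * real (?r ^ 2 - ?r) = real (?r ^ Suc k - ?r)"
    using card_lines_through_nat[OF X(1) u] unfolding X(2) by (simp only: of_nat_mult[symmetric])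
  then have "real ?c * (q ^ 2 - q) = q ^ Suc k - q" unfolding r .
  then have "q * ((q - 1) * real ?c) = q * (q ^ k - 1)"
    by (simp add: power2_eq_square algebra_simps)
  then show ?thesis by (simp only: mult_cancel_left q_pos(3) simp_thms)
qed

lemma card_lines_through_two:
  fixes u v :: "'a ^ 'n::finite"
  assumes "u \<noteq> 0" "v \<notin> vec.span {u}"
  shows "card {L \<in> lines_in UNIV. u \<in> L \<and> v \<in> L} = 1"
proof -
  have "vec.span {u, v} \<in> {L \<in> lines_in UNIV. u \<in> L \<and> v \<in> L}"
    using span_pair_in_lines[OF vec.subspace_UNIV _ _ assms] vec.span_base[of u "{u, v}"]
      vec.span_base[of v "{u, v}"] by simp
  moreover have "L = vec.span {u, v}" if "L \<in> {L \<in> lines_in UNIV. u \<in> L \<and> v \<in> L}" for L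
    using that line_eq_span_pair[OF _ _ _ assms, of L] by blast
  ultimately have "{L \<in> lines_in UNIV. u \<in> L \<and> v \<in> L} = {vec.span {u, v}}" by blast
  then show ?thesis by simp
qed

text \<open>Incident pairs of a nonzero vector and a line are counted in two ways. The result is a
  Gaussian binomial coefficient with its denominator multiplied out.\<close>

lemma card_lines_in:
  fixes X :: "('a ^ 'n::finite) set"
  assumes X: "vec.subspace X" "vec.dim X = Suc k"
  shows "(q - 1)\<^sup>2 * (q + 1) * real (card (lines_in X)) = (q ^ Suc k - 1) * (q ^ k - 1)"
proof -
  have "(\<Sum>L\<in>lines_in X. 1 * real (card (L \<inter> (X - {0})))) =
        (\<Sum>v\<in>X - {0}. \<Sum>L | L \<in> lines_in X \<and> v \<in> L. 1)"
    by (rule sum_card_Int) auto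
  moreover have "real (card (L \<inter> (X - {0}))) = q ^ 2 - 1" if "L \<in> lines_in X" for L
  proof -
    have "L \<inter> (X - {0}) = L - {0}" using that unfolding lines_in_def by auto
    then show ?thesis using that real_card_nonzero[of L] unfolding lines_in_def by auto
  qed
  ultimately have "real (card (lines_in X)) * (q ^ 2 - 1) = (\<Sum>v\<in>X - {0}. real (card {L \<in> lines_in X. v \<in> L}))"
    by simp
  then have "(q - 1) * (real (card (lines_in X)) * (q ^ 2 - 1)) =
      (\<Sum>v\<in>X - {0}. (q - 1) * real (card {L \<in> lines_in X. v \<in> L}))"
    by (simp add: sum_distrib_left)
  also have "\<dots> = (\<Sum>v\<in>X - {0}. q ^ k - 1)"
    by (rule sum.cong) (use card_lines_through[OF X] in auto)
  also have "\<dots> = (q ^ Suc k - 1) * (q ^ k - 1)"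
    using real_card_nonzero[OF X(1)] X(2) by simp
  finally show ?thesis by (simp add: power2_eq_square algebra_simps)
qed

end

section \<open>Partial line spreads of the seven-dimensional space\<close>

text \<open>
  If there are \<open>q\<^sup>5 + q\<^sup>3 + 1 + \<epsilon>\<close> members, then the number of uncovered points on each hyperplane is
  congruent to \<open>-\<epsilon>\<close> modulo \<open>q\<close>. For \<open>\<epsilon> > 0\<close> it is therefore at least \<open>q - \<epsilon>\<close>, which exceeds its average.
\<close>

lemma partial_spread_bound:
  fixes Z :: "('a::{field,finite} ^ 7) set set"
  assumes Z: "Z \<subseteq> lines_in UNIV" and disj: "\<And>L L'. L \<in> Z \<Longrightarrow> L' \<in> Z \<Longrightarrow> L \<noteq> L' \<Longrightarrow> L \<inter> L' = {0}"
  shows "card Z \<le> CARD('a) ^ 5 + CARD('a) ^ 3 + 1"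
proof (rule ccontr)
  interpret finite_field_size "real CARD('a)" "TYPE('a)" by standard simp
  define Q where "Q = int CARD('a)"
  define z where "z = int (card Z)"
  assume "\<not> ?thesis"
  then have "CARD('a) ^ 5 + CARD('a) ^ 3 + 1 < card Z" by simp
  then have "int (CARD('a) ^ 5 + CARD('a) ^ 3 + 1) < int (card Z)" by (simp only: of_nat_less_iff)
  then have z: "Q ^ 5 + Q ^ 3 + 1 < z" unfolding Q_def z_def by simp
  \<comment> \<open>The excess over the claimed bound, written \<epsilon> above.\<close>
  define e where "e = z - (Q ^ 5 + Q ^ 3 + 1)"
  have e: "1 \<le> e" using z unfolding e_def by simp
  have Q: "2 \<le> Q" using two_le_card_field[where 'a='a] unfolding Q_def by simp
  let ?H = "\<lambda>h::'a^7. {u. dotp h u = 0}"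
  \<comment> \<open>The holes: nonzero vectors on no member of \<open>Z\<close>.\<close>
  define Ho where "Ho = UNIV - {0} - (\<Union>L\<in>Z. L - {0})"
  have Lsub: "vec.subspace L" "card L = CARD('a) ^ 2" "0 \<in> L" if "L \<in> Z" for L
    using that Z card_subspace[of L] vec.subspace_0[of L] unfolding lines_in_def by auto
  have part: "int (card (A - {0})) = int (card (Ho \<inter> A)) + (\<Sum>L\<in>Z. int (card (L \<inter> A - {0})))"
    for A :: "('a ^ 7) set"
  proof -
    have "A - {0} = (Ho \<inter> A) \<union> (\<Union>L\<in>Z. L \<inter> A - {0})" unfolding Ho_def by auto
    moreover have "(Ho \<inter> A) \<inter> (\<Union>L\<in>Z. L \<inter> A - {0}) = {}" unfolding Ho_def by auto
    ultimately have "card (A - {0}) = card (Ho \<inter> A) + card (\<Union>L\<in>Z. L \<inter> A - {0})"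
      by (metis card_Un_disjoint finite)
    moreover have "card (\<Union>L\<in>Z. L \<inter> A - {0}) = (\<Sum>L\<in>Z. card (L \<inter> A - {0}))"
      by (rule card_UN_disjoint) (use disj in auto)
    ultimately show ?thesis by simp
  qed
  have "int (card (UNIV - {0} :: ('a^7) set)) = Q ^ 7 - 1"
    using Suc_card_minus_zero[of "UNIV :: ('a^7) set"] unfolding Q_def
    by (simp flip: of_nat_power, linarith?)
  moreover have "int (card (L - {0})) = Q ^ 2 - 1" if "L \<in> Z" for L
    using Lsub[OF that] Suc_card_minus_zero[of L] unfolding Q_def
    by (simp flip: of_nat_power, linarith?)
  ultimately have Ho: "int (card Ho) = Q ^ 7 - 1 - z * (Q ^ 2 - 1)"
    using part[of UNIV] unfolding z_def by simp
  have cardH: "int (card (?H h - {0})) = Q ^ 6 - 1" if "h \<noteq> 0" for h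
  proof -
    have "CARD('a) * CARD('a) ^ 6 = CARD('a) * card (?H h)"
      using card_dotp_hyperplane[OF that] by (simp add: power_Suc[symmetric])
    then have "card (?H h) = CARD('a) ^ 6" by simp
    then show ?thesis using Suc_card_minus_zero[of "?H h"] unfolding Q_def
      by (simp add: dotp_simps flip: of_nat_power, linarith?)
  qed
  have lower: "(Q - 1) * (Q - e) \<le> int (card (Ho \<inter> ?H h))" if h: "h \<noteq> 0" for h
  proof -
    define n where "n = int (card {L \<in> Z. L \<subseteq> ?H h})"
    have "int (card (L \<inter> ?H h - {0})) = (Q - 1) + (if L \<subseteq> ?H h then Q ^ 2 - Q else 0)" if "L \<in> Z" for L
    proof -
      have "0 \<in> L \<inter> ?H h" using Lsub[OF that] by (simp add: dotp_simps)
      from Suc_card_minus_zero[OF this]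
      have c: "int (card (L \<inter> ?H h - {0})) = int (card (L \<inter> ?H h)) - 1" by linarith
      show ?thesis
      proof (cases "L \<subseteq> ?H h")
        case True
        then have "L \<inter> ?H h = L" by auto
        then show ?thesis using c True Lsub[OF that] unfolding Q_def by simp
      next
        case False
        then obtain u0 where "u0 \<in> L" "dotp h u0 \<noteq> 0" by auto
        from card_dotp_kernel[OF Lsub(1)[OF that] this]
        have "CARD('a) * CARD('a) = CARD('a) * card {u \<in> L. dotp h u = 0}"
          using Lsub(2)[OF that] by (simp add: power2_eq_square)
        moreover have "{u \<in> L. dotp h u = 0} = L \<inter> ?H h" by auto
        ultimately have "card (L \<inter> ?H h) = CARD('a)" by simp
        then show ?thesis using c False unfolding Q_def by simp
      qed
    qed
    then have "(\<Sum>L\<in>Z. int (card (L \<inter> ?H h - {0}))) = (\<Sum>L\<in>Z. (Q - 1) + (if L \<subseteq> ?H h then Q ^ 2 - Q else 0))"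
      by (rule sum.cong[OF refl])
    also have "\<dots> = z * (Q - 1) + n * (Q ^ 2 - Q)"
      unfolding z_def n_def by (simp add: sum.distrib sum.If_cases Int_def)
    finally have "Q ^ 6 - 1 = int (card (Ho \<inter> ?H h)) + (z * (Q - 1) + n * (Q ^ 2 - Q))"
      using part[of "?H h"] cardH[OF h] by simp
    \<comment> \<open>Here \<open>n\<close> members lie inside the hyperplane. Since
      \<open>e\<close> is positive, nonnegativity of this count forces the integer
      \<open>Q ^ 3 + Q + 1 - n\<close> to be at least 1.\<close>
    then have eq: "int (card (Ho \<inter> ?H h)) = (Q - 1) * (Q * (Q ^ 3 + Q + 1 - n) - e)"
      unfolding e_def by algebra
    then have "0 \<le> (Q - 1) * (Q * (Q ^ 3 + Q + 1 - n) - e)" by (metis of_nat_0_le_iff)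
    then have "0 \<le> Q * (Q ^ 3 + Q + 1 - n) - e" using Q by (simp add: zero_le_mult_iff)
    then have "0 < Q * (Q ^ 3 + Q + 1 - n)" using e by linarith
    then have "1 \<le> Q ^ 3 + Q + 1 - n" using Q by (simp add: zero_less_mult_iff)
    then have "Q * 1 \<le> Q * (Q ^ 3 + Q + 1 - n)" using Q by (intro mult_left_mono) auto
    then show ?thesis unfolding eq using Q by (intro mult_left_mono) auto
  qed
  \<comment> \<open>Summation over all nonzero functionals; each hole is annihilated by
    \<open>Q ^ 6 - 1\<close> of them. For \<open>e > Q\<close> the lower bound is negative, and the
    comparison still leads to a contradiction.\<close>
  have "(Q ^ 7 - 1) * ((Q - 1) * (Q - e)) = (\<Sum>h\<in>UNIV - {0 :: 'a^7}. (Q - 1) * (Q - e))"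
    using \<open>int (card (UNIV - {0} :: ('a^7) set)) = Q ^ 7 - 1\<close> by simp
  also have "\<dots> \<le> (\<Sum>h\<in>UNIV - {0}. int (card (Ho \<inter> ?H h)))"
    by (rule sum_mono) (use lower in auto)
  also have "\<dots> = int (\<Sum>h\<in>UNIV - {0}. \<Sum>v | v \<in> Ho \<and> dotp h v = 0. 1)"
    by (simp add: Int_def)
  also have "(\<Sum>h\<in>UNIV - {0}. \<Sum>v | v \<in> Ho \<and> dotp h v = 0. 1) =
      (\<Sum>v\<in>Ho. \<Sum>h | h \<in> UNIV - {0} \<and> dotp h v = 0. (1::nat))"
    by (rule sum.swap_restrict) auto
  also have "int \<dots> = (\<Sum>v\<in>Ho. Q ^ 6 - 1)"
  proof -
    have "int (card {h. h \<in> UNIV - {0} \<and> dotp h v = 0}) = Q ^ 6 - 1" if "v \<in> Ho" for v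
    proof -
      have "v \<noteq> 0" using that unfolding Ho_def by auto
      moreover have "{h. h \<in> UNIV - {0} \<and> dotp h v = 0} = ?H v - {0}"
        by (auto simp: dotp_commute)
      ultimately show ?thesis using cardH by simp
    qed
    then show ?thesis by simp
  qed
  also have "\<dots> = (Q ^ 7 - 1 - z * (Q ^ 2 - 1)) * (Q ^ 6 - 1)" using Ho by simp
  finally have "(Q ^ 7 - 1) * ((Q - 1) * (Q - e)) \<le> (Q ^ 7 - 1 - z * (Q ^ 2 - 1)) * (Q ^ 6 - 1)" .
  moreover have "(Q ^ 7 - 1) * ((Q - 1) * (Q - e)) - (Q ^ 7 - 1 - z * (Q ^ 2 - 1)) * (Q ^ 6 - 1) =
    (Q - 1) * (Q * (Q - 1) + e * (Q * (Q ^ 5 - 1)))"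
    unfolding e_def by algebra
  moreover have "0 < (Q - 1) * (Q * (Q - 1) + e * (Q * (Q ^ 5 - 1)))"
  proof -
    have "1 \<le> Q ^ 5" using Q by (intro one_le_power) simp
    then have "0 \<le> e * (Q * (Q ^ 5 - 1))" using Q e by (intro mult_nonneg_nonneg) simp_all
    moreover have "0 < Q * (Q - 1)" using Q by (intro mult_pos_pos) linarith+
    ultimately have "0 < Q * (Q - 1) + e * (Q * (Q ^ 5 - 1))" by (rule add_pos_nonneg[rotated])
    then show ?thesis using Q by (intro mult_pos_pos) simp_all
  qed
  ultimately show False by linarith
qed


section \<open>A weight function attached to a five-dimensional subspace\<close>

context finite_field_size
begin

text \<open>A vector of \<open>A\<close> on \<open>vec.span {v}\<close> lies on every line through
  \<open>v\<close>; any other vector of \<open>A\<close> lies on exactly one of them.\<close>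

lemma sum_of_card_through_pair:
  fixes v :: "'a ^ 'n::finite"
  assumes "v \<noteq> 0" and A: "0 \<notin> A"
  shows "(\<Sum>a\<in>A. real (card {L \<in> lines_in UNIV. v \<in> L \<and> a \<in> L})) =
    real (card (A \<inter> vec.span {v})) * real (card {L \<in> lines_in UNIV. v \<in> L}) + real (card (A - vec.span {v}))"
proof -
  have 1: "{L \<in> lines_in UNIV. v \<in> L \<and> a \<in> L} = {L \<in> lines_in UNIV. v \<in> L}"
    if "a \<in> vec.span {v}" for a
  proof -
    have "a \<in> L" if "L \<in> lines_in UNIV" "v \<in> L" for L
      using vec.span_minimal[of "{v}" L] that \<open>a \<in> vec.span {v}\<close> unfolding lines_in_def by auto
    then show ?thesis by blast
  qed
  have "(\<Sum>a\<in>A. real (card {L \<in> lines_in UNIV. v \<in> L \<and> a \<in> L})) =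
    (\<Sum>a\<in>A \<inter> vec.span {v}. real (card {L \<in> lines_in UNIV. v \<in> L \<and> a \<in> L})) +
    (\<Sum>a\<in>A - vec.span {v}. real (card {L \<in> lines_in UNIV. v \<in> L \<and> a \<in> L}))"
    by (subst sum.union_disjoint[symmetric]) (auto simp: Int_Diff_Un)
  also have "\<dots> = (\<Sum>a\<in>A \<inter> vec.span {v}. real (card {L \<in> lines_in UNIV. v \<in> L})) +
    (\<Sum>a\<in>A - vec.span {v}. 1)"
    by (intro arg_cong2[where f = "(+)"] sum.cong) (use assms card_lines_through_two in \<open>auto simp: 1\<close>)
  finally show ?thesis by simp
qed

text \<open>
  For \<open>L\<close> of dimension 2 and \<open>W\<close> of dimension 5 this is \<open>q - 1\<close> times \<open>q\<^sup>3 (q + 1)\<close>, \<open>-q\<^sup>2\<close> or \<open>q + 1\<close>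
  according as \<open>L \<inter> W\<close> has dimension 2, 1 or 0.
\<close>

definition weight :: "('a ^ 7) set \<Rightarrow> ('a ^ 7) set \<Rightarrow> real" where
  "weight W L = (q\<^sup>2 - 1) - (q\<^sup>2 + q + 1) * real (card (L \<inter> (W - {0})))
     + q * (q\<^sup>2 - 1) * (q\<^sup>2 + q + 1) * of_bool (L \<subseteq> W)"

text \<open>The three terms of \<open>weight\<close> account for the lines of \<open>X\<close>, the
  incidences of these lines with the nonzero vectors of \<open>X \<inter> W\<close>, and the lines
  of \<open>X \<inter> W\<close>. The sums below for particular dimensions of \<open>X\<close> are
  instances.\<close>

lemma sum_weight_lines_in:
  assumes X: "vec.subspace X" "vec.dim X = Suc k" and W: "vec.subspace W" and d: "vec.dim (X \<inter> W) = Suc d"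
  shows "(q - 1) * (\<Sum>L\<in>lines_in X. weight W L) =
    (q ^ Suc k - 1) * (q ^ k - 1) - (q\<^sup>2 + q + 1) * (q ^ Suc d - 1) * (q ^ k - 1)
      + q * (q\<^sup>2 + q + 1) * (q ^ Suc d - 1) * (q ^ d - 1)"
proof -
  have XW: "vec.subspace (X \<inter> W)" using X W vec.subspace_inter by blast
  have "(\<Sum>L\<in>lines_in X. 1 * real (card (L \<inter> (W - {0})))) = (\<Sum>v\<in>W - {0}. \<Sum>L | L \<in> lines_in X \<and> v \<in> L. 1)"
    by (rule sum_card_Int) auto
  also have "\<dots> = (\<Sum>v\<in>X \<inter> W - {0}. \<Sum>L | L \<in> lines_in X \<and> v \<in> L. 1)"
    by (rule sum.mono_neutral_right) (auto simp: lines_in_def)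
  finally have "(q - 1) * (\<Sum>L\<in>lines_in X. real (card (L \<inter> (W - {0})))) =
      (\<Sum>v\<in>X \<inter> W - {0}. (q - 1) * real (card {L \<in> lines_in X. v \<in> L}))"
    by (simp add: sum_distrib_left)
  also have "\<dots> = (\<Sum>v\<in>X \<inter> W - {0}. q ^ k - 1)"
    by (rule sum.cong) (use card_lines_through[OF X] in auto)
  also have "\<dots> = (q ^ Suc d - 1) * (q ^ k - 1)"
    using real_card_nonzero[OF XW] d by simp
  finally have 1: "(q - 1) * (\<Sum>L\<in>lines_in X. real (card (L \<inter> (W - {0})))) = (q ^ Suc d - 1) * (q ^ k - 1)" .
  have "{L \<in> lines_in X. L \<subseteq> W} = lines_in (X \<inter> W)" unfolding lines_in_def by auto
  then have "(\<Sum>L\<in>lines_in X. of_bool (L \<subseteq> W)) = real (card (lines_in (X \<inter> W)))"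
    by (simp add: of_bool_def sum.If_cases Int_def)
  then have "(\<Sum>L\<in>lines_in X. weight W L) = (q\<^sup>2 - 1) * real (card (lines_in X))
      - (q\<^sup>2 + q + 1) * (\<Sum>L\<in>lines_in X. real (card (L \<inter> (W - {0}))))
      + q * (q\<^sup>2 - 1) * (q\<^sup>2 + q + 1) * real (card (lines_in (X \<inter> W)))"
    unfolding weight_def by (simp add: sum.distrib sum_subtractf sum_distrib_left[symmetric])
  then have "(q - 1) * (\<Sum>L\<in>lines_in X. weight W L) = (q - 1)\<^sup>2 * (q + 1) * real (card (lines_in X))
      - (q\<^sup>2 + q + 1) * ((q - 1) * (\<Sum>L\<in>lines_in X. real (card (L \<inter> (W - {0})))))
      + q * (q\<^sup>2 + q + 1) * ((q - 1)\<^sup>2 * (q + 1) * real (card (lines_in (X \<inter> W))))"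
    by algebra
  then show ?thesis
    unfolding card_lines_in[OF X] card_lines_in[OF XW d] 1 by simp
qed

text \<open>For codewords of dimensions 3 and 5 the intersection has dimension at most 2 by the
  minimum distance and at least 1 by the ambient dimension. The coefficients of
  \<open>weight\<close> make the sum vanish in both cases.\<close>

lemma sum_weight_plane:
  assumes X: "vec.subspace X" "vec.dim X = 3" and W: "vec.subspace W" and d: "vec.dim (X \<inter> W) \<in> {1, 2}"
  shows "(\<Sum>L\<in>lines_in X. weight W L) = 0"
proof -
  have "(q - 1) * (\<Sum>L\<in>lines_in X. weight W L) = 0"
    using d sum_weight_lines_in[of X 2 W 0] sum_weight_lines_in[of X 2 W 1] X W
    by (auto simp: numeral_eq_Suc) (simp_all add: algebra_simps)
  then show ?thesis using q_pos(4) by simp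
qed

text \<open>For codewords of dimensions 4 and 5 the distance and the ambient dimension leave 2 as
  the only dimension of the intersection.\<close>

lemma sum_weight_solid:
  assumes X: "vec.subspace X" "vec.dim X = 4" and W: "vec.subspace W" and d: "vec.dim (X \<inter> W) = 2"
  shows "(\<Sum>L\<in>lines_in X. weight W L) = 0"
proof -
  have "(q - 1) * (\<Sum>L\<in>lines_in X. weight W L) = 
    (q ^ 4 - 1) * (q ^ 3 - 1) - (q\<^sup>2 + q + 1) * (q ^ 2 - 1) * (q ^ 3 - 1)
      + q * (q\<^sup>2 + q + 1) * (q ^ 2 - 1) * (q - 1)"
    using sum_weight_lines_in[of X 3 W 1] X W d by (simp add: numeral_eq_Suc)
  also have "\<dots> = 0" by algebra
  finally show ?thesis using q_pos(4) by simp
qed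

lemma sum_weight_all:
  assumes W: "vec.subspace W" "vec.dim W = 5"
  shows "(\<Sum>L\<in>lines_in UNIV. weight W L) = (q\<^sup>2 + 1) * q ^ 3 * (q\<^sup>2 + q + 1) * (q\<^sup>2 - 1)"
proof -
  have "vec.dim (UNIV :: ('a^7) set) = 7" by (simp add: card_cart_basis)
  then have "(q - 1) * (\<Sum>L\<in>lines_in UNIV. weight W L) = 
    (q ^ 7 - 1) * (q ^ 6 - 1) - (q\<^sup>2 + q + 1) * (q ^ 5 - 1) * (q ^ 6 - 1)
      + q * (q\<^sup>2 + q + 1) * (q ^ 5 - 1) * (q ^ 4 - 1)"
    using sum_weight_lines_in[of UNIV 6 W 4] W by simp
  also have "\<dots> = (q - 1) * ((q\<^sup>2 + 1) * q ^ 3 * (q\<^sup>2 + q + 1) * (q\<^sup>2 - 1))" by algebra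
  finally show ?thesis by (simp only: mult_cancel_left q_pos(4) simp_thms)
qed

lemma sum_weight_five:
  assumes X: "vec.subspace X" "vec.dim X = 5" and W: "vec.subspace W" and d: "vec.dim (X \<inter> W) = Suc d"
  shows "(q - 1) * (\<Sum>L\<in>lines_in X. weight W L) = 
    (q ^ 5 - 1) * (q ^ 4 - 1) - (q\<^sup>2 + q + 1) * (q ^ Suc d - 1) * (q ^ 4 - 1)
      + q * (q\<^sup>2 + q + 1) * (q ^ Suc d - 1) * (q ^ d - 1)"
  using sum_weight_lines_in[of X 4 W d] X W d by simp

lemma card_lines_through_point:
  fixes v :: "'a ^ 7"
  assumes "v \<noteq> 0"
  shows "(q - 1) * real (card {L \<in> lines_in UNIV. v \<in> L}) = q ^ 6 - 1"
  using card_lines_through[of "UNIV :: ('a^7) set" 6 v] assms by (simp add: card_cart_basis)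

lemma card_span_nonzero:
  fixes v :: "'a ^ 7"
  assumes "v \<noteq> 0"
  shows "real (card (vec.span {v} - {0})) = q - 1"
  using real_card_nonzero[of "vec.span {v}"] vec.dim_span_eq_card_independent[of "{v}"] assms
  by (simp add: vec.dependent_single)

text \<open>The incidences are counted by \<open>sum_of_card_through_pair\<close>. The sum is
  negative for \<open>v\<close> outside \<open>W\<close>, so such terms can later be dropped from an
  upper bound.\<close>

lemma sum_weight_star:
  assumes W: "vec.subspace W" "vec.dim W = 5" and v: "v \<noteq> 0"
  shows "(\<Sum>L | L \<in> lines_in UNIV \<and> v \<in> L. weight W L) =
    (if v \<in> W then (q\<^sup>2 + q + 1) * q ^ 3 * (q\<^sup>2 - 1) else - (q\<^sup>2 + q + 1) * q\<^sup>2 * (q - 1))"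
proof -
  let ?St = "{L \<in> lines_in UNIV. v \<in> L}" and ?S = "vec.span {v}"
  define N where "N = real (card ?St)"
  have N: "(q - 1) * N = q ^ 6 - 1" unfolding N_def by (rule card_lines_through_point[OF v])
  have "(\<Sum>L\<in>?St. 1 * real (card (L \<inter> (W - {0})))) = (\<Sum>a\<in>W - {0}. \<Sum>L | L \<in> ?St \<and> a \<in> L. 1)"
    by (rule sum_card_Int) auto
  also have "\<dots> = (\<Sum>a\<in>W - {0}. real (card {L \<in> lines_in UNIV. v \<in> L \<and> a \<in> L}))" by (simp add: conj_assoc)
  also have "\<dots> = real (card ((W - {0}) \<inter> ?S)) * N + real (card ((W - {0}) - ?S))"
    unfolding N_def by (rule sum_of_card_through_pair) (use v in auto)
  finally have 1: "(\<Sum>L\<in>?St. real (card (L \<inter> (W - {0})))) = \<dots>" by simp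
  have "(\<Sum>L\<in>?St. of_bool (L \<subseteq> W)) = real (card {L \<in> ?St. L \<subseteq> W})"
    by (simp add: of_bool_def sum.If_cases Int_def)
  then have eq: "(\<Sum>L\<in>?St. weight W L) = (q\<^sup>2 - 1) * N
      - (q\<^sup>2 + q + 1) * (real (card ((W - {0}) \<inter> ?S)) * N + real (card ((W - {0}) - ?S)))
      + q * (q\<^sup>2 - 1) * (q\<^sup>2 + q + 1) * real (card {L \<in> ?St. L \<subseteq> W})"
    unfolding weight_def N_def 1[unfolded N_def, symmetric]
    by (simp add: sum.distrib sum_subtractf sum_distrib_left[symmetric])
  have cW: "real (card (W - {0})) = q ^ 5 - 1" using real_card_nonzero[OF W(1)] W(2) by simp
  show ?thesis
  proof (cases "v \<in> W")
    case True
    have "?S \<subseteq> W" using True W by (intro vec.span_minimal) auto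
    then have "(W - {0}) \<inter> ?S = ?S - {0}" by auto
    then have a: "real (card ((W - {0}) \<inter> ?S)) = q - 1" using card_span_nonzero[OF v] by simp
    have "card (W - {0}) = card ((W - {0}) \<inter> ?S) + card ((W - {0}) - ?S)"
      by (rule card_Int_Diff) simp
    then have b: "real (card ((W - {0}) - ?S)) = q ^ 5 - q" using a cW by simp
    have "{L \<in> ?St. L \<subseteq> W} = {L \<in> lines_in W. v \<in> L}" unfolding lines_in_def by auto
    then have c: "(q - 1) * real (card {L \<in> ?St. L \<subseteq> W}) = q ^ 4 - 1"
      using card_lines_through[of W 4 v] W True v by simp
    have "(\<Sum>L\<in>?St. weight W L) = (q + 1) * ((q - 1) * N)
      - (q\<^sup>2 + q + 1) * ((q - 1) * N + (q ^ 5 - q))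
      + q * (q + 1) * (q\<^sup>2 + q + 1) * ((q - 1) * real (card {L \<in> ?St. L \<subseteq> W}))"
      unfolding eq a b by algebra
    also have "\<dots> = (q\<^sup>2 + q + 1) * q ^ 3 * (q\<^sup>2 - 1)" unfolding N c by algebra
    finally show ?thesis using True by simp
  next
    case False
    have "(W - {0}) \<inter> ?S = {}"
    proof -
      have "x \<notin> W" if "x \<in> ?S" "x \<noteq> 0" for x
      proof
        assume "x \<in> W"
        obtain c where c: "x = c *s v" using \<open>x \<in> ?S\<close> by (auto simp: vec.span_singleton)
        then have "v = inverse c *s x" using \<open>x \<noteq> 0\<close> by auto
        then show False using \<open>x \<in> W\<close> W(1) False vec.subspace_scale by metis
      qed
      then show ?thesis by auto
    qed
    then have a: "real (card ((W - {0}) \<inter> ?S)) = 0" and b: "real (card ((W - {0}) - ?S)) = q ^ 5 - 1"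
      using cW by (simp_all add: Diff_triv)
    have "{L \<in> ?St. L \<subseteq> W} = {}" using False by auto
    then have c: "real (card {L \<in> ?St. L \<subseteq> W}) = 0" by simp
    have "(\<Sum>L\<in>?St. weight W L) = (q + 1) * ((q - 1) * N) - (q\<^sup>2 + q + 1) * (q ^ 5 - 1)"
      unfolding eq a b c by algebra
    also have "\<dots> = - (q\<^sup>2 + q + 1) * q\<^sup>2 * (q - 1)" unfolding N by algebra
    finally show ?thesis using False by simp
  qed
qed

text \<open>Expanding the factor \<open>weight V L\<close> leaves the total sum of
  \<open>weight W\<close>, its star sums at the vectors of \<open>V\<close>, and its sum over the
  lines of \<open>V\<close>. All of them depend only on the dimension of
  \<open>V \<inter> W\<close>.\<close>

lemma sum_weight_product:
  assumes W: "vec.subspace W" "vec.dim W = 5" and V: "vec.subspace V" "vec.dim V = 5"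
    and d: "vec.dim (V \<inter> W) = Suc d"
  shows "(\<Sum>L\<in>lines_in UNIV. weight W L * weight V L) =
    (q\<^sup>2 - 1) * ((q\<^sup>2 + 1) * q ^ 3 * (q\<^sup>2 + q + 1) * (q\<^sup>2 - 1))
    - (q\<^sup>2 + q + 1) * ((q ^ Suc d - 1) * ((q\<^sup>2 + q + 1) * q ^ 3 * (q\<^sup>2 - 1))
        - (q ^ 5 - q ^ Suc d) * ((q\<^sup>2 + q + 1) * q\<^sup>2 * (q - 1)))
    + q * (q + 1) * (q\<^sup>2 + q + 1) * ((q ^ 5 - 1) * (q ^ 4 - 1) - (q\<^sup>2 + q + 1) * (q ^ Suc d - 1) * (q ^ 4 - 1)
      + q * (q\<^sup>2 + q + 1) * (q ^ Suc d - 1) * (q ^ d - 1))"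
proof -
  have VW: "vec.subspace (V \<inter> W)" using V W vec.subspace_inter by blast
  let ?in = "(q\<^sup>2 + q + 1) * q ^ 3 * (q\<^sup>2 - 1)" and ?out = "- (q\<^sup>2 + q + 1) * q\<^sup>2 * (q - 1)"
  have "(\<Sum>L\<in>lines_in UNIV. weight W L * real (card (L \<inter> (V - {0})))) =
      (\<Sum>v\<in>V - {0}. \<Sum>L | L \<in> lines_in UNIV \<and> v \<in> L. weight W L)"
    by (rule sum_card_Int) auto
  also have "\<dots> = (\<Sum>v\<in>V - {0}. ?out + (if v \<in> W then ?in - ?out else 0))"
    by (rule sum.cong) (use sum_weight_star[OF W] in auto)
  also have "\<dots> = real (card (V - {0})) * ?out + real (card (V \<inter> W - {0})) * (?in - ?out)"
  proof -
    have "(V - {0}) \<inter> {v. v \<in> W} = V \<inter> W - {0}" by auto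
    then show ?thesis by (simp add: sum.distrib sum.If_cases)
  qed
  also have "\<dots> = (q ^ 5 - 1) * ?out + (q ^ Suc d - 1) * (?in - ?out)"
    by (simp only: real_card_nonzero[OF V(1)] real_card_nonzero[OF VW] d V(2))
  also have "\<dots> = (q ^ Suc d - 1) * ?in + (q ^ 5 - q ^ Suc d) * ?out"
    by algebra
  finally have 1: "(\<Sum>L\<in>lines_in UNIV. weight W L * real (card (L \<inter> (V - {0})))) = \<dots>" .
  have 2: "(\<Sum>L\<in>lines_in UNIV. weight W L * of_bool (L \<subseteq> V)) = (\<Sum>L\<in>lines_in V. weight W L)"
  proof -
    have "(\<Sum>L\<in>lines_in UNIV. weight W L * of_bool (L \<subseteq> V)) = (\<Sum>L\<in>{L \<in> lines_in UNIV. L \<subseteq> V}. weight W L)"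
      by (simp add: of_bool_def if_distrib sum.If_cases Int_def cong: if_cong)
    then show ?thesis using lines_in_mono[of V UNIV] by simp
  qed
  have "(\<Sum>L\<in>lines_in UNIV. weight W L * weight V L) = (\<Sum>L\<in>lines_in UNIV.
      (q\<^sup>2 - 1) * weight W L - (q\<^sup>2 + q + 1) * (weight W L * real (card (L \<inter> (V - {0}))))
      + q * (q\<^sup>2 - 1) * (q\<^sup>2 + q + 1) * (weight W L * of_bool (L \<subseteq> V)))"
  proof (rule sum.cong[OF refl])
    fix L :: "('a ^ 7) set"
    show "weight W L * weight V L =
      (q\<^sup>2 - 1) * weight W L - (q\<^sup>2 + q + 1) * (weight W L * real (card (L \<inter> (V - {0}))))
      + q * (q\<^sup>2 - 1) * (q\<^sup>2 + q + 1) * (weight W L * of_bool (L \<subseteq> V))"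
      unfolding weight_def[of V] by (simp only: distrib_left right_diff_distrib mult_ac)
  qed
  also have "\<dots> = (q\<^sup>2 - 1) * (\<Sum>L\<in>lines_in UNIV. weight W L)
      - (q\<^sup>2 + q + 1) * (\<Sum>L\<in>lines_in UNIV. weight W L * real (card (L \<inter> (V - {0}))))
      + q * (q\<^sup>2 - 1) * (q\<^sup>2 + q + 1) * (\<Sum>L\<in>lines_in UNIV. weight W L * of_bool (L \<subseteq> V))"
    by (simp only: sum.distrib sum_subtractf sum_distrib_left)
  also have "q * (q\<^sup>2 - 1) * (q\<^sup>2 + q + 1) * (\<Sum>L\<in>lines_in UNIV. weight W L * of_bool (L \<subseteq> V)) =
      q * (q + 1) * (q\<^sup>2 + q + 1) * ((q - 1) * (\<Sum>L\<in>lines_in V. weight W L))"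
    unfolding 2 by algebra
  finally show ?thesis
    unfolding 1 sum_weight_all[OF W] sum_weight_five[OF V W(1) d]
    by (simp only: minus_mult_left[symmetric] mult_minus_right add_uminus_conv_diff)
qed

text \<open>Two distinct codewords of dimension 5 meet in dimension exactly 3, again by the distance
  and the ambient dimension.\<close>

lemma sum_weight_orthogonal:
  assumes "vec.subspace W" "vec.dim W = 5" "vec.subspace V" "vec.dim V = 5" "vec.dim (V \<inter> W) = 3"
  shows "(\<Sum>L\<in>lines_in UNIV. weight W L * weight V L) = 0"
proof -
  have "vec.dim (V \<inter> W) = Suc 2" using assms by simp
  moreover have "q ^ Suc 2 = q ^ 3" by (simp add: eval_nat_numeral)
  ultimately have "(\<Sum>L\<in>lines_in UNIV. weight W L * weight V L) =
    (q\<^sup>2 - 1) * ((q\<^sup>2 + 1) * q ^ 3 * (q\<^sup>2 + q + 1) * (q\<^sup>2 - 1))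
    - (q\<^sup>2 + q + 1) * ((q ^ 3 - 1) * ((q\<^sup>2 + q + 1) * q ^ 3 * (q\<^sup>2 - 1))
        - (q ^ 5 - q ^ 3) * ((q\<^sup>2 + q + 1) * q\<^sup>2 * (q - 1)))
    + q * (q + 1) * (q\<^sup>2 + q + 1) * ((q ^ 5 - 1) * (q ^ 4 - 1) - (q\<^sup>2 + q + 1) * (q ^ 3 - 1) * (q ^ 4 - 1)
      + q * (q\<^sup>2 + q + 1) * (q ^ 3 - 1) * (q ^ 2 - 1))"
    by (simp only: sum_weight_product[OF assms(1-4)])
  also have "\<dots> = 0" by algebra
  finally show ?thesis .
qed

text \<open>The case \<open>V = W\<close> of the product formula. The last factor is the D of the
  opening summary.\<close>

lemma sum_weight_square:
  assumes "vec.subspace W" "vec.dim W = 5"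
  shows "(\<Sum>L\<in>lines_in UNIV. (weight W L)\<^sup>2) =
    (q - 1)\<^sup>2 * q ^ 6 * (q\<^sup>2 + q + 1) * (q + 1) * (q^5 + 2 * q^4 + 2 * q^3 + 2 * q\<^sup>2 + q + 1)"
proof -
  have "vec.dim (W \<inter> W) = Suc 4" using assms by simp
  moreover have "q ^ Suc 4 = q ^ 5" by (simp add: eval_nat_numeral)
  ultimately have "(\<Sum>L\<in>lines_in UNIV. (weight W L)\<^sup>2) =
    (q\<^sup>2 - 1) * ((q\<^sup>2 + 1) * q ^ 3 * (q\<^sup>2 + q + 1) * (q\<^sup>2 - 1))
    - (q\<^sup>2 + q + 1) * ((q ^ 5 - 1) * ((q\<^sup>2 + q + 1) * q ^ 3 * (q\<^sup>2 - 1))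
        - (q ^ 5 - q ^ 5) * ((q\<^sup>2 + q + 1) * q\<^sup>2 * (q - 1)))
    + q * (q + 1) * (q\<^sup>2 + q + 1) * ((q ^ 5 - 1) * (q ^ 4 - 1) - (q\<^sup>2 + q + 1) * (q ^ 5 - 1) * (q ^ 4 - 1)
      + q * (q\<^sup>2 + q + 1) * (q ^ 5 - 1) * (q ^ 4 - 1))"
    by (simp only: power2_eq_square[of "weight W _"] sum_weight_product[OF assms assms])
  also have "\<dots> = (q - 1)\<^sup>2 * q ^ 6 * (q\<^sup>2 + q + 1) * (q + 1) * (q^5 + 2 * q^4 + 2 * q^3 + 2 * q\<^sup>2 + q + 1)"
    by algebra
  finally show ?thesis .
qed

end


section \<open>Codes of minimum distance four\<close>

definition level :: "('a::field ^ 'n::finite) set set \<Rightarrow> nat \<Rightarrow> ('a ^ 'n) set set" where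
  "level C k = {U \<in> C. vec.dim U = k}"

text \<open>Ordered pairs are counted, so each unordered pair contributes 2.\<close>

definition meeting_pairs :: "('a::field ^ 'n::finite) set set \<Rightarrow> nat \<Rightarrow> nat \<Rightarrow> real" where
  "meeting_pairs C k d = (\<Sum>U\<in>level C k. \<Sum>W\<in>level C k. of_bool (U \<noteq> W \<and> vec.dim (U \<inter> W) = d))"

definition dual_code :: "('a::field ^ 'n::finite) set set \<Rightarrow> ('a ^ 'n) set set" where
  "dual_code C = orth ` C"

lemma card_Diff_plus:
  fixes A B :: "'b::finite set"
  assumes "A \<subseteq> B"
  shows "card (B - A) + card A = card B"
  using card_Diff_subset[OF _ assms] card_mono[OF _ assms] by simp

lemma dim_zero_iff:
  fixes U :: "('a::{field,finite} ^ 'n::finite) set"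
  shows "vec.subspace U \<Longrightarrow> vec.dim U = 0 \<longleftrightarrow> U = {0}"
  using vec.dim_eq_0[of U] vec.subspace_0[of U] by auto

locale distance_four_code = finite_field_size q F
  for q :: real and F :: "'a::{field,finite} itself" +
  fixes C :: "('a ^ 7) set set"
  assumes code: "subspace_code 4 C"
begin

lemma code_subspace: "U \<in> C \<Longrightarrow> vec.subspace U"
  using code unfolding subspace_code_def subspaces_def by auto

lemma level_subspace: "U \<in> level C k \<Longrightarrow> vec.subspace U" "U \<in> level C k \<Longrightarrow> vec.dim U = k"
  "U \<in> level C k \<Longrightarrow> U \<in> C"
  unfolding level_def using code_subspace by auto

text \<open>For subspaces the distance equals \<open>dim U + dim W - 2 dim (U \<inter> W)\<close>.
  This bound and the lower bound after it determine which intersections of codewords are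
  possible.\<close>

lemma code_dim_Int:
  assumes "U \<in> C" "W \<in> C" "U \<noteq> W"
  shows "2 * vec.dim (U \<inter> W) + 4 \<le> vec.dim U + vec.dim W"
proof -
  have "4 \<le> subspace_dist U W" using code assms unfolding subspace_code_def by auto
  then show ?thesis using subspace_dist_eq[OF code_subspace code_subspace, OF assms(1,2)] by linarith
qed

lemma code_dim_Int_lower:
  assumes "U \<in> C" "W \<in> C"
  shows "vec.dim U + vec.dim W \<le> 7 + vec.dim (U \<inter> W)"
  using dim_orth_Int[OF code_subspace code_subspace, OF assms] by simp

lemma inj_orth: "inj_on orth C"
  using orth_orth code_subspace by (metis inj_onI)

text \<open>Complements preserve the distance and turn dimension \<open>k\<close> into
  \<open>7 - k\<close>, so a bound valid for all codes also holds with the dimensions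
  reversed.\<close>

lemma dual_code: "distance_four_code q (dual_code C)"
proof
  show "subspace_code 4 (dual_code C)"
    unfolding subspace_code_def
  proof (intro conjI ballI impI)
    show "dual_code C \<subseteq> subspaces"
      unfolding dual_code_def subspaces_def using subspace_orth by auto
    fix U W assume UW: "U \<in> dual_code C" "W \<in> dual_code C" "U \<noteq> W"
    then obtain U' W' where "U = orth U'" "W = orth W'" "U' \<in> C" "W' \<in> C" "U' \<noteq> W'"
      unfolding dual_code_def by auto
    then show "4 \<le> subspace_dist U W"
      using code subspace_dist_orth[OF code_subspace code_subspace, of U' W']
      unfolding subspace_code_def by auto
  qed
qed

lemma dual_level:
  assumes "k \<le> 7"
  shows "level (dual_code C) k = orth ` level C (7 - k)"
proof -
  have "vec.dim (orth U) = k \<longleftrightarrow> vec.dim U = 7 - k" if "U \<in> C" for U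
    using dim_orth[OF code_subspace[OF that]] assms by auto
  then show ?thesis unfolding level_def dual_code_def by auto
qed

lemma card_dual_level: "k \<le> 7 \<Longrightarrow> card (level (dual_code C) k) = card (level C (7 - k))"
  unfolding dual_level
  by (rule card_image, rule inj_on_subset[OF inj_orth]) (auto simp: level_def)

lemma card_dual_code: "card (dual_code C) = card C"
  unfolding dual_code_def by (rule card_image[OF inj_orth])

text \<open>If two subspaces of dimension 4 meet in dimension 2, their sum has dimension 6, and the
  complements meet in dimension 1.\<close>

lemma meeting_pairs_dual: "meeting_pairs (dual_code C) 3 1 = meeting_pairs C 4 2"
proof -
  have lev: "level (dual_code C) 3 = orth ` level C 4" using dual_level[of 3] by simp
  have inj: "inj_on orth (level C 4)" by (rule inj_on_subset[OF inj_orth]) (auto simp: level_def)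
  have "(orth U \<noteq> orth W \<and> vec.dim (orth U \<inter> orth W) = 1) = (U \<noteq> W \<and> vec.dim (U \<inter> W) = 2)"
    if "U \<in> level C 4" "W \<in> level C 4" for U W
  proof -
    have "vec.dim (orth U \<inter> orth W) + 1 = vec.dim (U \<inter> W)"
      using dim_orth_Int[of U W] level_subspace that by fastforce
    moreover have "orth U \<noteq> orth W \<longleftrightarrow> U \<noteq> W" using inj that by (auto dest: inj_onD)
    ultimately show ?thesis by auto
  qed
  then show ?thesis
    unfolding meeting_pairs_def lev sum.reindex[OF inj] o_def
    by (intro sum.cong refl) (simp only:)
qed

lemma level_disjoint_Int:
  assumes "U \<in> level C k" "W \<in> level C m" "U \<noteq> W" "k + m < 6"
  shows "U \<inter> W = {0}"
proof -
  have "vec.dim (U \<inter> W) = 0"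
    using code_dim_Int[of U W] level_subspace assms by fastforce
  then show ?thesis
    using dim_zero_iff[OF vec.subspace_inter] level_subspace assms by blast
qed

lemma card_level_2: "real (card (level C 2)) \<le> q ^ 5 + q ^ 3 + 1"
proof -
  have "card (level C 2) \<le> CARD('a) ^ 5 + CARD('a) ^ 3 + 1"
  proof (rule partial_spread_bound)
    show "level C 2 \<subseteq> lines_in UNIV" unfolding lines_in_def using level_subspace by auto
    show "\<And>L L'. L \<in> level C 2 \<Longrightarrow> L' \<in> level C 2 \<Longrightarrow> L \<noteq> L' \<Longrightarrow> L \<inter> L' = {0}"
      using level_disjoint_Int[of _ 2 _ 2] by simp
  qed
  then have "real (card (level C 2)) \<le> real (CARD('a) ^ 5 + CARD('a) ^ 3 + 1)" by (simp only: of_nat_le_iff)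
  then show ?thesis unfolding q_eq by simp
qed

text \<open>A packing argument outside \<open>vec.span {v}\<close>: the planes through
  \<open>v\<close> share nothing there, and the codewords of dimension 2 are disjoint from each
  other and from these planes apart from zero.\<close>

lemma plane_degree_bound:
  assumes v: "v \<noteq> 0" and ex: "{E \<in> level C 3. v \<in> E} \<noteq> {}"
  shows "(q ^ 3 - q) * real (card {E \<in> level C 3. v \<in> E}) \<le> q ^ 7 - q - (q\<^sup>2 - 1) * real (card (level C 2))"
proof -
  let ?P = "{E \<in> level C 3. v \<in> E}" and ?Z = "level C 2" and ?S = "vec.span {v}"
  have SE: "?S \<subseteq> E" if "E \<in> ?P" for E
    using that level_subspace by (intro vec.span_minimal) auto
  have cS: "real (card ?S) = q" using card_line_span[OF v] q_eq by simp
  have EE: "E \<inter> E' = ?S" if "E \<in> ?P" "E' \<in> ?P" "E \<noteq> E'" for E E'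
  proof -
    have sub: "vec.subspace (E \<inter> E')" using that level_subspace vec.subspace_inter by blast
    have "vec.dim (E \<inter> E') \<le> 1" using code_dim_Int[of E E'] that level_subspace by fastforce
    moreover have "vec.dim ?S = 1" using v vec.dim_span_eq_card_independent[of "{v}"] by (simp add: vec.dependent_single)
    ultimately show ?thesis
      using vec.subspace_dim_equal[OF vec.subspace_span sub, of "{v}"] SE that by auto
  qed
  have LE: "L \<inter> E = {0}" if "L \<in> ?Z" "E \<in> ?P" for L E
  proof -
    have "vec.dim L = 2" "vec.dim E = 3" using that level_subspace(2) by blast+
    then have "L \<noteq> E" by auto
    then show ?thesis using level_disjoint_Int[of L 2 E 3] that by simp
  qed
  have 1: "real (card (\<Union>E\<in>?P. E - ?S)) = real (card ?P) * (q ^ 3 - q)"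
  proof -
    have "card (\<Union>E\<in>?P. E - ?S) = (\<Sum>E\<in>?P. card (E - ?S))"
    proof (rule card_UN_disjoint)
      show "\<forall>E\<in>?P. \<forall>E'\<in>?P. E \<noteq> E' \<longrightarrow> (E - ?S) \<inter> (E' - ?S) = {}" using EE by blast
    qed auto
    moreover have "real (card (E - ?S)) = q ^ 3 - q" if "E \<in> ?P" for E
    proof -
      have "card E = card (E - ?S) + card ?S"
        using card_Diff_plus[OF SE[OF that]] by simp
      then show ?thesis using real_card_subspace[of E] that level_subspace cS by auto
    qed
    ultimately show ?thesis by simp
  qed
  have 2: "real (card (\<Union>L\<in>?Z. L - {0})) = real (card ?Z) * (q\<^sup>2 - 1)"
  proof -
    have "card (\<Union>L\<in>?Z. L - {0}) = (\<Sum>L\<in>?Z. card (L - {0}))"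
    proof (rule card_UN_disjoint)
      have "L \<inter> L' = {0}" if "L \<in> ?Z" "L' \<in> ?Z" "L \<noteq> L'" for L L'
        using level_disjoint_Int[OF that] by simp
      then show "\<forall>L\<in>?Z. \<forall>L'\<in>?Z. L \<noteq> L' \<longrightarrow> (L - {0}) \<inter> (L' - {0}) = {}" by blast
    qed auto
    moreover have "real (card (L - {0})) = q\<^sup>2 - 1" if "L \<in> ?Z" for L
      using real_card_nonzero[of L] that level_subspace by auto
    ultimately show ?thesis by simp
  qed
  \<comment> \<open>A plane through \<open>v\<close> contains \<open>?S\<close> and meets the
    codewords of dimension 2 only in zero; this keeps them off \<open>?S\<close>.\<close>
  obtain E0 where E0: "E0 \<in> ?P" using ex by blast
  have LS: "x = 0" if "L \<in> ?Z" "x \<in> L" "x \<in> ?S" for L x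
  proof -
    have "x \<in> L \<inter> E0" using that SE[OF E0] by blast
    then show ?thesis unfolding LE[OF that(1) E0] by simp
  qed
  have "x = 0" if "L \<in> ?Z" "E \<in> ?P" "x \<in> L" "x \<in> E" for L E x
  proof -
    have "x \<in> L \<inter> E" using that by blast
    then show ?thesis unfolding LE[OF that(1,2)] by simp
  qed
  then have "(\<Union>E\<in>?P. E - ?S) \<inter> (\<Union>L\<in>?Z. L - {0}) = {}" by blast
  then have "card ((\<Union>E\<in>?P. E - ?S) \<union> (\<Union>L\<in>?Z. L - {0})) = card (\<Union>E\<in>?P. E - ?S) + card (\<Union>L\<in>?Z. L - {0})"
    by (intro card_Un_disjoint) simp_all
  moreover have "card ((\<Union>E\<in>?P. E - ?S) \<union> (\<Union>L\<in>?Z. L - {0})) \<le> card (UNIV - ?S)"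
    by (rule card_mono) (use LS in auto)
  ultimately have "card (\<Union>E\<in>?P. E - ?S) + card (\<Union>L\<in>?Z. L - {0}) \<le> card (UNIV - ?S)" by simp
  moreover have "real (card (UNIV - ?S)) = q ^ 7 - q"
  proof -
    have "card (UNIV :: ('a^7) set) = card (UNIV - ?S) + card ?S"
      using card_Diff_plus[of ?S UNIV] by simp
    moreover have "real (card (UNIV :: ('a^7) set)) = q ^ 7" unfolding q_eq by simp
    ultimately show ?thesis using cS by simp
  qed
  ultimately show ?thesis using 1 2 by (simp add: mult.commute)
qed

text \<open>With \<open>d v\<close> the number of planes through \<open>v\<close>, the sum of the
  squares of \<open>d\<close> counts pairs of planes by their common nonzero vectors. Bounding one
  factor of each square by \<open>plane_degree_bound\<close> reduces it to the sum of
  \<open>d\<close>, which is known.\<close>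

lemma meeting_pairs_bound:
  "q * meeting_pairs C 3 1 \<le>
    (q\<^sup>2 + q + 1) * real (card (level C 3)) * (q * (q ^ 4 + q\<^sup>2) - real (card (level C 2)))"
proof -
  let ?P = "level C 3"
  define z where "z = real (card (level C 2))"
  define x where "x = real (card ?P)"
  define d where "d v = real (card {E \<in> ?P. v \<in> E})" for v
  have c3: "real (card (E - {0})) = q ^ 3 - 1" if "E \<in> ?P" for E
    using real_card_nonzero[of E] that level_subspace by auto
  have "(\<Sum>v\<in>UNIV - {0}. 1 * d v) = (\<Sum>E\<in>?P. \<Sum>v | v \<in> UNIV - {0} \<and> v \<in> E. 1)"
    unfolding d_def by (rule sum_incidence) auto
  also have "\<dots> = (\<Sum>E\<in>?P. real (card (E - {0})))"
    by (rule sum.cong) (auto intro!: arg_cong[where f = card])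
  also have "\<dots> = x * (q ^ 3 - 1)" unfolding x_def using c3 by simp
  finally have sum1: "(\<Sum>v\<in>UNIV - {0}. d v) = x * (q ^ 3 - 1)" by simp
  have pair: "real (card (E \<inter> E' - {0})) =
      (if E = E' then q ^ 3 - 1 else 0) + (q - 1) * of_bool (E \<noteq> E' \<and> vec.dim (E \<inter> E') = 1)"
    if E: "E \<in> ?P" "E' \<in> ?P" for E E'
  proof (cases "E = E'")
    case True then show ?thesis using c3[OF E(1)] by simp
  next
    case False
    have "vec.dim (E \<inter> E') \<le> 1" using code_dim_Int[of E E'] E False level_subspace by fastforce
    have "vec.subspace (E \<inter> E')" using E level_subspace vec.subspace_inter by blast
    from real_card_nonzero[OF this] have "real (card (E \<inter> E' - {0})) = q ^ vec.dim (E \<inter> E') - 1" .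
    moreover have "vec.dim (E \<inter> E') = 0 \<or> vec.dim (E \<inter> E') = 1"
      using \<open>vec.dim (E \<inter> E') \<le> 1\<close> by linarith
    ultimately show ?thesis using False by (elim disjE) (simp_all only: if_False simp_thms of_bool_eq power_0 power_one_right, simp_all)
  qed
  have inner: "(\<Sum>v | v \<in> UNIV - {0} \<and> v \<in> E. d v) = (\<Sum>E'\<in>?P. real (card (E \<inter> E' - {0})))" for E
  proof -
    have "(\<Sum>v\<in>{v. v \<in> UNIV - {0} \<and> v \<in> E}. 1 * d v) =
        (\<Sum>E'\<in>?P. \<Sum>v | v \<in> {v. v \<in> UNIV - {0} \<and> v \<in> E} \<and> v \<in> E'. 1)"
      unfolding d_def by (rule sum_incidence) auto
    also have "\<dots> = (\<Sum>E'\<in>?P. real (card (E \<inter> E' - {0})))"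
      by (rule sum.cong) (auto intro!: arg_cong[where f = card])
    finally show ?thesis by simp
  qed
  have "(\<Sum>v\<in>UNIV - {0}. d v * d v) = (\<Sum>E\<in>?P. \<Sum>v | v \<in> UNIV - {0} \<and> v \<in> E. d v)"
    by (subst (2) d_def, rule sum_incidence) auto
  also have "\<dots> = (\<Sum>E\<in>?P. \<Sum>E'\<in>?P. (if E = E' then q ^ 3 - 1 else 0) + (q - 1) * of_bool (E \<noteq> E' \<and> vec.dim (E \<inter> E') = 1))"
    unfolding inner using pair by (intro sum.cong) auto
  also have "\<dots> = x * (q ^ 3 - 1) + (q - 1) * meeting_pairs C 3 1"
    unfolding meeting_pairs_def x_def by (simp only: sum.distrib sum_distrib_left) simp
  finally have sum2: "(\<Sum>v\<in>UNIV - {0}. d v * d v) = x * (q ^ 3 - 1) + (q - 1) * meeting_pairs C 3 1" .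
  have "(q ^ 3 - q) * (\<Sum>v\<in>UNIV - {0}. d v * d v) = (\<Sum>v\<in>UNIV - {0}. ((q ^ 3 - q) * d v) * d v)"
    by (simp add: sum_distrib_left mult.assoc)
  also have "\<dots> \<le> (\<Sum>v\<in>UNIV - {0}. (q ^ 7 - q - (q\<^sup>2 - 1) * z) * d v)"
  proof (rule sum_mono)
    fix v :: "'a ^ 7" assume v: "v \<in> UNIV - {0}"
    show "((q ^ 3 - q) * d v) * d v \<le> (q ^ 7 - q - (q\<^sup>2 - 1) * z) * d v"
    proof (cases "{E \<in> ?P. v \<in> E} = {}")
      case True
      then have "d v = 0" unfolding d_def by (simp only: card.empty of_nat_0)
      then show ?thesis by simp
    next
      case False
      then show ?thesis
        using plane_degree_bound[of v] v unfolding d_def z_def by (intro mult_right_mono) auto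
    qed
  qed
  also have "\<dots> = (q ^ 7 - q - (q\<^sup>2 - 1) * z) * (x * (q ^ 3 - 1))"
    using sum1 by (simp add: sum_distrib_left[symmetric])
  finally have "(q ^ 3 - q) * (x * (q ^ 3 - 1) + (q - 1) * meeting_pairs C 3 1) \<le> \<dots>" unfolding sum2 .
  then have "(q - 1)\<^sup>2 * (q + 1) * (q * meeting_pairs C 3 1) \<le>
      (q - 1)\<^sup>2 * (q + 1) * ((q\<^sup>2 + q + 1) * x * (q * (q ^ 4 + q\<^sup>2) - z))"
  proof -
    have "(q ^ 3 - q) * (x * (q ^ 3 - 1) + (q - 1) * meeting_pairs C 3 1) - (q ^ 7 - q - (q\<^sup>2 - 1) * z) * (x * (q ^ 3 - 1))
      = (q - 1)\<^sup>2 * (q + 1) * (q * meeting_pairs C 3 1) - 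
      (q - 1)\<^sup>2 * (q + 1) * ((q\<^sup>2 + q + 1) * x * (q * (q ^ 4 + q\<^sup>2) - z))" by algebra
    moreover assume "(q ^ 3 - q) * (x * (q ^ 3 - 1) + (q - 1) * meeting_pairs C 3 1) \<le> (q ^ 7 - q - (q\<^sup>2 - 1) * z) * (x * (q ^ 3 - 1))"
    ultimately show ?thesis by linarith
  qed
  moreover have "0 < (q - 1)\<^sup>2 * (q + 1)" using q_pos by simp
  ultimately show ?thesis unfolding x_def z_def by (simp only: mult_le_cancel_left_pos)
qed

text \<open>Duality exchanges planes with solids, and dimension 2 with dimension 5.\<close>

lemma meeting_pairs_bound_dual:
  "q * meeting_pairs C 4 2 \<le>
    (q\<^sup>2 + q + 1) * real (card (level C 4)) * (q * (q ^ 4 + q\<^sup>2) - real (card (level C 5)))"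
proof -
  interpret dual: distance_four_code q F "dual_code C" by (rule dual_code)
  show ?thesis
    using dual.meeting_pairs_bound unfolding meeting_pairs_dual by (simp add: card_dual_level)
qed

lemma card_level_5: "real (card (level C 5)) \<le> q ^ 5 + q ^ 3 + 1"
proof -
  interpret dual: distance_four_code q F "dual_code C" by (rule dual_code)
  show ?thesis using dual.card_level_2 by (simp add: card_dual_level)
qed

end


section \<open>The defect of a code on two-dimensional subspaces\<close>

context distance_four_code
begin

definition planes_on :: "('a ^ 7) set \<Rightarrow> real" where
  "planes_on L = real (card {E \<in> level C 3. L \<subseteq> E})"

definition solids_on :: "('a ^ 7) set \<Rightarrow> real" where
  "solids_on L = real (card {S \<in> level C 4. L \<subseteq> S})"

text \<open>A solid has \<open>q\<^sup>2 + 1\<close> times as many lines as a plane. With the weight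
  \<open>1 / (q\<^sup>2 + 1)\<close> both reduce the sum of the defects by the same amount.\<close>

definition defect :: "('a ^ 7) set \<Rightarrow> real" where
  "defect L = 1 - planes_on L - of_bool (L \<in> level C 2) - solids_on L / (q\<^sup>2 + 1)"

text \<open>\<open>G\<close> is a test function. It will be the constant 1, the defect itself, the
  total weight, or the indicator of the lines through a vector.\<close>

lemma sum_defect_weighted:
  "(\<Sum>L\<in>lines_in UNIV. G L * defect L) = (\<Sum>L\<in>lines_in UNIV. G L)
     - (\<Sum>E\<in>level C 3. \<Sum>L\<in>lines_in E. G L) - (\<Sum>L\<in>level C 2. G L)
     - (\<Sum>S\<in>level C 4. \<Sum>L\<in>lines_in S. G L) / (q\<^sup>2 + 1)"
proof -
  have 1: "(\<Sum>L\<in>lines_in UNIV. G L * real (card {S \<in> P. L \<subseteq> S})) = (\<Sum>S\<in>P. \<Sum>L\<in>lines_in S. G L)"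
    for P :: "('a ^ 7) set set"
  proof -
    have "(\<Sum>L\<in>lines_in UNIV. G L * real (card {S \<in> P. L \<subseteq> S})) =
        (\<Sum>S\<in>P. \<Sum>L | L \<in> lines_in UNIV \<and> L \<subseteq> S. G L)"
      by (rule sum_incidence) auto
    then show ?thesis by (simp only: lines_in_mono[OF subset_UNIV, symmetric])
  qed
  have "level C 2 \<subseteq> lines_in UNIV" unfolding lines_in_def using level_subspace by auto
  then have 2: "(\<Sum>L\<in>lines_in UNIV. G L * of_bool (L \<in> level C 2)) = (\<Sum>L\<in>level C 2. G L)"
    by (intro sum.mono_neutral_cong_right) auto
  have "(\<Sum>L\<in>lines_in UNIV. G L * defect L) = (\<Sum>L\<in>lines_in UNIV. G L - G L * planes_on L
      - G L * of_bool (L \<in> level C 2) - G L * solids_on L / (q\<^sup>2 + 1))"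
    unfolding defect_def by (simp only: right_diff_distrib mult_1_right times_divide_eq_right)
  also have "\<dots> = (\<Sum>L\<in>lines_in UNIV. G L) - (\<Sum>L\<in>lines_in UNIV. G L * planes_on L)
     - (\<Sum>L\<in>lines_in UNIV. G L * of_bool (L \<in> level C 2)) - (\<Sum>L\<in>lines_in UNIV. G L * solids_on L) / (q\<^sup>2 + 1)"
    by (simp only: sum_subtractf sum_divide_distrib)
  finally show ?thesis unfolding planes_on_def solids_on_def 1 2 .
qed

text \<open>Another codeword of dimension 2, 3 or 4 containing \<open>L\<close> would meet
  \<open>E\<close> in dimension 2, too much for distance 4. Hence the defect is 0 on every line of a
  plane codeword.\<close>

lemma planes_on_eq_1:
  assumes E: "E \<in> level C 3" and L: "L \<in> lines_in E"
  shows "planes_on L = 1" "L \<notin> level C 2" "solids_on L = 0"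
proof -
  have L': "vec.dim L = 2" "L \<subseteq> E" using L unfolding lines_in_def by auto
  have le: "2 \<le> vec.dim (U \<inter> W)" if "L \<subseteq> U" "L \<subseteq> W" for U W
    using vec.dim_subset[of L "U \<inter> W"] that L' by simp
  have uniq: "E' = E" if "E' \<in> level C 3" "L \<subseteq> E'" for E'
  proof (rule ccontr)
    assume "E' \<noteq> E"
    then show False
      using code_dim_Int[of E' E] le[OF that(2) L'(2)] level_subspace(2,3)[OF that(1)]
        level_subspace(2,3)[OF E] by simp
  qed
  have "{E' \<in> level C 3. L \<subseteq> E'} = {E}"
  proof
    show "{E' \<in> level C 3. L \<subseteq> E'} \<subseteq> {E}" using uniq by blast
    show "{E} \<subseteq> {E' \<in> level C 3. L \<subseteq> E'}" using E L'(2) by blast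
  qed
  then show "planes_on L = 1" unfolding planes_on_def by simp
  have free: "\<not> L \<subseteq> S" if "S \<in> level C k" "k \<noteq> 3" "k \<le> 4" for S k
  proof
    assume sub: "L \<subseteq> S"
    have "S \<noteq> E" using level_subspace(2)[OF E] level_subspace(2)[OF that(1)] that(2) by metis
    from code_dim_Int[OF level_subspace(3)[OF that(1)] level_subspace(3)[OF E] this] show False
      using le[OF sub L'(2)] that(3) level_subspace(2)[OF E] level_subspace(2)[OF that(1)] by linarith
  qed
  show "L \<notin> level C 2" using free[of L 2] by auto
  have "{S \<in> level C 4. L \<subseteq> S} = {}" using free[of _ 4] by simp
  then show "solids_on L = 0" unfolding solids_on_def by (simp only: card.empty of_nat_0)
qed

text \<open>A codeword of dimension 3 or 4 containing \<open>L\<close> would have distance at most 2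
  from it. Hence the defect is 0 on the codewords of dimension 2.\<close>

lemma line_codeword_free:
  assumes L: "L \<in> level C 2"
  shows "planes_on L = 0" "solids_on L = 0"
proof -
  have "\<not> L \<subseteq> U" if "U \<in> level C k" "2 < k" "k \<le> 5" for U k
  proof
    assume sub: "L \<subseteq> U"
    then have "L \<inter> U = L" by auto
    moreover have "L \<noteq> U" using level_subspace(2)[OF L] level_subspace(2)[OF that(1)] that by auto
    ultimately show False
      using code_dim_Int[of L U] that level_subspace(2,3)[OF L] level_subspace(2,3)[OF that(1)] by auto
  qed
  from this[of _ 3] this[of _ 4] have "{E \<in> level C 3. L \<subseteq> E} = {}" "{E \<in> level C 4. L \<subseteq> E} = {}" by simp_all
  then show "planes_on L = 0" "solids_on L = 0"
    unfolding planes_on_def solids_on_def by (simp_all only: card.empty of_nat_0)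
qed

lemma card_lines_small:
  fixes X :: "('a ^ 7) set"
  shows "vec.subspace X \<Longrightarrow> vec.dim X = 2 \<Longrightarrow> real (card (lines_in X)) = 1"
  "vec.subspace X \<Longrightarrow> vec.dim X = 3 \<Longrightarrow> real (card (lines_in X)) = q\<^sup>2 + q + 1"
  "vec.subspace X \<Longrightarrow> vec.dim X = 4 \<Longrightarrow> real (card (lines_in X)) = (q\<^sup>2 + 1) * (q\<^sup>2 + q + 1)"
  "vec.subspace X \<Longrightarrow> vec.dim X = 7 \<Longrightarrow>
    real (card (lines_in X)) = (q^6 + q^5 + q^4 + q^3 + q\<^sup>2 + q + 1) * (q^4 + q\<^sup>2 + 1)"
proof -
  have c: "(q - 1)\<^sup>2 * (q + 1) \<noteq> 0" using q_pos by simp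
  { assume a: "vec.subspace X" and b: "vec.dim X = 2"
    have b': "vec.dim X = Suc 1" using b by simp
    have "(q - 1)\<^sup>2 * (q + 1) * real (card (lines_in X)) = (q ^ Suc 1 - 1) * (q ^ 1 - 1)"
      by (rule card_lines_in[OF a b'])
    also have "\<dots> = (q - 1)\<^sup>2 * (q + 1) * 1" by (simp add: power2_eq_square algebra_simps)
    finally show "real (card (lines_in X)) = 1" by (simp only: mult_cancel_left c simp_thms) }
  { assume a: "vec.subspace X" and b: "vec.dim X = 3"
    have b': "vec.dim X = Suc 2" using b by simp
    have "(q - 1)\<^sup>2 * (q + 1) * real (card (lines_in X)) = (q ^ Suc 2 - 1) * (q ^ 2 - 1)"
      by (rule card_lines_in[OF a b'])
    also have "q ^ Suc 2 = q ^ 3" by (simp add: eval_nat_numeral)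
    also have "(q ^ 3 - 1) * (q ^ 2 - 1) = (q - 1)\<^sup>2 * (q + 1) * (q\<^sup>2 + q + 1)" by algebra
    finally show "real (card (lines_in X)) = q\<^sup>2 + q + 1" by (simp only: mult_cancel_left c simp_thms) }
  { assume a: "vec.subspace X" and b: "vec.dim X = 4"
    have b': "vec.dim X = Suc 3" using b by simp
    have "(q - 1)\<^sup>2 * (q + 1) * real (card (lines_in X)) = (q ^ Suc 3 - 1) * (q ^ 3 - 1)"
      by (rule card_lines_in[OF a b'])
    also have "q ^ Suc 3 = q ^ 4" by (simp add: eval_nat_numeral)
    also have "(q ^ 4 - 1) * (q ^ 3 - 1) = (q - 1)\<^sup>2 * (q + 1) * ((q\<^sup>2 + 1) * (q\<^sup>2 + q + 1))" by algebra
    finally show "real (card (lines_in X)) = (q\<^sup>2 + 1) * (q\<^sup>2 + q + 1)"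
      by (simp only: mult_cancel_left c simp_thms) }
  { assume a: "vec.subspace X" and b: "vec.dim X = 7"
    have b': "vec.dim X = Suc 6" using b by simp
    have "(q - 1)\<^sup>2 * (q + 1) * real (card (lines_in X)) = (q ^ Suc 6 - 1) * (q ^ 6 - 1)"
      by (rule card_lines_in[OF a b'])
    also have "q ^ Suc 6 = q ^ 7" by (simp add: eval_nat_numeral)
    also have "(q ^ 7 - 1) * (q ^ 6 - 1) =
      (q - 1)\<^sup>2 * (q + 1) * ((q^6 + q^5 + q^4 + q^3 + q\<^sup>2 + q + 1) * (q^4 + q\<^sup>2 + 1))" by algebra
    finally show "real (card (lines_in X)) = (q^6 + q^5 + q^4 + q^3 + q\<^sup>2 + q + 1) * (q^4 + q\<^sup>2 + 1)"
      by (simp only: mult_cancel_left c simp_thms) }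
qed

lemma dim_UNIV_7: "vec.dim (UNIV :: ('a ^ 7) set) = 7"
  using vec_dim_card[where 'a='a and 'n=7] by simp

text \<open>Two distinct solid codewords meet in dimension at most 2, so they share one line or
  none; \<open>S\<close> itself contributes all its lines.\<close>

lemma sum_solids_on_solid:
  assumes S: "S \<in> level C 4"
  shows "(\<Sum>L\<in>lines_in S. solids_on L) =
    (q\<^sup>2 + 1) * (q\<^sup>2 + q + 1) + (\<Sum>S'\<in>level C 4. of_bool (S \<noteq> S' \<and> vec.dim (S \<inter> S') = 2))"
proof -
  have "(\<Sum>L\<in>lines_in S. 1 * real (card {S' \<in> level C 4. L \<subseteq> S'})) =
      (\<Sum>S'\<in>level C 4. \<Sum>L | L \<in> lines_in S \<and> L \<subseteq> S'. 1)"
    by (rule sum_incidence) auto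
  also have "\<dots> = (\<Sum>S'\<in>level C 4. (if S' = S then (q\<^sup>2 + 1) * (q\<^sup>2 + q + 1) else 0) +
      of_bool (S \<noteq> S' \<and> vec.dim (S \<inter> S') = 2))"
  proof (rule sum.cong[OF refl])
    fix S' assume S': "S' \<in> level C 4"
    have eq: "{L. L \<in> lines_in S \<and> L \<subseteq> S'} = lines_in (S \<inter> S')" unfolding lines_in_def by auto
    have sub: "vec.subspace (S \<inter> S')" using S S' level_subspace vec.subspace_inter by blast
    show "(\<Sum>L | L \<in> lines_in S \<and> L \<subseteq> S'. 1) = (if S' = S then (q\<^sup>2 + 1) * (q\<^sup>2 + q + 1) else 0) +
      of_bool (S \<noteq> S' \<and> vec.dim (S \<inter> S') = 2)"
    proof (cases "S' = S")
      case True
      then show ?thesis using card_lines_small(3)[of S] S level_subspace unfolding eq by simp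
    next
      case False
      then have "vec.dim (S \<inter> S') \<le> 2"
        using code_dim_Int[of S S'] level_subspace(2,3)[OF S] level_subspace(2,3)[OF S'] by auto
      moreover have "lines_in (S \<inter> S') = {}" if "vec.dim (S \<inter> S') < 2"
      proof -
        have False if L: "L \<in> lines_in (S \<inter> S')" for L
        proof -
          have "vec.dim L = 2" "L \<subseteq> S \<inter> S'" using L unfolding lines_in_def by blast+
          then show False using vec.dim_subset[of L "S \<inter> S'"] \<open>vec.dim (S \<inter> S') < 2\<close> by simp
        qed
        then show ?thesis by blast
      qed
      ultimately show ?thesis
        using False card_lines_small(1)[OF sub] unfolding eq by (cases "vec.dim (S \<inter> S') = 2") auto
    qed
  qed
  also have "\<dots> = (q\<^sup>2 + 1) * (q\<^sup>2 + q + 1) + (\<Sum>S'\<in>level C 4. of_bool (S \<noteq> S' \<and> vec.dim (S \<inter> S') = 2))"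
    using S by (simp only: sum.distrib) simp
  finally show ?thesis unfolding solids_on_def by simp
qed

text \<open>This is N/s - x - y in the notation of the opening summary, because q^4 + q^2 + 1 = (q^2
  + q + 1)(q^2 - q + 1).\<close>

definition slack :: real where
  "slack = (q^6 + q^5 + q^4 + q^3 + q\<^sup>2 + q + 1) * (q\<^sup>2 - q + 1)
     - real (card (level C 3)) - real (card (level C 4))"

text \<open>The defect vanishes on the lines of planes and on the codewords of dimension 2. Testing
  it against itself therefore leaves only its total and the part from the solids, which involves the
  number of meeting pairs.\<close>

lemma sum_defect_square:
  "(q\<^sup>2 + q + 1) * slack \<ge> (\<Sum>L\<in>lines_in UNIV. (defect L)\<^sup>2) + real (card (level C 2))
     + (q\<^sup>2 + q + 1) * real (card (level C 4)) * real (card (level C 5)) / (q * (q\<^sup>2 + 1)\<^sup>2)"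
proof -
  let ?s = "q\<^sup>2 + q + 1" and ?\<mu> = "q\<^sup>2 + 1"
  define x y z w D where "x = real (card (level C 3))" and "y = real (card (level C 4))"
    and "z = real (card (level C 2))" and "w = real (card (level C 5))" and "D = meeting_pairs C 4 2"
  define N where "N = real (card (lines_in (UNIV :: ('a^7) set)))"
  have \<mu>: "?\<mu> > 0" by (simp add: add_nonneg_pos)
  have N: "N = (q^6 + q^5 + q^4 + q^3 + q\<^sup>2 + q + 1) * (q^4 + q\<^sup>2 + 1)"
    unfolding N_def by (rule card_lines_small(4)[OF vec.subspace_UNIV dim_UNIV_7])
  have planes: "(\<Sum>L\<in>lines_in E. defect L) = 0" if "E \<in> level C 3" for E
    by (rule sum.neutral) (use planes_on_eq_1[OF that] in \<open>auto simp: defect_def\<close>)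
  have lines: "(\<Sum>L\<in>level C 2. defect L) = 0"
    by (rule sum.neutral) (use line_codeword_free in \<open>auto simp: defect_def\<close>)
  \<comment> \<open>On a line of a solid codeword only solids enter the defect.\<close>
  have solid: "defect L = 1 - solids_on L / ?\<mu>" if "S \<in> level C 4" "L \<in> lines_in S" for S L
  proof -
    have "0 < card {S \<in> level C 4. L \<subseteq> S}"
      using that unfolding lines_in_def by (auto simp: card_gt_0_iff)
    then have ne: "solids_on L \<noteq> 0" unfolding solids_on_def by (simp only: of_nat_eq_0_iff neq0_conv simp_thms)
    have L: "vec.subspace L" "vec.dim L = 2" "L \<subseteq> S" using that unfolding lines_in_def by auto
    have "{E \<in> level C 3. L \<subseteq> E} = {}"
      using planes_on_eq_1(3)[of _ L] ne L unfolding lines_in_def by auto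
    then have "planes_on L = 0" unfolding planes_on_def by (simp only: card.empty of_nat_0)
    moreover have "L \<notin> level C 2" using line_codeword_free(2)[of L] ne by auto
    ultimately show ?thesis unfolding defect_def by simp
  qed
  have "(\<Sum>S\<in>level C 4. \<Sum>L\<in>lines_in S. defect L) =
      (\<Sum>S\<in>level C 4. real (card (lines_in S)) - (\<Sum>L\<in>lines_in S. solids_on L) / ?\<mu>)"
    using solid by (simp add: sum_subtractf sum_divide_distrib)
  also have "\<dots> = (\<Sum>S\<in>level C 4. ?\<mu> * ?s - (?\<mu> * ?s +
      (\<Sum>S'\<in>level C 4. of_bool (S \<noteq> S' \<and> vec.dim (S \<inter> S') = 2))) / ?\<mu>)"
    by (rule sum.cong) (use card_lines_small(3) level_subspace sum_solids_on_solid in auto)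
  also have "\<dots> = y * (?\<mu> * ?s) - (y * (?\<mu> * ?s) + D) / ?\<mu>"
    unfolding D_def meeting_pairs_def y_def
    by (simp only: sum_subtractf sum.distrib sum_divide_distrib[symmetric]) simp
  finally have solids: "(\<Sum>S\<in>level C 4. \<Sum>L\<in>lines_in S. defect L) = \<dots>" .
  have "(\<Sum>L\<in>lines_in UNIV. defect L) = (\<Sum>L\<in>lines_in UNIV. 1 * defect L)" by simp
  also have "\<dots> = (\<Sum>L\<in>lines_in (UNIV :: ('a^7) set). 1)
     - (\<Sum>E\<in>level C 3. \<Sum>L\<in>lines_in E. 1) - (\<Sum>L\<in>level C 2. 1)
     - (\<Sum>S\<in>level C 4. \<Sum>L\<in>lines_in S. 1) / ?\<mu>"
    by (rule sum_defect_weighted)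
  also have "(\<Sum>L\<in>lines_in (UNIV :: ('a^7) set). 1) = N" unfolding N_def by simp
  also have "(\<Sum>E\<in>level C 3. \<Sum>L\<in>lines_in E. (1::real)) = x * ?s"
  proof -
    have "(\<Sum>E\<in>level C 3. \<Sum>L\<in>lines_in E. (1::real)) = (\<Sum>E\<in>level C 3. ?s)"
      by (rule sum.cong) (use card_lines_small(2) level_subspace in auto)
    then show ?thesis unfolding x_def by simp
  qed
  also have "(\<Sum>L\<in>level C 2. (1::real)) = z" unfolding z_def by simp
  also have "(\<Sum>S\<in>level C 4. \<Sum>L\<in>lines_in S. (1::real)) = y * (?\<mu> * ?s)"
  proof -
    have "(\<Sum>S\<in>level C 4. \<Sum>L\<in>lines_in S. (1::real)) = (\<Sum>S\<in>level C 4. ?\<mu> * ?s)"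
      by (rule sum.cong) (use card_lines_small(3) level_subspace in auto)
    then show ?thesis unfolding y_def by simp
  qed
  also have "y * (?\<mu> * ?s) / ?\<mu> = y * ?s" using \<mu> by simp
  finally have total: "(\<Sum>L\<in>lines_in UNIV. defect L) = N - x * ?s - z - y * ?s" .
  have "(\<Sum>L\<in>lines_in UNIV. (defect L)\<^sup>2) = (\<Sum>L\<in>lines_in UNIV. defect L * defect L)"
    by (simp only: power2_eq_square)
  also have "\<dots> = (N - x * ?s - z - y * ?s) - (y * (?\<mu> * ?s) - (y * (?\<mu> * ?s) + D) / ?\<mu>) / ?\<mu>"
    unfolding sum_defect_weighted total lines solids using planes by simp
  also have "\<dots> = N - x * ?s - z - 2 * y * ?s + y * ?s / ?\<mu> + D / ?\<mu>\<^sup>2"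
  proof -
    have "(y * (m * s) - (y * (m * s) + D) / m) / m = y * s - y * s / m - D / m\<^sup>2" if "m \<noteq> 0" for m s :: real
      using that by (simp add: field_simps power2_eq_square)
    from this[of ?\<mu> ?s] \<mu> show ?thesis by simp
  qed
  finally have sq: "(\<Sum>L\<in>lines_in UNIV. (defect L)\<^sup>2) = \<dots>" .
  \<comment> \<open>The leading coefficient \<open>q * (q ^ 4 + q\<^sup>2)\<close> divided by
    \<open>q * ?\<mu>\<^sup>2\<close> is \<open>1 - 1 / ?\<mu>\<close>. This reduces the terms in
    \<open>y\<close> of the preceding identity to the single \<open>- y * ?s\<close> that occurs in
    \<open>?s * slack\<close>.\<close>
  have "q * D \<le> ?s * y * (q * (q ^ 4 + q\<^sup>2) - w)"
    unfolding D_def y_def w_def by (rule meeting_pairs_bound_dual)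
  then have "(q * D) / (q * ?\<mu>\<^sup>2) \<le> (?s * y * (q * (q ^ 4 + q\<^sup>2) - w)) / (q * ?\<mu>\<^sup>2)"
    using q_pos by (intro divide_right_mono) auto
  also have "\<dots> = y * ?s - y * ?s / ?\<mu> - ?s * y * w / (q * ?\<mu>\<^sup>2)"
  proof -
    have "?s * y * (q * (q ^ 4 + q\<^sup>2) - w) = (y * ?s - y * ?s / ?\<mu> - ?s * y * w / (q * ?\<mu>\<^sup>2)) * (q * ?\<mu>\<^sup>2)"
    proof -
      have "y * ?s / ?\<mu> * (q * ?\<mu>\<^sup>2) = y * ?s * q * ?\<mu>" using \<mu> by (simp add: power2_eq_square)
      moreover have "?s * y * w / (q * ?\<mu>\<^sup>2) * (q * ?\<mu>\<^sup>2) = ?s * y * w" using \<mu> q_pos by simp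
      ultimately have "(y * ?s - y * ?s / ?\<mu> - ?s * y * w / (q * ?\<mu>\<^sup>2)) * (q * ?\<mu>\<^sup>2) =
          y * ?s * (q * ?\<mu>\<^sup>2) - y * ?s * q * ?\<mu> - ?s * y * w"
        by (simp only: left_diff_distrib)
      also have "\<dots> = ?s * y * (q * (q ^ 4 + q\<^sup>2) - w)" by algebra
      finally show ?thesis by simp
    qed
    then show ?thesis using \<mu> q_pos by (simp add: eq_divide_eq)
  qed
  finally have "D / ?\<mu>\<^sup>2 \<le> y * ?s - y * ?s / ?\<mu> - ?s * y * w / (q * ?\<mu>\<^sup>2)" using q_pos by simp
  moreover have "?s * slack = N - x * ?s - y * ?s"
    unfolding slack_def N x_def y_def by algebra
  ultimately show ?thesis using sq unfolding x_def y_def z_def w_def by linarith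
qed

end


section \<open>Testing the defect against the weights\<close>

context distance_four_code
begin

definition total_weight :: "('a ^ 7) set \<Rightarrow> real" where
  "total_weight L = (\<Sum>W\<in>level C 5. weight W L)"

lemma sum_total_weight:
  "(\<Sum>L\<in>lines_in UNIV. total_weight L) =
     real (card (level C 5)) * ((q\<^sup>2 + 1) * q ^ 3 * (q\<^sup>2 + q + 1) * (q\<^sup>2 - 1))"
proof -
  have "(\<Sum>L\<in>lines_in UNIV. total_weight L) = (\<Sum>W\<in>level C 5. \<Sum>L\<in>lines_in UNIV. weight W L)"
    unfolding total_weight_def by (rule sum.swap)
  also have "\<dots> = (\<Sum>W\<in>level C 5. (q\<^sup>2 + 1) * q ^ 3 * (q\<^sup>2 + q + 1) * (q\<^sup>2 - 1))"
    by (rule sum.cong[OF refl]) (rule sum_weight_all, rule level_subspace(1), assumption, rule level_subspace(2))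
  finally show ?thesis by simp
qed

text \<open>A codeword of dimension 2 inside one of dimension 5 would have distance 3 from it, so
  the positive containment term is absent.\<close>

lemma weight_line_le:
  assumes L: "L \<in> level C 2" and W: "W \<in> level C 5"
  shows "weight W L \<le> q\<^sup>2 - 1"
proof -
  have "L \<noteq> W" using level_subspace(2)[OF L] level_subspace(2)[OF W] by auto
  have "\<not> L \<subseteq> W"
  proof
    assume "L \<subseteq> W"
    then have "L \<inter> W = L" by blast
    then show False
      using code_dim_Int[OF level_subspace(3)[OF L] level_subspace(3)[OF W] \<open>L \<noteq> W\<close>]
        level_subspace(2)[OF L] level_subspace(2)[OF W] by simp
  qed
  then have "weight W L = (q\<^sup>2 - 1) - (q\<^sup>2 + q + 1) * real (card (L \<inter> (W - {0})))"
    unfolding weight_def by simp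
  moreover have "0 \<le> (q\<^sup>2 + q + 1) * real (card (L \<inter> (W - {0})))" using q_pos by simp
  ultimately show ?thesis by linarith
qed

text \<open>Planes and solids contribute 0, so only the total weight and the codewords of dimension
  2 remain.\<close>

lemma sum_total_weight_defect:
  "(\<Sum>L\<in>lines_in UNIV. total_weight L * defect L) \<ge>
     real (card (level C 5)) * ((q\<^sup>2 + 1) * q ^ 3 * (q\<^sup>2 + q + 1) * (q\<^sup>2 - 1))
     - real (card (level C 2)) * real (card (level C 5)) * (q\<^sup>2 - 1)"
proof -
  have planes: "(\<Sum>L\<in>lines_in E. total_weight L) = 0" if E: "E \<in> level C 3" for E
  proof -
    have "(\<Sum>L\<in>lines_in E. total_weight L) = (\<Sum>W\<in>level C 5. \<Sum>L\<in>lines_in E. weight W L)"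
      unfolding total_weight_def by (rule sum.swap)
    also have "\<dots> = (\<Sum>W\<in>level C 5. 0)"
    proof (rule sum.cong[OF refl])
      fix W assume W: "W \<in> level C 5"
      have "E \<noteq> W" using level_subspace(2)[OF E] level_subspace(2)[OF W] by auto
      from code_dim_Int[OF level_subspace(3)[OF E] level_subspace(3)[OF W] this]
        code_dim_Int_lower[OF level_subspace(3)[OF E] level_subspace(3)[OF W]]
      have "vec.dim (E \<inter> W) \<in> {1, 2}"
        using level_subspace(2)[OF E] level_subspace(2)[OF W] by simp linarith
      then show "(\<Sum>L\<in>lines_in E. weight W L) = 0"
        by (rule sum_weight_plane[OF level_subspace(1)[OF E] level_subspace(2)[OF E] level_subspace(1)[OF W]])
    qed
    finally show ?thesis by simp
  qed
  have solids: "(\<Sum>L\<in>lines_in S. total_weight L) = 0" if S: "S \<in> level C 4" for S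
  proof -
    have "(\<Sum>L\<in>lines_in S. total_weight L) = (\<Sum>W\<in>level C 5. \<Sum>L\<in>lines_in S. weight W L)"
      unfolding total_weight_def by (rule sum.swap)
    also have "\<dots> = (\<Sum>W\<in>level C 5. 0)"
    proof (rule sum.cong[OF refl])
      fix W assume W: "W \<in> level C 5"
      have "S \<noteq> W" using level_subspace(2)[OF S] level_subspace(2)[OF W] by auto
      from code_dim_Int[OF level_subspace(3)[OF S] level_subspace(3)[OF W] this]
        code_dim_Int_lower[OF level_subspace(3)[OF S] level_subspace(3)[OF W]]
      have "vec.dim (S \<inter> W) = 2"
        using level_subspace(2)[OF S] level_subspace(2)[OF W] by simp
      then show "(\<Sum>L\<in>lines_in S. weight W L) = 0"
        by (rule sum_weight_solid[OF level_subspace(1)[OF S] level_subspace(2)[OF S] level_subspace(1)[OF W]])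
    qed
    finally show ?thesis by simp
  qed
  have "(\<Sum>L\<in>level C 2. total_weight L) \<le> (\<Sum>L\<in>level C 2. \<Sum>W\<in>level C 5. q\<^sup>2 - 1)"
    unfolding total_weight_def by (intro sum_mono weight_line_le)
  then have "(\<Sum>L\<in>level C 2. total_weight L) \<le> real (card (level C 2)) * real (card (level C 5)) * (q\<^sup>2 - 1)"
    by simp
  then show ?thesis
    unfolding sum_defect_weighted sum_total_weight using planes solids by simp
qed

lemma sum_total_weight_square:
  "(\<Sum>L\<in>lines_in UNIV. (total_weight L)\<^sup>2) = real (card (level C 5)) *
    ((q - 1)\<^sup>2 * q ^ 6 * (q\<^sup>2 + q + 1) * (q + 1) * (q^5 + 2 * q^4 + 2 * q^3 + 2 * q\<^sup>2 + q + 1))"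
    (is "_ = _ * ?n")
proof -
  have "(\<Sum>L\<in>lines_in UNIV. (total_weight L)\<^sup>2) =
      (\<Sum>L\<in>lines_in UNIV. \<Sum>W\<in>level C 5. \<Sum>V\<in>level C 5. weight W L * weight V L)"
    unfolding total_weight_def power2_eq_square by (simp only: sum_product)
  also have "\<dots> = (\<Sum>W\<in>level C 5. \<Sum>L\<in>lines_in UNIV. \<Sum>V\<in>level C 5. weight W L * weight V L)"
    by (rule sum.swap)
  also have "\<dots> = (\<Sum>W\<in>level C 5. \<Sum>V\<in>level C 5. \<Sum>L\<in>lines_in UNIV. weight W L * weight V L)"
    by (intro sum.cong[OF refl] sum.swap)
  also have "\<dots> = (\<Sum>W\<in>level C 5. \<Sum>V\<in>level C 5. if W = V then ?n else 0)"
  proof (intro sum.cong[OF refl])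
    fix W V assume W: "W \<in> level C 5" and V: "V \<in> level C 5"
    show "(\<Sum>L\<in>lines_in UNIV. weight W L * weight V L) = (if W = V then ?n else 0)"
    proof (cases "W = V")
      case True
      then show ?thesis
        using sum_weight_square[OF level_subspace(1,2)[OF W]] by (simp only: power2_eq_square[of "weight _ _"] if_True simp_thms)
    next
      case False
      then have "V \<noteq> W" by simp
      from code_dim_Int[OF level_subspace(3)[OF V] level_subspace(3)[OF W] this]
        code_dim_Int_lower[OF level_subspace(3)[OF V] level_subspace(3)[OF W]]
      have "vec.dim (V \<inter> W) = 3"
        using level_subspace(2)[OF V] level_subspace(2)[OF W] by simp
      from sum_weight_orthogonal[OF level_subspace(1,2)[OF W] level_subspace(1,2)[OF V] this]
      show ?thesis using False by simp
    qed
  qed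
  also have "\<dots> = (\<Sum>W\<in>level C 5. ?n)"
    by (rule sum.cong[OF refl]) simp
  finally show ?thesis by simp
qed

text \<open>The complements of these codewords are lines meeting only in zero, inside the hyperplane
  orthogonal to \<open>v\<close>; the bound is (q^6 - 1)/(q^2 - 1).\<close>

lemma card_level_5_through:
  assumes v: "v \<noteq> 0"
  shows "real (card {W \<in> level C 5. v \<in> W}) \<le> q ^ 4 + q\<^sup>2 + 1"
proof -
  interpret dual: distance_four_code q F "dual_code C" by (rule dual_code)
  let ?W = "{W \<in> level C 5. v \<in> W}" and ?H = "{u. dotp v u = 0}"
  have mem: "orth W \<in> level (dual_code C) 2" if "W \<in> ?W" for W
    using that dual_level[of 2] by simp
  have inj: "inj_on orth ?W" by (rule inj_on_subset[OF inj_orth]) (auto simp: level_def)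
  have "card (\<Union>W\<in>?W. orth W - {0}) = (\<Sum>W\<in>?W. card (orth W - {0}))"
  proof (rule card_UN_disjoint)
    have "orth W \<inter> orth W' = {0}" if "W \<in> ?W" "W' \<in> ?W" "W \<noteq> W'" for W W'
    proof -
      have "orth W \<noteq> orth W'" using inj_onD[OF inj _ that(1,2)] that(3) by blast
      then show ?thesis using dual.level_disjoint_Int[OF mem[OF that(1)] mem[OF that(2)]] by simp
    qed
    then show "\<forall>W\<in>?W. \<forall>W'\<in>?W. W \<noteq> W' \<longrightarrow> (orth W - {0}) \<inter> (orth W' - {0}) = {}" by blast
  qed auto
  also have "real \<dots> = (\<Sum>W\<in>?W. q\<^sup>2 - 1)"
    using dual.level_subspace(1,2)[OF mem] by (simp add: real_card_nonzero)
  finally have "real (card (\<Union>W\<in>?W. orth W - {0})) = real (card ?W) * (q\<^sup>2 - 1)" by simp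
  moreover have "card (\<Union>W\<in>?W. orth W - {0}) \<le> card (?H - {0})"
    by (rule card_mono) (auto simp: orth_def dotp_commute)
  moreover have "real (card (?H - {0})) = q ^ 6 - 1"
  proof -
    have "real (CARD('a) * CARD('a) ^ 6) = real (CARD('a) * card ?H)"
      using card_dotp_hyperplane[OF v] by (simp add: power_Suc[symmetric])
    then have "q * q ^ 6 = q * real (card ?H)" unfolding q_eq by (simp only: of_nat_mult of_nat_power)
    then have "real (card ?H) = q ^ 6" using q_pos(3) by simp
    moreover have "Suc (card (?H - {0})) = card ?H" by (rule Suc_card_minus_zero) (simp add: dotp_simps)
    ultimately show ?thesis by linarith
  qed
  ultimately have "real (card ?W) * (q\<^sup>2 - 1) \<le> q ^ 6 - 1" by linarith
  also have "\<dots> = (q ^ 4 + q\<^sup>2 + 1) * (q\<^sup>2 - 1)" by algebra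
  finally have le: "real (card ?W) * (q\<^sup>2 - 1) \<le> (q ^ 4 + q\<^sup>2 + 1) * (q\<^sup>2 - 1)" .
  have "0 < q\<^sup>2 - 1" using q_pos by simp
  then show ?thesis using le by (simp only: mult_le_cancel_right_pos)
qed

lemma sum_total_weight_star_le:
  assumes v: "v \<noteq> 0"
  shows "(\<Sum>L | L \<in> lines_in UNIV \<and> v \<in> L. total_weight L) \<le>
    (q ^ 4 + q\<^sup>2 + 1) * ((q\<^sup>2 + q + 1) * q ^ 3 * (q\<^sup>2 - 1))"
proof -
  let ?c = "(q\<^sup>2 + q + 1) * q ^ 3 * (q\<^sup>2 - 1)"
  have c: "0 \<le> ?c" using q_pos by simp
  have "(\<Sum>L | L \<in> lines_in UNIV \<and> v \<in> L. total_weight L) =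
      (\<Sum>W\<in>level C 5. \<Sum>L | L \<in> lines_in UNIV \<and> v \<in> L. weight W L)"
    unfolding total_weight_def by (rule sum.swap)
  also have "\<dots> \<le> (\<Sum>W\<in>level C 5. if v \<in> W then ?c else 0)"
  proof (rule sum_mono)
    fix W assume W: "W \<in> level C 5"
    have "0 \<le> (q\<^sup>2 + q + 1) * q\<^sup>2 * (q - 1)" using q_pos by simp
    then show "(\<Sum>L | L \<in> lines_in UNIV \<and> v \<in> L. weight W L) \<le> (if v \<in> W then ?c else 0)"
      unfolding sum_weight_star[OF level_subspace(1,2)[OF W] v]
      by (cases "v \<in> W") (simp_all only: if_True if_False minus_mult_left[symmetric] neg_le_0_iff_le order_refl)
  qed
  also have "\<dots> = real (card {W \<in> level C 5. v \<in> W}) * ?c"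
    by (simp add: sum.If_cases Int_def)
  also have "\<dots> \<le> (q ^ 4 + q\<^sup>2 + 1) * ?c"
    by (rule mult_right_mono[OF card_level_5_through[OF v] c])
  finally show ?thesis .
qed

text \<open>The squares of \<open>defect L - a * total_weight L - b * card (L \<inter> K)\<close>
  have a nonnegative sum; this is expanded and combined with \<open>sum_defect_square\<close>.
  \<open>K\<close> is a union of one-dimensional subspaces with zero removed: it will be empty, come
  from a codeword of dimension 1, or be the part covered by the codewords of dimension 2.\<close>

lemma test_defect:
  assumes K: "\<And>v. v \<in> K \<Longrightarrow> v \<noteq> 0" "\<And>v. v \<in> K \<Longrightarrow> vec.span {v} - {0} \<subseteq> K"
    and b: "0 \<le> b" and k: "k = real (card K)" and w: "w = real (card (level C 5))"
    and T: "(\<Sum>v\<in>K. \<Sum>L | L \<in> lines_in UNIV \<and> v \<in> L. defect L) \<ge> T"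
    and D: "D = q^5 + 2 * q^4 + 2 * q^3 + 2 * q\<^sup>2 + q + 1"
  shows "(q\<^sup>2 + q + 1) * slack \<ge> (q\<^sup>2 + q + 1) * w * ((q\<^sup>2 + 1)\<^sup>2 * (q + 1) / D)
      + (q\<^sup>2 + q + 1) * real (card (level C 4)) * w / (q * (q\<^sup>2 + 1)\<^sup>2) - real (card (level C 2))
      + 2 * b * T - 2 * b * k * ((q ^ 4 + q\<^sup>2 + 1) * (q\<^sup>2 + q + 1) * (q\<^sup>2 + 1) * (q + 1) / D)
      - b\<^sup>2 * k * (q ^ 6 - q + k)"
proof -
  \<comment> \<open>For \<open>w > 0\<close> this is the quotient of the values in
    \<open>sum_total_weight\<close> and \<open>sum_total_weight_square\<close>, in which
    \<open>w\<close> cancels; it maximises the quadratic in \<open>a\<close> evaluated in step 1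
    below.\<close>
  define a where "a = (q\<^sup>2 + 1) / (q ^ 3 * D * (q - 1))"
  define z where "z = real (card (level C 2))"
  let ?s = "q\<^sup>2 + q + 1"
  let ?m = "\<lambda>L. real (card (L \<inter> K))"
  have D0: "0 < D" unfolding D using q_pos(1) by (intro add_pos_pos) simp_all
  have a0: "0 \<le> a" unfolding a_def using D0 q_pos by simp
  have aq: "a * (q ^ 3 * (q - 1)) = (q\<^sup>2 + 1) / D"
    unfolding a_def using q_pos(3,4) D0 by simp
  have mT: "(\<Sum>L\<in>lines_in UNIV. G L * ?m L) = (\<Sum>v\<in>K. \<Sum>L | L \<in> lines_in UNIV \<and> v \<in> L. G L)" for G
    by (rule sum_card_Int) auto
  \<comment> \<open>The \<open>q - 1\<close> nonzero multiples of \<open>v\<close> lie on every line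
    through \<open>v\<close>, the remaining vectors of \<open>K\<close> on one of these lines
    each.\<close>
  have inner: "(\<Sum>L | L \<in> lines_in UNIV \<and> v \<in> L. ?m L) = q ^ 6 - q + k" if v: "v \<in> K" for v
  proof -
    have sp: "K \<inter> vec.span {v} = vec.span {v} - {0}" using K v by blast
    have "(\<Sum>L\<in>{L. L \<in> lines_in UNIV \<and> v \<in> L}. 1 * ?m L) =
        (\<Sum>a\<in>K. \<Sum>L | L \<in> {L. L \<in> lines_in UNIV \<and> v \<in> L} \<and> a \<in> L. 1)"
      by (rule sum_card_Int) auto
    also have "\<dots> = (\<Sum>a\<in>K. real (card {L \<in> lines_in UNIV. v \<in> L \<and> a \<in> L}))" by (simp add: conj_assoc)
    also have "\<dots> = real (card (K \<inter> vec.span {v})) * real (card {L \<in> lines_in UNIV. v \<in> L})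
        + real (card (K - vec.span {v}))"
      by (rule sum_of_card_through_pair) (use K v in auto)
    also have "real (card (K - vec.span {v})) = k - (q - 1)"
    proof -
      have "card K = card (K \<inter> vec.span {v}) + card (K - vec.span {v})" by (rule card_Int_Diff) simp
      then show ?thesis unfolding sp k using card_span_nonzero[OF K(1)[OF v]] by simp
    qed
    also have "real (card (K \<inter> vec.span {v})) * real (card {L \<in> lines_in UNIV. v \<in> L}) = q ^ 6 - 1"
      unfolding sp card_span_nonzero[OF K(1)[OF v]] by (rule card_lines_through_point[OF K(1)[OF v]])
    finally show ?thesis by simp
  qed
  have mm: "(\<Sum>L\<in>lines_in UNIV. (?m L)\<^sup>2) = k * (q ^ 6 - q + k)"
  proof -
    have "(\<Sum>L\<in>lines_in UNIV. (?m L)\<^sup>2) = (\<Sum>v\<in>K. \<Sum>L | L \<in> lines_in UNIV \<and> v \<in> L. ?m L)"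
      unfolding power2_eq_square by (rule mT)
    also have "\<dots> = (\<Sum>v\<in>K. q ^ 6 - q + k)" by (rule sum.cong[OF refl inner])
    finally show ?thesis unfolding k by simp
  qed
  have md: "T \<le> (\<Sum>L\<in>lines_in UNIV. defect L * ?m L)" unfolding mT by (rule T)
  have mw: "(\<Sum>L\<in>lines_in UNIV. total_weight L * ?m L) \<le> k * ((q ^ 4 + q\<^sup>2 + 1) * (?s * q ^ 3 * (q\<^sup>2 - 1)))"
  proof -
    have "(\<Sum>L\<in>lines_in UNIV. total_weight L * ?m L) \<le> (\<Sum>v\<in>K. (q ^ 4 + q\<^sup>2 + 1) * (?s * q ^ 3 * (q\<^sup>2 - 1)))"
      unfolding mT by (rule sum_mono, rule sum_total_weight_star_le, rule K(1))
    then show ?thesis unfolding k by simp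
  qed
  let ?f = "defect" and ?P = "total_weight"
  have "0 \<le> (\<Sum>L\<in>lines_in UNIV. (?f L - a * ?P L - b * ?m L)\<^sup>2)" by (rule sum_nonneg) simp
  also have "\<dots> = (\<Sum>L\<in>lines_in UNIV. (?f L)\<^sup>2 + a\<^sup>2 * (?P L)\<^sup>2 + b\<^sup>2 * (?m L)\<^sup>2
      - 2 * a * (?P L * ?f L) - 2 * b * (?f L * ?m L) + 2 * a * b * (?P L * ?m L))"
    by (rule sum.cong[OF refl]) (simp add: power2_eq_square algebra_simps)
  also have "\<dots> = (\<Sum>L\<in>lines_in UNIV. (?f L)\<^sup>2) + a\<^sup>2 * (\<Sum>L\<in>lines_in UNIV. (?P L)\<^sup>2)
      + b\<^sup>2 * (\<Sum>L\<in>lines_in UNIV. (?m L)\<^sup>2) - 2 * a * (\<Sum>L\<in>lines_in UNIV. ?P L * ?f L)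
      - 2 * b * (\<Sum>L\<in>lines_in UNIV. ?f L * ?m L) + 2 * a * b * (\<Sum>L\<in>lines_in UNIV. ?P L * ?m L)"
    by (simp only: sum.distrib sum_subtractf sum_distrib_left)
  finally have *: "0 \<le> \<dots>" .
  have "2 * a * (\<Sum>L\<in>lines_in UNIV. ?P L * ?f L) \<ge>
      2 * a * (w * ((q\<^sup>2 + 1) * q ^ 3 * ?s * (q\<^sup>2 - 1)) - z * w * (q\<^sup>2 - 1))"
    using sum_total_weight_defect a0 unfolding w z_def by (intro mult_left_mono) simp_all
  moreover have "2 * b * (\<Sum>L\<in>lines_in UNIV. ?f L * ?m L) \<ge> 2 * b * T"
    using md b by (intro mult_left_mono) simp_all
  moreover have "2 * a * b * (\<Sum>L\<in>lines_in UNIV. ?P L * ?m L) \<le>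
      2 * a * b * (k * ((q ^ 4 + q\<^sup>2 + 1) * (?s * q ^ 3 * (q\<^sup>2 - 1))))"
    using mw a0 b by (intro mult_left_mono) simp_all
  ultimately have main: "(\<Sum>L\<in>lines_in UNIV. (?f L)\<^sup>2) \<ge>
      2 * a * (w * ((q\<^sup>2 + 1) * q ^ 3 * ?s * (q\<^sup>2 - 1)) - z * w * (q\<^sup>2 - 1))
      - a\<^sup>2 * (w * ((q - 1)\<^sup>2 * q ^ 6 * ?s * (q + 1) * D))
      + 2 * b * T - 2 * a * b * (k * ((q ^ 4 + q\<^sup>2 + 1) * (?s * q ^ 3 * (q\<^sup>2 - 1))))
      - b\<^sup>2 * (k * (q ^ 6 - q + k))"
    using * unfolding mm sum_total_weight_square w D by linarith
  have 1: "2 * a * (w * ((q\<^sup>2 + 1) * q ^ 3 * ?s * (q\<^sup>2 - 1))) - a\<^sup>2 * (w * ((q - 1)\<^sup>2 * q ^ 6 * ?s * (q + 1) * D))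
      = ?s * w * ((q\<^sup>2 + 1)\<^sup>2 * (q + 1) / D)"
  proof -
    have "2 * a * (w * ((q\<^sup>2 + 1) * q ^ 3 * ?s * (q\<^sup>2 - 1))) = 2 * (a * (q ^ 3 * (q - 1))) * (w * (q\<^sup>2 + 1) * ?s * (q + 1))"
      by algebra
    moreover have "a\<^sup>2 * (w * ((q - 1)\<^sup>2 * q ^ 6 * ?s * (q + 1) * D)) =
        (a * (q ^ 3 * (q - 1))) * ((a * (q ^ 3 * (q - 1))) * D) * (w * ?s * (q + 1))" by algebra
    moreover have "(q\<^sup>2 + 1) / D * D = q\<^sup>2 + 1" using D0 by simp
    ultimately have "2 * a * (w * ((q\<^sup>2 + 1) * q ^ 3 * ?s * (q\<^sup>2 - 1))) - a\<^sup>2 * (w * ((q - 1)\<^sup>2 * q ^ 6 * ?s * (q + 1) * D))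
      = 2 * ((q\<^sup>2 + 1) / D) * (w * (q\<^sup>2 + 1) * ?s * (q + 1)) - ((q\<^sup>2 + 1) / D) * (q\<^sup>2 + 1) * (w * ?s * (q + 1))"
      unfolding aq by simp
    also have "\<dots> = ?s * w * ((q\<^sup>2 + 1) * ((q\<^sup>2 + 1) / D) * (q + 1))" by algebra
    finally show ?thesis by (simp add: power2_eq_square)
  qed
  have 2: "2 * a * b * (k * ((q ^ 4 + q\<^sup>2 + 1) * (?s * q ^ 3 * (q\<^sup>2 - 1)))) =
      2 * b * k * ((q ^ 4 + q\<^sup>2 + 1) * ?s * (q\<^sup>2 + 1) * (q + 1) / D)"
  proof -
    have "2 * a * b * (k * ((q ^ 4 + q\<^sup>2 + 1) * (?s * q ^ 3 * (q\<^sup>2 - 1)))) =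
      2 * b * k * ((q ^ 4 + q\<^sup>2 + 1) * ?s * (a * (q ^ 3 * (q - 1))) * (q + 1))" by algebra
    then show ?thesis unfolding aq by simp
  qed
  \<comment> \<open>The codewords of dimension 2 disturb the test by at most \<open>2 * z\<close>,
    by the partial spread bound on \<open>w\<close>. As \<open>sum_defect_square\<close> supplies
    \<open>z\<close>, the net loss is \<open>z\<close>.\<close>
  have 3: "2 * a * (z * w * (q\<^sup>2 - 1)) \<le> 2 * z"
  proof -
    have "(q\<^sup>2 + 1) * (q + 1) * w \<le> (q\<^sup>2 + 1) * (q + 1) * (q ^ 5 + q ^ 3 + 1)"
      using card_level_5 q_pos(1) unfolding w by (intro mult_left_mono) simp_all
    also have "\<dots> \<le> q ^ 3 * D"
    proof -
      have "q ^ 3 * D - (q\<^sup>2 + 1) * (q + 1) * (q ^ 5 + q ^ 3 + 1) = q ^ 7 - q ^ 3 - q\<^sup>2 - q - 1"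
        unfolding D by algebra
      moreover have "q ^ 3 + q\<^sup>2 + q + 1 \<le> q ^ 7"
      proof -
        have "q ^ 3 * 16 \<le> q ^ 3 * q ^ 4"
          using q_ge_2 power_mono[of 2 q 4] by (intro mult_left_mono) simp_all
        moreover have "q ^ 3 * q ^ 4 = q ^ 7" by algebra
        moreover have "q\<^sup>2 \<le> q ^ 3" "q ^ 1 \<le> q ^ 3" "q ^ 0 \<le> q ^ 3"
          using q_ge_2 by (intro power_increasing; simp)+
        ultimately show ?thesis by simp
      qed
      ultimately show ?thesis by linarith
    qed
    finally have le: "(q\<^sup>2 + 1) * (q + 1) * w \<le> q ^ 3 * D" .
    have "a * (w * (q\<^sup>2 - 1)) = ((q\<^sup>2 + 1) * (q + 1) * w) / (q ^ 3 * D)"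
    proof -
      have "q\<^sup>2 - 1 = (q - 1) * (q + 1)" by algebra
      then show ?thesis unfolding a_def using q_pos(3,4) D0 by simp
    qed
    also have "\<dots> \<le> 1" using le D0 q_pos(1) by (simp add: divide_le_eq_1)
    finally have "2 * z * (a * (w * (q\<^sup>2 - 1))) \<le> 2 * z * 1"
      unfolding z_def by (intro mult_left_mono) simp_all
    then show ?thesis by (simp add: mult_ac)
  qed
  show ?thesis
    using main 1 2 3 sum_defect_square unfolding w[symmetric] z_def[symmetric]
    by (simp only: right_diff_distrib mult.assoc[of _ k])
qed

end


section \<open>The size of a code\<close>

context finite_field_size
begin

definition den :: real where
  "den = q^5 + 2 * q^4 + 2 * q^3 + 2 * q\<^sup>2 + q + 1"

text \<open>The slack that each codeword of dimension 5 uses up; its remaining share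
  \<open>1 - coeff\<close> is what may exceed \<open>base\<close>.\<close>

definition coeff :: real where
  "coeff = (q\<^sup>2 + 1)\<^sup>2 * (q + 1) / den"

text \<open>The value N/s of the opening summary.\<close>

definition base :: real where
  "base = (q^6 + q^5 + q^4 + q^3 + q\<^sup>2 + q + 1) * (q\<^sup>2 - q + 1)"

lemma den_pos: "0 < den"
  unfolding den_def using q_pos(1) by (intro add_pos_pos) simp_all

lemma one_minus_coeff: "1 - coeff = q ^ 4 / den"
proof -
  have "den - (q\<^sup>2 + 1)\<^sup>2 * (q + 1) = q ^ 4" unfolding den_def by algebra
  then show ?thesis unfolding coeff_def using den_pos by (simp add: field_simps)
qed

lemma coeff_bounds: "9 / 11 \<le> coeff" "coeff \<le> 1"
proof -
  \<comment> \<open>In terms of \<open>q - 2\<close> the difference is a polynomial with nonnegative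
    coefficients. The same shift proves the later inequalities of this kind.\<close>
  define t where "t = q - 2"
  have t: "0 \<le> t" using q_ge_2 unfolding t_def by simp
  have "2 * den - 11 * q ^ 4 = 6 + 2 * t + 20 * t\<^sup>2 + 28 * t ^ 3 + 13 * t ^ 4 + 2 * t ^ 5"
    unfolding den_def t_def by algebra
  moreover have "0 \<le> 6 + 2 * t + 20 * t\<^sup>2 + 28 * t ^ 3 + 13 * t ^ 4 + 2 * t ^ 5"
    using t by (intro add_nonneg_nonneg mult_nonneg_nonneg zero_le_power) simp_all
  ultimately have "11 * q ^ 4 \<le> 2 * den" by linarith
  then have "q ^ 4 / den \<le> 2 / 11" using den_pos by (simp add: field_simps)
  then show "9 / 11 \<le> coeff" using one_minus_coeff by linarith
  have "0 \<le> q ^ 4 / den" using den_pos q_pos by simp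
  then show "coeff \<le> 1" using one_minus_coeff by linarith
qed

text \<open>The net effect of testing against a codeword of dimension 1. A gain of q^2 + q + 1
  amounts to one unit of slack.\<close>

lemma point_gain:
  "q\<^sup>2 + q + 1 \<le> (q ^ 6 - 1) / (q - 1) - 2 * ((q ^ 4 + q\<^sup>2 + 1) * (q\<^sup>2 + q + 1) * (q\<^sup>2 + 1) * (q + 1) / den)"
proof -
  define t where "t = q - 2"
  have t: "0 \<le> t" using q_ge_2 unfolding t_def by simp
  have "(q ^ 3 + 1) * (q ^ 5 - 2 * q\<^sup>2 - q - 1) - den =
      98 + 714 * t + 1538 * t\<^sup>2 + 1685 * t ^ 3 + 1097 * t ^ 4 + 446 * t ^ 5 + 112 * t ^ 6 + 16 * t ^ 7 + t ^ 8"
    unfolding den_def t_def by algebra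
  moreover have "0 \<le> 98 + 714 * t + 1538 * t\<^sup>2 + 1685 * t ^ 3 + 1097 * t ^ 4 + 446 * t ^ 5 + 112 * t ^ 6 + 16 * t ^ 7 + t ^ 8"
    using t by (intro add_nonneg_nonneg mult_nonneg_nonneg zero_le_power) simp_all
  ultimately have "den \<le> (q ^ 3 + 1) * (q ^ 5 - 2 * q\<^sup>2 - q - 1)" by linarith
  then have "(q\<^sup>2 + q + 1) * den \<le> (q\<^sup>2 + q + 1) * ((q ^ 3 + 1) * (q ^ 5 - 2 * q\<^sup>2 - q - 1))"
    using q_pos by (intro mult_left_mono) simp_all
  also have "\<dots> = (q ^ 5 + q ^ 4 + q ^ 3 + q\<^sup>2 + q + 1) * den - 2 * ((q ^ 4 + q\<^sup>2 + 1) * (q\<^sup>2 + q + 1) * (q\<^sup>2 + 1) * (q + 1))"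
    unfolding den_def by algebra
  finally have "q\<^sup>2 + q + 1 \<le> ((q ^ 5 + q ^ 4 + q ^ 3 + q\<^sup>2 + q + 1) * den
      - 2 * ((q ^ 4 + q\<^sup>2 + 1) * (q\<^sup>2 + q + 1) * (q\<^sup>2 + 1) * (q + 1))) / den"
    using den_pos by (simp only: pos_le_divide_eq)
  also have "\<dots> = (q ^ 5 + q ^ 4 + q ^ 3 + q\<^sup>2 + q + 1)
      - 2 * ((q ^ 4 + q\<^sup>2 + 1) * (q\<^sup>2 + q + 1) * (q\<^sup>2 + 1) * (q + 1) / den)"
    using den_pos by (simp add: diff_divide_distrib)
  also have "q ^ 5 + q ^ 4 + q ^ 3 + q\<^sup>2 + q + 1 = (q ^ 6 - 1) / (q - 1)"
  proof -
    have "(q ^ 5 + q ^ 4 + q ^ 3 + q\<^sup>2 + q + 1) * (q - 1) = q ^ 6 - 1" by algebra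
    then show ?thesis by (simp only: nonzero_eq_divide_eq[OF q_pos(4)])
  qed
  finally show ?thesis .
qed

text \<open>The analogous gain for each codeword of dimension 2. The term \<open>z\<close> stems
  from pairs of such codewords, and the final 1 is their individual loss in
  \<open>test_defect\<close>.\<close>

lemma line_gain:
  defines "g \<equiv> q ^ 5 + q ^ 4 + q ^ 3 + q\<^sup>2 + q"
  assumes y: "2 * y \<le> q * (q\<^sup>2 + 1)\<^sup>2" and z: "4 * z \<le> q ^ 5 + q ^ 3 + 1"
  shows "q\<^sup>2 + q + 1 \<le> 2 * g - 2 * (q\<^sup>2 + q + 1) * y / ((q + 1) * (q\<^sup>2 + 1))
    - 2 * ((q ^ 4 + q\<^sup>2 + 1) * (q\<^sup>2 + q + 1) * (q\<^sup>2 + 1) * (q + 1) / den) - g / (q + 1) - z - 1"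
proof -
  let ?s = "q\<^sup>2 + q + 1" and ?\<mu> = "q\<^sup>2 + 1" and ?M = "q ^ 4 + q\<^sup>2 + 1" and ?B = "q ^ 5 + q ^ 3 + 1"
  define t where "t = q - 2"
  have t: "0 \<le> t" using q_ge_2 unfolding t_def by simp
  have \<mu>: "0 < ?\<mu>" by (simp add: add_nonneg_pos)
  \<comment> \<open>The claim with \<open>y\<close> and \<open>z\<close> at their largest values,
    multiplied by \<open>4 * (q + 1) * den\<close>.\<close>
  let ?R = "4 * (q + 1) * den * (2 * g - 1 - ?s) - (q + 1) * den * ?B - 4 * (?s * q * ?\<mu>) * den
      - 8 * (?M * ?s * ?\<mu> * (q + 1)) * (q + 1) - 4 * g * den"
  have "?R = 14511 + 116394 * t + 327491 * t\<^sup>2 + 502227 * t ^ 3 + 490176 * t ^ 4 + 326553 * t ^ 5 + 153155 * t ^ 6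
      + 50873 * t ^ 7 + 11771 * t ^ 8 + 1811 * t ^ 9 + 167 * t ^ 10 + 7 * t ^ 11"
    unfolding den_def t_def g_def by algebra
  also have "0 \<le> \<dots>"
    using t by (intro add_nonneg_nonneg mult_nonneg_nonneg zero_le_power) simp_all
  finally have R: "0 \<le> ?R" .
  have p: "0 < 4 * (q + 1) * den" using den_pos q_pos by simp
  have "?R / (4 * (q + 1) * den) = 2 * g - 1 - ?s - ?B / 4 - ?s * q * ?\<mu> / (q + 1)
      - 2 * (?M * ?s * ?\<mu> * (q + 1) / den) - g / (q + 1)"
  proof -
    \<comment> \<open>Stated for arbitrary reals so that the polynomials are not expanded.\<close>
    have gen: "(4 * a * d * e - a * d * f - 4 * h * d - 8 * k * a - 4 * g * d) / (4 * a * d) =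
        e - f / 4 - h / a - 2 * (k / d) - g / a" if "a \<noteq> 0" "d \<noteq> 0" for a d e f h k :: real
      using that by (simp add: field_simps)
    show ?thesis by (rule gen) (use den_pos q_pos(6) in simp_all)
  qed
  then have main: "0 \<le> 2 * g - 1 - ?s - ?B / 4 - ?s * q * ?\<mu> / (q + 1)
      - 2 * (?M * ?s * ?\<mu> * (q + 1) / den) - g / (q + 1)"
    using R p by (metis divide_nonneg_pos)
  have "2 * ?s * y / ((q + 1) * ?\<mu>) \<le> ?s * q * ?\<mu> / (q + 1)"
  proof -
    have "?s * (2 * y) / ((q + 1) * ?\<mu>) \<le> ?s * (q * ?\<mu>\<^sup>2) / ((q + 1) * ?\<mu>)"
      using y \<mu> q_pos by (intro divide_right_mono mult_left_mono) simp_all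
    also have "\<dots> = ?s * q * ?\<mu> / (q + 1)"
      using \<mu> by (simp add: power2_eq_square[of ?\<mu>])
    finally show ?thesis by (simp only: mult.left_commute[of ?s 2] mult.assoc)
  qed
  note y' = this
  show ?thesis
  proof -
    have gen: "s \<le> e - A - X - G - z - 1"
      if "0 \<le> e - 1 - s - B / 4 - H - X - G" "A \<le> H" "4 * z \<le> B" for s e A X G B H :: real
      using that by linarith
    show ?thesis by (rule gen[OF main y' z])
  qed
qed

end

section \<open>Admissible dimensions and lower bounds for the slack\<close>

context distance_four_code
begin

text \<open>The first bound is nonnegativity of \<open>vec.dim (U \<inter> W)\<close> in
  \<open>code_dim_Int\<close>; the second eliminates this dimension between the upper and the lower
  estimate.\<close>

lemma level_exclusion:
  assumes "U \<in> level C i" "W \<in> level C j" "U \<noteq> W"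
  shows "4 \<le> i + j" "i + j \<le> 10"
  using code_dim_Int[OF level_subspace(3)[OF assms(1)] level_subspace(3)[OF assms(2)] assms(3)]
    code_dim_Int_lower[OF level_subspace(3)[OF assms(1)] level_subspace(3)[OF assms(2)]]
    level_subspace(2)[OF assms(1)] level_subspace(2)[OF assms(2)] by linarith+

lemma level_empty:
  assumes "level C i \<noteq> {}" "i \<noteq> j" "i + j < 4 \<or> 10 < i + j"
  shows "level C j = {}"
proof (rule ccontr)
  assume "level C j \<noteq> {}"
  then obtain U W where UW: "U \<in> level C i" "W \<in> level C j" using assms(1) by blast
  moreover from this have "U \<noteq> W" using assms(2) level_subspace(2) by metis
  ultimately show False using level_exclusion[of U i W j] assms(3) by linarith
qed

lemma card_level_le_1:
  assumes "i + i < 4 \<or> 10 < i + i"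
  shows "card (level C i) \<le> 1"
proof -
  have "U = W" if "U \<in> level C i" "W \<in> level C i" for U W
    using level_exclusion[OF that] assms by linarith
  then show ?thesis by (metis card_le_Suc0_iff_eq finite One_nat_def)
qed

lemma card_code: "card C = (\<Sum>k\<le>7. card (level C k))"
proof -
  have "C = (\<Union>k\<in>{..7}. level C k)"
  proof
    show "C \<subseteq> (\<Union>k\<in>{..7}. level C k)"
    proof
      fix U assume "U \<in> C"
      moreover have "vec.dim U \<le> 7" using vec.dim_subset[of U UNIV] unfolding dim_UNIV_7 by simp
      ultimately show "U \<in> (\<Union>k\<in>{..7}. level C k)" unfolding level_def by auto
    qed
  qed (auto simp: level_def)
  moreover have "card (\<Union>k\<in>{..7}. level C k) = (\<Sum>k\<le>7. card (level C k))"
    by (rule card_UN_disjoint) (auto simp: level_def)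
  ultimately show ?thesis by simp
qed

abbreviation n :: "nat \<Rightarrow> real" where
  "n k \<equiv> real (card (level C k))"

lemma real_card_code: "real (card C) = n 0 + n 1 + n 2 + n 3 + n 4 + n 5 + n 6 + n 7"
  unfolding card_code by (simp add: eval_nat_numeral atMost_Suc)

lemma slack_eq: "slack = base - n 3 - n 4"
  unfolding slack_def base_def ..

text \<open>The test with \<open>K\<close> empty, that is, against the weights alone.\<close>

lemma slack_five_bound:
  "slack \<ge> (coeff + n 4 / (q * (q\<^sup>2 + 1)\<^sup>2)) * n 5 - n 2 / (q\<^sup>2 + q + 1)"
proof -
  let ?s = "q\<^sup>2 + q + 1"
  have s: "0 < ?s" using q_pos(1) by (intro add_pos_pos) simp_all
  have "?s * slack \<ge> ?s * n 5 * coeff + ?s * n 4 * n 5 / (q * (q\<^sup>2 + 1)\<^sup>2) - n 2"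
    using test_defect[of "{}" 0 0 "n 5" 0 den] unfolding den_def coeff_def by simp
  also have "?s * n 5 * coeff + ?s * n 4 * n 5 / (q * (q\<^sup>2 + 1)\<^sup>2) - n 2 =
      ?s * ((coeff + n 4 / (q * (q\<^sup>2 + 1)\<^sup>2)) * n 5 - n 2 / ?s)"
  proof -
    have gen: "s * w * c + s * y * w / t - z = s * ((c + y / t) * w - z / s)" if "s \<noteq> 0" for s w c y t z :: real
      using that by (simp add: algebra_simps add_divide_distrib)
    show ?thesis by (rule gen) (use s in simp)
  qed
  finally show ?thesis using s by (simp only: mult_le_cancel_left_pos)
qed

lemma slack_dual: "distance_four_code.slack q (dual_code C) = slack"
proof -
  interpret dual: distance_four_code q F "dual_code C" by (rule dual_code)
  show ?thesis unfolding dual.slack_eq slack_eq by (simp add: card_dual_level)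
qed

text \<open>Only the nonnegativity of the squared defects is used here.\<close>

lemma slack_lines_bound: "slack \<ge> n 2 / (q\<^sup>2 + q + 1) + n 4 * n 5 / (q * (q\<^sup>2 + 1)\<^sup>2)"
proof -
  let ?s = "q\<^sup>2 + q + 1"
  have s: "0 < ?s" using q_pos(1) by (intro add_pos_pos) simp_all
  have "0 \<le> (\<Sum>L\<in>lines_in UNIV. (defect L)\<^sup>2)" by (rule sum_nonneg) simp
  then have "?s * slack \<ge> n 2 + ?s * n 4 * n 5 / (q * (q\<^sup>2 + 1)\<^sup>2)"
    using sum_defect_square by linarith
  also have "n 2 + ?s * n 4 * n 5 / (q * (q\<^sup>2 + 1)\<^sup>2) = ?s * (n 2 / ?s + n 4 * n 5 / (q * (q\<^sup>2 + 1)\<^sup>2))"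
    using s by (simp add: distrib_left)
  finally show ?thesis using s by (simp only: mult_le_cancel_left_pos)
qed

lemma slack_lines_bound_dual: "slack \<ge> n 5 / (q\<^sup>2 + q + 1) + n 3 * n 2 / (q * (q\<^sup>2 + 1)\<^sup>2)"
proof -
  interpret dual: distance_four_code q F "dual_code C" by (rule dual_code)
  show ?thesis using dual.slack_lines_bound unfolding slack_dual by (simp add: card_dual_level)
qed

lemma slack_nonneg: "0 \<le> slack"
proof -
  have "0 \<le> n 2 / (q\<^sup>2 + q + 1) + n 4 * n 5 / (q * (q\<^sup>2 + 1)\<^sup>2)"
    using q_pos by (intro add_nonneg_nonneg divide_nonneg_nonneg mult_nonneg_nonneg) simp_all
  then show ?thesis using slack_lines_bound by linarith
qed

text \<open>No codeword of dimension 2, 3 or 4 contains \<open>p\<close>, so all lines through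
  \<open>p\<close> have defect 1. Testing against these lines gains a unit of slack.\<close>

lemma slack_point_bound:
  assumes p: "p \<in> level C 1"
  shows "slack \<ge> coeff * n 5 + 1"
proof -
  let ?s = "q\<^sup>2 + q + 1" and ?K = "p - {0}"
  have s: "0 < ?s" using q_pos(1) by (intro add_pos_pos) simp_all
  have k: "real (card ?K) = q - 1" using real_card_nonzero[OF level_subspace(1)[OF p]] level_subspace(2)[OF p] by simp
  have empty2: "level C 2 = {}" by (rule level_empty[of 1]) (use p in auto)
  have notin: "v \<notin> U" if v: "v \<in> ?K" and U: "U \<in> level C j" "j = 3 \<or> j = 4" for v U j
  proof
    assume "v \<in> U"
    have "p \<noteq> U" using level_subspace(2)[OF p] level_subspace(2)[OF U(1)] U(2) by auto
    from code_dim_Int[OF level_subspace(3)[OF p] level_subspace(3)[OF U(1)] this]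
    moreover have "j \<le> 4" using U(2) by auto
    ultimately have "vec.dim (p \<inter> U) = 0" using level_subspace(2)[OF p] level_subspace(2)[OF U(1)] by linarith
    then have "p \<inter> U = {0}"
      using dim_zero_iff[OF vec.subspace_inter[OF level_subspace(1)[OF p] level_subspace(1)[OF U(1)]]] by simp
    then show False using v \<open>v \<in> U\<close> by blast
  qed
  have star: "(\<Sum>L | L \<in> lines_in UNIV \<and> v \<in> L. defect L) = real (card {L \<in> lines_in UNIV. v \<in> L})"
    if v: "v \<in> ?K" for v
  proof -
    have "defect L = 1" if "v \<in> L" for L
    proof -
      have e3: "{E \<in> level C 3. L \<subseteq> E} = {}" using notin[OF v, of _ 3] that by blast
      have e4: "{E \<in> level C 4. L \<subseteq> E} = {}" using notin[OF v, of _ 4] that by blast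
      show ?thesis unfolding defect_def planes_on_def solids_on_def e3 e4 empty2 by simp
    qed
    then show ?thesis by simp
  qed
  have "(\<Sum>v\<in>?K. \<Sum>L | L \<in> lines_in UNIV \<and> v \<in> L. defect L) = (\<Sum>v\<in>?K. (q ^ 6 - 1) / (q - 1))"
  proof (rule sum.cong[OF refl])
    fix v assume v: "v \<in> ?K"
    have "(q - 1) * real (card {L \<in> lines_in UNIV. v \<in> L}) = q ^ 6 - 1"
      by (rule card_lines_through_point) (use v in auto)
    then show "(\<Sum>L | L \<in> lines_in UNIV \<and> v \<in> L. defect L) = (q ^ 6 - 1) / (q - 1)"
      unfolding star[OF v] using q_pos(4) by (simp add: eq_divide_eq mult.commute)
  qed
  also have "\<dots> = q ^ 6 - 1" using k q_pos(4) by simp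
  finally have T: "(\<Sum>v\<in>?K. \<Sum>L | L \<in> lines_in UNIV \<and> v \<in> L. defect L) \<ge> q ^ 6 - 1" by simp
  have sp: "vec.span {v} - {0} \<subseteq> ?K" if "v \<in> ?K" for v
    using vec.span_minimal[of "{v}" p] that level_subspace(1)[OF p] by blast
  \<comment> \<open>With this \<open>?b\<close> the test function
    \<open>?b * card (L \<inter> ?K)\<close> is the indicator of the lines through
    \<open>p\<close>.\<close>
  let ?X = "(q ^ 4 + q\<^sup>2 + 1) * ?s * (q\<^sup>2 + 1) * (q + 1) / den" and ?b = "1 / (q - 1)"
  have "?s * slack \<ge> ?s * n 5 * coeff + ?s * n 4 * n 5 / (q * (q\<^sup>2 + 1)\<^sup>2) - n 2
      + 2 * ?b * (q ^ 6 - 1) - 2 * ?b * (q - 1) * ?X - ?b\<^sup>2 * (q - 1) * (q ^ 6 - q + (q - 1))"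
    unfolding coeff_def
    by (rule test_defect[OF _ sp _ k[symmetric] refl T den_def]) (use q_pos in auto)
  moreover have "2 * ?b * (q - 1) * ?X = 2 * ?X"
  proof -
    have gen: "2 * (1 / r) * r * X = 2 * X" if "r \<noteq> 0" for r X :: real using that by simp
    show ?thesis by (rule gen[OF q_pos(4)])
  qed
  moreover have "?b\<^sup>2 * (q - 1) * (q ^ 6 - q + (q - 1)) = (q ^ 6 - 1) / (q - 1)"
    using q_pos(4) by (simp add: power2_eq_square)
  moreover have "2 * ?b * (q ^ 6 - 1) = 2 * ((q ^ 6 - 1) / (q - 1))" by simp
  moreover have "0 \<le> ?s * n 4 * n 5 / (q * (q\<^sup>2 + 1)\<^sup>2)"
    using q_pos by (intro divide_nonneg_nonneg mult_nonneg_nonneg) simp_all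
  moreover have "n 2 = 0" unfolding empty2 by simp
  ultimately have "?s * n 5 * coeff + ?s \<le> ?s * slack" using point_gain by linarith
  moreover have "?s * n 5 * coeff + ?s = ?s * (coeff * n 5 + 1)" by (simp add: algebra_simps)
  ultimately show ?thesis using s by (simp only: mult_le_cancel_left_pos)
qed

text \<open>Testing against all vectors covered by codewords of dimension 2 gains a unit for each of
  these codewords, as long as they and the solids are not too numerous.\<close>

lemma slack_covered_bound:
  assumes y: "2 * n 4 \<le> q * (q\<^sup>2 + 1)\<^sup>2" and z: "4 * n 2 \<le> q ^ 5 + q ^ 3 + 1"
  shows "slack \<ge> coeff * n 5 + n 2"
proof -
  let ?s = "q\<^sup>2 + q + 1" and ?\<mu> = "q\<^sup>2 + 1"
  define K where "K = (\<Union>L\<in>level C 2. L - {0})"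
  have s: "0 < ?s" using q_pos(1) by (intro add_pos_pos) simp_all
  have \<mu>: "0 < ?\<mu>" by (simp add: add_nonneg_pos)
  have disj: "L \<inter> L' = {0}" if "L \<in> level C 2" "L' \<in> level C 2" "L \<noteq> L'" for L L'
    using level_disjoint_Int[OF that] by simp
  have disj': "\<forall>L\<in>level C 2. \<forall>L'\<in>level C 2. L \<noteq> L' \<longrightarrow> (L - {0}) \<inter> (L' - {0}) = {}"
    using disj by blast
  have cL: "real (card (L - {0})) = q\<^sup>2 - 1" if "L \<in> level C 2" for L
    using real_card_nonzero[OF level_subspace(1)[OF that]] level_subspace(2)[OF that] by simp
  have "card K = (\<Sum>L\<in>level C 2. card (L - {0}))"
    unfolding K_def by (rule card_UN_disjoint[OF _ _ disj']) simp_all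
  then have k: "real (card K) = n 2 * (q\<^sup>2 - 1)" using cL by simp
  \<comment> \<open>No plane codeword contains \<open>v\<close>, exactly one codeword of dimension 2
    does, and each solid through \<open>v\<close> has \<open>?s\<close> lines through
    \<open>v\<close>.\<close>
  have star: "(\<Sum>L | L \<in> lines_in UNIV \<and> v \<in> L. defect L) =
      (q ^ 6 - 1) / (q - 1) - 1 - ?s / ?\<mu> * real (card {S \<in> level C 4. v \<in> S})"
    if v: "v \<in> K" for v
  proof -
    obtain l where l: "l \<in> level C 2" "v \<in> l" and v0: "v \<noteq> 0" using v unfolding K_def by blast
    let ?G = "\<lambda>L. of_bool (v \<in> L) :: real"
    have G: "(\<Sum>L\<in>lines_in X. ?G L) = real (card {L \<in> lines_in X. v \<in> L})" for X
      by (simp add: of_bool_def sum.If_cases Int_def)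
    have "(\<Sum>L | L \<in> lines_in UNIV \<and> v \<in> L. defect L) = (\<Sum>L\<in>lines_in UNIV. ?G L * defect L)"
      by (rule sum.mono_neutral_cong_left) auto
    also have "\<dots> = (\<Sum>L\<in>lines_in UNIV. ?G L)
     - (\<Sum>E\<in>level C 3. \<Sum>L\<in>lines_in E. ?G L) - (\<Sum>L\<in>level C 2. ?G L)
     - (\<Sum>S\<in>level C 4. \<Sum>L\<in>lines_in S. ?G L) / ?\<mu>"
      by (rule sum_defect_weighted)
    also have "(\<Sum>L\<in>lines_in UNIV. ?G L) = (q ^ 6 - 1) / (q - 1)"
      using card_lines_through_point[OF v0] q_pos(4) unfolding G by (simp add: eq_divide_eq mult.commute)
    also have "(\<Sum>E\<in>level C 3. \<Sum>L\<in>lines_in E. ?G L) = 0"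
    proof (rule sum.neutral, rule ballI, rule sum.neutral, rule ballI)
      fix E L assume E: "E \<in> level C 3" and L: "L \<in> lines_in E"
      have "l \<noteq> E" using level_subspace(2)[OF E] level_subspace(2)[OF l(1)] by auto
      then have "l \<inter> E = {0}" using level_disjoint_Int[OF l(1) E] by simp
      then have "v \<notin> E" using l(2) v0 by blast
      then show "?G L = 0" using L unfolding lines_in_def by auto
    qed
    also have "(\<Sum>L\<in>level C 2. ?G L) = 1"
    proof -
      have "{L \<in> level C 2. v \<in> L} = {l}"
      proof
        show "{L \<in> level C 2. v \<in> L} \<subseteq> {l}"
        proof
          fix L assume L: "L \<in> {L \<in> level C 2. v \<in> L}"
          show "L \<in> {l}"
          proof (rule ccontr)
            assume "L \<notin> {l}"
            then have "L \<inter> l = {0}" using disj[of L l] L l(1) by simp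
            then show False using L l(2) v0 by blast
          qed
        qed
        show "{l} \<subseteq> {L \<in> level C 2. v \<in> L}" using l by simp
      qed
      then have "card {L \<in> level C 2. v \<in> L} = 1" by simp
      then show ?thesis by (simp add: of_bool_def sum.If_cases Int_def)
    qed
    also have "(\<Sum>S\<in>level C 4. \<Sum>L\<in>lines_in S. ?G L) = ?s * real (card {S \<in> level C 4. v \<in> S})"
    proof -
      have "(\<Sum>S\<in>level C 4. \<Sum>L\<in>lines_in S. ?G L) = (\<Sum>S\<in>level C 4. if v \<in> S then ?s else 0)"
      proof (rule sum.cong[OF refl])
        fix S assume S: "S \<in> level C 4"
        show "(\<Sum>L\<in>lines_in S. ?G L) = (if v \<in> S then ?s else 0)"
        proof (cases "v \<in> S")
          case True
          have "(q - 1) * real (card {L \<in> lines_in S. v \<in> L}) = q ^ 3 - 1"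
            by (rule card_lines_through[OF level_subspace(1)[OF S] _ True v0]) (use level_subspace(2)[OF S] in simp)
          also have "\<dots> = (q - 1) * ?s" by algebra
          finally show ?thesis using True unfolding G by (simp only: mult_cancel_left q_pos(4) simp_thms if_True)
        next
          case False
          then have "{L \<in> lines_in S. v \<in> L} = {}" unfolding lines_in_def by auto
          then show ?thesis using False unfolding G by simp
        qed
      qed
      then show ?thesis by (simp add: sum.If_cases Int_def)
    qed
    finally show ?thesis by simp
  qed
  \<comment> \<open>A solid and a codeword of dimension 2 have at most \<open>q - 1\<close> nonzero
    vectors in common, since they meet in dimension at most 1.\<close>
  have solids: "(\<Sum>v\<in>K. real (card {S \<in> level C 4. v \<in> S})) \<le> n 2 * (n 4 * (q - 1))"
  proof -
    have "(\<Sum>v\<in>K. 1 * real (card {S \<in> level C 4. v \<in> S})) = (\<Sum>S\<in>level C 4. \<Sum>v | v \<in> K \<and> v \<in> S. 1)"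
      by (rule sum_incidence) auto
    also have "\<dots> = (\<Sum>S\<in>level C 4. real (card (\<Union>L\<in>level C 2. L \<inter> S - {0})))"
      unfolding K_def by (rule sum.cong) (auto intro!: arg_cong[where f = card])
    also have "\<dots> \<le> (\<Sum>S\<in>level C 4. \<Sum>L\<in>level C 2. q - 1)"
    proof (rule sum_mono)
      fix S assume S: "S \<in> level C 4"
      have "card (\<Union>L\<in>level C 2. L \<inter> S - {0}) \<le> (\<Sum>L\<in>level C 2. card (L \<inter> S - {0}))"
        by (rule card_UN_le) simp
      then have "real (card (\<Union>L\<in>level C 2. L \<inter> S - {0})) \<le> (\<Sum>L\<in>level C 2. real (card (L \<inter> S - {0})))"
        by (simp only: of_nat_sum[symmetric] of_nat_le_iff)
      also have "\<dots> \<le> (\<Sum>L\<in>level C 2. q - 1)"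
      proof (rule sum_mono)
        fix L assume L: "L \<in> level C 2"
        have "L \<noteq> S" using level_subspace(2)[OF L] level_subspace(2)[OF S] by auto
        from code_dim_Int[OF level_subspace(3)[OF L] level_subspace(3)[OF S] this]
        have "vec.dim (L \<inter> S) \<le> 1" using level_subspace(2)[OF L] level_subspace(2)[OF S] by simp
        then have "q ^ vec.dim (L \<inter> S) \<le> q ^ 1" using q_pos by (intro power_increasing) simp_all
        then show "real (card (L \<inter> S - {0})) \<le> q - 1"
          using real_card_nonzero[OF vec.subspace_inter[OF level_subspace(1)[OF L] level_subspace(1)[OF S]]] by simp
      qed
      finally show "real (card (\<Union>L\<in>level C 2. L \<inter> S - {0})) \<le> (\<Sum>L\<in>level C 2. q - 1)" .
    qed
    finally show ?thesis by (simp add: mult_ac)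
  qed
  define T where "T = n 2 * (q\<^sup>2 - 1) * ((q ^ 6 - 1) / (q - 1) - 1) - ?s / ?\<mu> * (n 2 * (n 4 * (q - 1)))"
  have T: "(\<Sum>v\<in>K. \<Sum>L | L \<in> lines_in UNIV \<and> v \<in> L. defect L) \<ge> T"
  proof -
    have "(\<Sum>v\<in>K. \<Sum>L | L \<in> lines_in UNIV \<and> v \<in> L. defect L) =
        (\<Sum>v\<in>K. (q ^ 6 - 1) / (q - 1) - 1 - ?s / ?\<mu> * real (card {S \<in> level C 4. v \<in> S}))"
      by (rule sum.cong[OF refl star])
    also have "\<dots> = real (card K) * ((q ^ 6 - 1) / (q - 1) - 1)
        - ?s / ?\<mu> * (\<Sum>v\<in>K. real (card {S \<in> level C 4. v \<in> S}))"
      by (simp only: sum_subtractf sum_distrib_left[symmetric]) (simp add: right_diff_distrib)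
    also have "\<dots> \<ge> T"
      unfolding T_def k using solids s \<mu> by (intro diff_left_mono mult_left_mono) simp_all
    finally show ?thesis .
  qed
  have sp: "vec.span {v} - {0} \<subseteq> K" if "v \<in> K" for v
  proof -
    have "\<exists>l\<in>level C 2. v \<in> l" using that unfolding K_def by blast
    then obtain l where l: "l \<in> level C 2" "v \<in> l" by blast
    then have "vec.span {v} \<subseteq> l" using vec.span_minimal[of "{v}" l] level_subspace(1)[OF l(1)] by blast
    then show ?thesis unfolding K_def using l(1) by blast
  qed
  have nz: "v \<noteq> 0" if "v \<in> K" for v using that unfolding K_def by blast
  \<comment> \<open>With this \<open>?b\<close> the test function
    \<open>?b * card (L \<inter> K)\<close> is 1 on each codeword of dimension 2.\<close>
  let ?X = "(q ^ 4 + q\<^sup>2 + 1) * ?s * ?\<mu> * (q + 1) / den" and ?b = "1 / (q\<^sup>2 - 1)"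
  let ?g = "q ^ 5 + q ^ 4 + q ^ 3 + q\<^sup>2 + q"
  have q21: "0 < q\<^sup>2 - 1" using q_pos by simp
  have fac: "q\<^sup>2 - 1 = (q - 1) * (q + 1)" by algebra
  have main: "?s * slack \<ge> ?s * n 5 * coeff + ?s * n 4 * n 5 / (q * ?\<mu>\<^sup>2) - n 2
      + 2 * ?b * T - 2 * ?b * (n 2 * (q\<^sup>2 - 1)) * ?X - ?b\<^sup>2 * (n 2 * (q\<^sup>2 - 1)) * (q ^ 6 - q + n 2 * (q\<^sup>2 - 1))"
    unfolding coeff_def
    by (rule test_defect[OF nz sp _ k[symmetric] refl T den_def]) (use q21 in auto)
  have g: "(q ^ 6 - 1) / (q - 1) - 1 = ?g" 
  proof -
    have "(?g + 1) * (q - 1) = q ^ 6 - 1" by algebra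
    then have "(q ^ 6 - 1) / (q - 1) = ?g + 1" by (simp only: nonzero_divide_eq_eq[OF q_pos(4)])
    then show ?thesis by simp
  qed
  have 1: "2 * ?b * T = n 2 * (2 * ?g - 2 * ?s * n 4 / ((q + 1) * ?\<mu>))"
  proof -
    have "?b * (n 2 * (q\<^sup>2 - 1) * ?g) = n 2 * ?g" using q21 by simp
    moreover have "?b * (?s / ?\<mu> * (n 2 * (n 4 * (q - 1)))) = n 2 * (?s * n 4 / ((q + 1) * ?\<mu>))"
      unfolding fac using q_pos(4) by simp
    ultimately have "?b * T = n 2 * ?g - n 2 * (?s * n 4 / ((q + 1) * ?\<mu>))"
      unfolding T_def g by (simp only: right_diff_distrib)
    then have "2 * ?b * T = 2 * (n 2 * ?g - n 2 * (?s * n 4 / ((q + 1) * ?\<mu>)))" by (simp only: mult.assoc)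
    also have "\<dots> = n 2 * (2 * ?g - 2 * ?s * n 4 / ((q + 1) * ?\<mu>))"
      by (simp only: right_diff_distrib times_divide_eq_right mult_ac)
    finally show ?thesis .
  qed
  have 2: "2 * ?b * (n 2 * (q\<^sup>2 - 1)) * ?X = n 2 * (2 * ?X)"
  proof -
    have gen: "2 * (1 / r) * (m * r) * X = m * (2 * X)" if "r \<noteq> 0" for r m X :: real using that by simp
    show ?thesis by (rule gen) (use q21 in simp)
  qed
  have 3: "?b\<^sup>2 * (n 2 * (q\<^sup>2 - 1)) * (q ^ 6 - q + n 2 * (q\<^sup>2 - 1)) = n 2 * (?g / (q + 1) + n 2)"
  proof -
    have "?b\<^sup>2 * (n 2 * (q\<^sup>2 - 1)) * (q ^ 6 - q + n 2 * (q\<^sup>2 - 1)) =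
        n 2 * ((q ^ 6 - q) / (q\<^sup>2 - 1) + n 2)"
    proof -
      have gen: "(1 / r)\<^sup>2 * (m * r) * (e + m * r) = m * (e / r + m)" if "r \<noteq> 0" for r m e :: real
        using that by (simp add: field_simps power2_eq_square)
      show ?thesis by (rule gen) (use q21 in simp)
    qed
    moreover have "(q ^ 6 - q) / (q\<^sup>2 - 1) = ?g / (q + 1)"
    proof -
      have "q ^ 6 - q = ?g * (q - 1)" by algebra
      then show ?thesis unfolding fac using q_pos(4) by simp
    qed
    ultimately show ?thesis by simp
  qed
  have "n 2 * ?s \<le> n 2 * (2 * ?g - 2 * ?s * n 4 / ((q + 1) * ?\<mu>) - 2 * ?X - ?g / (q + 1) - n 2 - 1)"
    by (intro mult_left_mono line_gain y z) simp
  also have "\<dots> = n 2 * (2 * ?g - 2 * ?s * n 4 / ((q + 1) * ?\<mu>)) - n 2 * (2 * ?X) - n 2 * (?g / (q + 1) + n 2) - n 2"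
    by (simp only: right_diff_distrib distrib_left mult_1_right diff_diff_add)
  finally have gain: "n 2 * ?s \<le> \<dots>" .
  have "0 \<le> ?s * n 4 * n 5 / (q * ?\<mu>\<^sup>2)"
    using q_pos by (intro divide_nonneg_nonneg mult_nonneg_nonneg) simp_all
  then have "?s * n 5 * coeff + n 2 * ?s \<le> ?s * slack"
    using main gain unfolding 1 2 3 by linarith
  moreover have "?s * n 5 * coeff + n 2 * ?s = ?s * (coeff * n 5 + n 2)" by (simp add: algebra_simps)
  ultimately show ?thesis using s by (simp only: mult_le_cancel_left_pos)
qed

end


section \<open>The common bound for all codes and comparisons with it\<close>

context finite_field_size
begin

text \<open>The largest possible excess, \<open>1 - coeff\<close> for each codeword of dimension 5,
  with their number at the partial spread bound.\<close>

definition size_bound :: real where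
  "size_bound = base + (1 - coeff) * (q ^ 5 + q ^ 3 + 1)"

text \<open>Leaves room for two codewords beyond \<open>base\<close>, as happens when extreme
  dimensions occur.\<close>

lemma size_bound_ge: "base + 2 \<le> size_bound"
proof -
  define t where "t = q - 2"
  have t: "0 \<le> t" using q_ge_2 unfolding t_def by simp
  have "q ^ 4 * (q ^ 5 + q ^ 3 + 1) - 2 * den =
      474 + 2430 * t + 5020 * t\<^sup>2 + 5828 * t ^ 3 + 4289 * t ^ 4 + 2098 * t ^ 5 + 686 * t ^ 6 + 145 * t ^ 7 + 18 * t ^ 8 + t ^ 9"
    unfolding den_def t_def by algebra
  moreover have "0 \<le> 474 + 2430 * t + 5020 * t\<^sup>2 + 5828 * t ^ 3 + 4289 * t ^ 4 + 2098 * t ^ 5 + 686 * t ^ 6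
      + 145 * t ^ 7 + 18 * t ^ 8 + t ^ 9"
    using t by (intro add_nonneg_nonneg mult_nonneg_nonneg zero_le_power) simp_all
  ultimately have "2 * den \<le> q ^ 4 * (q ^ 5 + q ^ 3 + 1)" by linarith
  then have "2 \<le> q ^ 4 * (q ^ 5 + q ^ 3 + 1) / den" using den_pos by (simp only: pos_le_divide_eq)
  then show ?thesis unfolding size_bound_def one_minus_coeff by simp
qed

lemma base_large: "1 + q * (q\<^sup>2 + 1)\<^sup>2 + (q ^ 5 + q ^ 3 + 1) \<le> base"
proof -
  define t where "t = q - 2"
  have t: "0 \<le> t" using q_ge_2 unfolding t_def by simp
  have "base - 1 - q * (q\<^sup>2 + 1)\<^sup>2 - (q ^ 5 + q ^ 3 + 1) =
      289 + 1147 * t + 1965 * t\<^sup>2 + 1918 * t ^ 3 + 1171 * t ^ 4 + 459 * t ^ 5 + 113 * t ^ 6 + 16 * t ^ 7 + t ^ 8"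
    unfolding base_def t_def by algebra
  moreover have "0 \<le> 289 + 1147 * t + 1965 * t\<^sup>2 + 1918 * t ^ 3 + 1171 * t ^ 4 + 459 * t ^ 5 + 113 * t ^ 6 + 16 * t ^ 7 + t ^ 8"
    using t by (intro add_nonneg_nonneg mult_nonneg_nonneg zero_le_power) simp_all
  ultimately show ?thesis by linarith
qed

text \<open>At q = 2 the two sides are 295 and 299, so the constant 59/10 is nearly the best
  possible there.\<close>

lemma base_large': "59 / 10 * (q * (q\<^sup>2 + 1)\<^sup>2) \<le> base - 2 * (q ^ 5 + q ^ 3 + 1)"
proof -
  define t where "t = q - 2"
  have t: "0 \<le> t" using q_ge_2 unfolding t_def by simp
  have "10 * (base - 2 * (q ^ 5 + q ^ 3 + 1)) - 59 * (q * (q\<^sup>2 + 1)\<^sup>2) =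
      40 + 5405 * t + 14282 * t\<^sup>2 + 16712 * t ^ 3 + 11120 * t ^ 4 + 4531 * t ^ 5 + 1130 * t ^ 6 + 160 * t ^ 7 + 10 * t ^ 8"
    unfolding base_def t_def by algebra
  moreover have "0 \<le> 40 + 5405 * t + 14282 * t\<^sup>2 + 16712 * t ^ 3 + 11120 * t ^ 4 + 4531 * t ^ 5 + 1130 * t ^ 6 + 160 * t ^ 7 + 10 * t ^ 8"
    using t by (intro add_nonneg_nonneg mult_nonneg_nonneg zero_le_power) simp_all
  moreover have "59 / 10 * u \<le> v" if "10 * v - 59 * u = r" "0 \<le> r" for u v r :: real
    using that by linarith
  ultimately show ?thesis by blast
qed

lemma threshold_pos: "0 < q * (q\<^sup>2 + 1)\<^sup>2"
  using q_pos(1) by (intro mult_pos_pos zero_less_power add_nonneg_pos) simp_all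

end

section \<open>Codes according to the dimensions that occur\<close>

context distance_four_code
begin

lemma le_size_bound:
  assumes "slack \<ge> coeff * n 5 + e"
  shows "n 3 + n 4 + n 5 + e \<le> size_bound"
proof -
  have "(1 - coeff) * n 5 \<le> (1 - coeff) * (q ^ 5 + q ^ 3 + 1)"
    using coeff_bounds(2) card_level_5 by (intro mult_left_mono) simp_all
  then show ?thesis using assms unfolding size_bound_def slack_eq by (simp add: algebra_simps)
qed

text \<open>
  Unless level four is tiny, \<open>slack_lines_bound_dual\<close> and \<open>slack_five_bound\<close> together pay for all
  codewords of dimensions two and five.
\<close>

lemma card_code_middle:
  assumes empty: "level C 0 = {}" "level C 1 = {}" "level C 6 = {}" "level C 7 = {}"
    and le: "n 4 \<le> n 3"
  shows "real (card C) \<le> size_bound"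
proof -
  \<comment> \<open>\<open>X\<close> and \<open>Y\<close> measure planes and solids in units of the
    number of solids whose interaction term alone equals the number of codewords of dimension
    5.\<close>
  define s X Y z w where "s = q\<^sup>2 + q + 1" and "X = n 3 / (q * (q\<^sup>2 + 1)\<^sup>2)" and "Y = n 4 / (q * (q\<^sup>2 + 1)\<^sup>2)"
    and "z = n 2" and "w = n 5"
  have card: "real (card C) = n 3 + n 4 + w + z"
    unfolding real_card_code empty z_def w_def by simp
  note Q = threshold_pos
  have s: "7 \<le> s"
  proof -
    have "2\<^sup>2 \<le> q\<^sup>2" using q_ge_2 by (intro power_mono) simp_all
    then show ?thesis unfolding s_def using q_ge_2 by simp
  qed
  have I: "slack \<ge> (coeff + Y) * w - z / s"
    using slack_five_bound unfolding Y_def w_def z_def s_def .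
  have II: "slack \<ge> w / s + X * z"
    using slack_lines_bound_dual unfolding X_def w_def z_def s_def by simp
  have nn: "0 \<le> z" "0 \<le> w" unfolding z_def w_def by simp_all
  have XY: "Y \<le> X" unfolding X_def Y_def using le Q by (intro divide_right_mono) simp_all
  have Y0: "0 \<le> Y" unfolding Y_def using Q by simp
  show ?thesis
  proof (cases "slack \<ge> z + w")
    case True
    then show ?thesis using size_bound_ge unfolding card slack_eq by linarith
  next
    case False
    have zB: "z \<le> q ^ 5 + q ^ 3 + 1" and wB: "w \<le> q ^ 5 + q ^ 3 + 1"
      unfolding z_def w_def by (rule card_level_2, rule card_level_5)
    \<comment> \<open>Here the slack is below \<open>z + w\<close>, hence below twice the partial
      spread bound, so planes and solids nearly fill \<open>base\<close>.\<close>
    have "59 / 10 * (q * (q\<^sup>2 + 1)\<^sup>2) \<le> n 3 + n 4"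
    proof -
      have gen: "u \<le> x + y" if "\<not> z + w \<le> b - x - y" "u \<le> b - 2 * B" "z \<le> B" "w \<le> B" for u x y b B :: real
        using that by linarith
      show ?thesis by (rule gen[OF False[unfolded slack_eq] base_large' zB wB])
    qed
    then have "59 / 10 \<le> (n 3 + n 4) / (q * (q\<^sup>2 + 1)\<^sup>2)" using Q by (simp only: pos_le_divide_eq)
    then have sum: "59 / 10 \<le> X + Y" unfolding X_def Y_def by (simp add: add_divide_distrib)
    have Xz: "(X - 1) * z < (1 - 1 / s) * w"
      using II False by (simp add: algebra_simps)
    have "(1 - 1 / s) * w \<le> 1 * w" using s nn by (intro mult_right_mono) simp_all
    then have Xz': "(X - 1) * z \<le> w" using Xz by simp
    show ?thesis
    proof (cases "z = 0")
      case True
      have "coeff * w \<le> (coeff + Y) * w" using Y0 nn by (intro mult_right_mono) simp_all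
      then have "slack \<ge> coeff * n 5 + 0" using I True unfolding w_def by simp
      then show ?thesis using le_size_bound[of 0] True unfolding card w_def by simp
    next
      case False
      then have z: "0 < z" using nn by simp
      \<comment> \<open>Otherwise I gives \<open>p * w < (1 + 1 / s) * z\<close>, while II gives
        \<open>(X - 1) * z < (1 - 1 / s) * w\<close>. Multiplied together they force
        \<open>p * (X - 1) < 1\<close>.\<close>
      have Yhalf: "Y < 1 / 2"
      proof (rule ccontr)
        assume "\<not> Y < 1 / 2"
        define p where "p = coeff + Y - 1"
        have p: "7 / 22 \<le> p" using \<open>\<not> Y < 1 / 2\<close> coeff_bounds(1) unfolding p_def by linarith
        have X1: "39 / 20 \<le> X - 1" using sum XY by linarith
        have pw: "p * w < (1 + 1 / s) * z"
          using I \<open>\<not> z + w \<le> slack\<close> unfolding p_def by (simp add: algebra_simps)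
        have "p * ((X - 1) * z) \<le> p * ((1 - 1 / s) * w)"
          using Xz p by (intro mult_left_mono) simp_all
        also have "\<dots> = (1 - 1 / s) * (p * w)" by simp
        also have "\<dots> \<le> (1 - 1 / s) * ((1 + 1 / s) * z)"
          using pw s by (intro mult_left_mono) simp_all
        also have "\<dots> < 1 * z"
        proof -
          have "(1 - 1 / s) * (1 + 1 / s) = 1 - (1 / s)\<^sup>2" by algebra
          moreover have "0 < (1 / s)\<^sup>2" using s by simp
          ultimately have "(1 - 1 / s) * (1 + 1 / s) < 1" by simp
          then have "((1 - 1 / s) * (1 + 1 / s)) * z < 1 * z" using z by (rule mult_strict_right_mono)
          then show ?thesis by (simp only: mult.assoc)
        qed
        finally have "(p * (X - 1)) * z < 1 * z" by (simp only: mult.assoc)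
        then have lt: "p * (X - 1) < 1" using z by (simp only: mult_less_cancel_right_pos)
        \<comment> \<open>The crude values are 9/11 + 1/2 - 1 = 7/22 for \<open>p\<close> and 59/20
          - 1 for \<open>X - 1\<close>. The first bounds \<open>X\<close> from above, hence
          \<open>Y\<close> from below; the improved \<open>p\<close> then contradicts the
          second.\<close>
        have "7 / 22 * (X - 1) \<le> p * (X - 1)" using p X1 by (intro mult_right_mono) simp_all
        then have "7 / 22 * (X - 1) < 1" using lt by (rule le_less_trans)
        then have "X < 29 / 7" by simp
        then have "3 / 2 \<le> p" using sum coeff_bounds(1) unfolding p_def by linarith
        then have "3 / 2 * (39 / 20) \<le> p * (X - 1)" using X1 by (intro mult_mono) simp_all
        then have "3 / 2 * (39 / 20) < (1 :: real)" using lt by (rule le_less_trans)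
        then show False by simp
      qed
      \<comment> \<open>As \<open>Y\<close> is below 1/2, \<open>X - 1\<close> exceeds 59/10 - 1/2 -
        1. Thus \<open>z\<close> is at most a quarter of \<open>w\<close>, and
        \<open>slack_covered_bound\<close> applies.\<close>
      then have "4 * z \<le> (X - 1) * z" using sum z by (intro mult_right_mono) simp_all
      then have z4: "4 * n 2 \<le> q ^ 5 + q ^ 3 + 1" using Xz' wB unfolding z_def by linarith
      have "n 4 < 1 / 2 * (q * (q\<^sup>2 + 1)\<^sup>2)"
        using Yhalf Q unfolding Y_def by (simp only: pos_divide_less_eq)
      then have "2 * n 4 \<le> q * (q\<^sup>2 + 1)\<^sup>2" by linarith
      from slack_covered_bound[OF this z4] have "slack \<ge> coeff * n 5 + n 2" .
      from le_size_bound[OF this] show ?thesis unfolding card w_def z_def .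
    qed
  qed
qed

text \<open>Dimension 1 excludes dimension 2, and dimension 6 excludes dimension 5. So either the
  unit from \<open>slack_point_bound\<close> pays for the point, or at most two codewords exceed
  \<open>base\<close>.\<close>

lemma card_code_with_point:
  assumes empty: "level C 0 = {}" "level C 7 = {}" and p: "level C 1 \<noteq> {}"
  shows "real (card C) \<le> size_bound"
proof -
  have e2: "level C 2 = {}" by (rule level_empty[OF p]) simp_all
  have n1: "n 1 \<le> 1" using card_level_le_1[of 1] by simp
  show ?thesis
  proof (cases "level C 6 = {}")
    case True
    obtain p where "p \<in> level C 1" using assms(3) by blast
    from le_size_bound[OF slack_point_bound[OF this]] n1 show ?thesis
      unfolding real_card_code empty e2 True by simp
  next
    case False
    have e5: "level C 5 = {}" by (rule level_empty[OF False]) simp_all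
    have "n 6 \<le> 1" using card_level_le_1[of 6] by simp
    then show ?thesis
      using n1 slack_nonneg size_bound_ge unfolding real_card_code empty e2 e5 slack_eq by simp
  qed
qed

lemma card_code_with_zero:
  assumes zero: "level C 0 \<noteq> {}"
  shows "real (card C) \<le> size_bound"
proof -
  have e: "level C 1 = {}" "level C 2 = {}" "level C 3 = {}"
    by (rule level_empty[OF zero]; simp)+
  have n0: "n 0 \<le> 1" "n 6 \<le> 1" "n 7 \<le> 1"
    using card_level_le_1[of 0] card_level_le_1[of 6] card_level_le_1[of 7] by simp_all
  have "0 \<le> 1 + q * (q\<^sup>2 + 1)\<^sup>2 + (q ^ 5 + q ^ 3 + 1)"
    using q_pos(1) by (intro add_nonneg_nonneg mult_nonneg_nonneg) simp_all
  then have base0: "0 \<le> base" using base_large by (rule order_trans)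
  show ?thesis
  proof (cases "level C 7 = {}")
    case False
    have e': "level C 4 = {}" "level C 5 = {}" "level C 6 = {}"
      by (rule level_empty[OF False]; simp)+
    show ?thesis using n0 base0 size_bound_ge unfolding real_card_code e e' by simp
  next
    case True
    show ?thesis
    proof (cases "level C 6 = {}")
      case False
      have e5: "level C 5 = {}" by (rule level_empty[OF False]) simp_all
      show ?thesis
        using n0 slack_nonneg size_bound_ge unfolding real_card_code e e5 True slack_eq by simp
    next
      case e6: True
        note Q = threshold_pos
      have bound: "slack \<ge> (coeff + n 4 / (q * (q\<^sup>2 + 1)\<^sup>2)) * n 5"
        using slack_five_bound unfolding e by simp
      \<comment> \<open>Either there are enough solids to pay for each codeword of dimension 5 in
        full, or so few that \<open>base_large\<close> bounds everything.\<close>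
      have "n 4 + n 5 + 1 \<le> base + 1"
      proof (cases "q * (q\<^sup>2 + 1)\<^sup>2 \<le> n 4")
        case True
        then have "1 \<le> n 4 / (q * (q\<^sup>2 + 1)\<^sup>2)" using Q by (simp only: pos_le_divide_eq mult_1_left)
        then have "1 * n 5 \<le> (coeff + n 4 / (q * (q\<^sup>2 + 1)\<^sup>2)) * n 5"
          using coeff_bounds(1) by (intro mult_right_mono) simp_all
        then show ?thesis using bound unfolding slack_eq e by simp
      next
        case False
        then show ?thesis using base_large card_level_5 by linarith
      qed
      then show ?thesis using n0 size_bound_ge unfolding real_card_code e e6 True by simp
    qed
  qed
qed

lemma level_dual_empty: "k \<le> 7 \<Longrightarrow> level (dual_code C) k = {} \<longleftrightarrow> level C (7 - k) = {}"
  by (simp add: dual_level)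

text \<open>Duality exchanges dimensions 0 and 7, and 1 and 6; when none of these occurs it allows
  the assumption that there are at most as many solids as planes.\<close>

theorem card_code_le: "real (card C) \<le> size_bound"
proof -
  interpret dual: distance_four_code q F "dual_code C" by (rule dual_code)
  consider "level C 0 \<noteq> {}" | "level C 7 \<noteq> {}"
    | "level C 0 = {}" "level C 7 = {}" "level C 1 \<noteq> {}"
    | "level C 0 = {}" "level C 7 = {}" "level C 6 \<noteq> {}"
    | "level C 0 = {}" "level C 7 = {}" "level C 1 = {}" "level C 6 = {}" by blast
  then show ?thesis
  proof cases
    case 1
    then show ?thesis by (rule card_code_with_zero)
  next
    case 2
    then have "level (dual_code C) 0 \<noteq> {}" by (simp add: level_dual_empty)
    from dual.card_code_with_zero[OF this] show ?thesis unfolding card_dual_code .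
  next
    case 3
    then show ?thesis by (rule card_code_with_point)
  next
    case 4
    then have "level (dual_code C) 0 = {}" "level (dual_code C) 7 = {}" "level (dual_code C) 1 \<noteq> {}"
      by (simp_all add: level_dual_empty)
    from dual.card_code_with_point[OF this] show ?thesis unfolding card_dual_code .
  next
    case 5
    show ?thesis
    proof (cases "n 4 \<le> n 3")
      case True
      then show ?thesis using 5 by (intro card_code_middle)
    next
      case False
      then have "dual.n 4 \<le> dual.n 3" by (simp add: card_dual_level)
      moreover have "level (dual_code C) 0 = {}" "level (dual_code C) 7 = {}"
        "level (dual_code C) 1 = {}" "level (dual_code C) 6 = {}"
        using 5 by (simp_all add: level_dual_empty)
      ultimately show ?thesis using dual.card_code_middle unfolding card_dual_code by simp
    qed
  qed
qed

end

section \<open>The bound in closed form\<close>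

text \<open>The quartic with constant term 5, times \<open>den\<close>, exceeds
  \<open>q ^ 4 * (q ^ 5 + q ^ 3 + 1)\<close> by a positive polynomial. At q = 2 and q = 3 this
  surplus is greater than \<open>den\<close>, so the constant term 4 suffices there.\<close>

lemma (in finite_field_size) size_bound_less:
  assumes q: "q = real m"
  shows "size_bound < F_bound m + 1"
proof -
  have br: "gauss_bracket1 7 m = q^6 + q^5 + q^4 + q^3 + q\<^sup>2 + q + 1"
  proof -
    have "(q^6 + q^5 + q^4 + q^3 + q\<^sup>2 + q + 1) * (q - 1) = q ^ 7 - 1" by algebra
    then show ?thesis unfolding gauss_bracket1_def q[symmetric] by (simp only: nonzero_divide_eq_eq[OF q_pos(4)])
  qed
  have F: "F_bound m = base + q ^ 4 - 2 * q ^ 3 + 3 * q\<^sup>2 - 4 * q + (if m \<in> {2, 3} then 3 else 4)"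
    unfolding F_bound_def br q[symmetric] base_def by (simp add: mult.commute)
  have "(1 - coeff) * (q ^ 5 + q ^ 3 + 1) < q ^ 4 - 2 * q ^ 3 + 3 * q\<^sup>2 - 4 * q + (if m \<in> {2, 3} then 3 else 4) + 1"
  proof (cases "m \<in> {2, 3}")
    case True
    then have "q = 2 \<or> q = 3" using q by auto
    then show ?thesis
      using True unfolding one_minus_coeff den_def by (elim disjE) simp_all
  next
    case False
    have "den * (q ^ 4 - 2 * q ^ 3 + 3 * q\<^sup>2 - 4 * q + 5) - q ^ 4 * (q ^ 5 + q ^ 3 + 1) = 6 * q ^ 4 + 3 * q ^ 3 + 9 * q\<^sup>2 + q + 5"
      unfolding den_def by algebra
    moreover have "0 < 6 * q ^ 4 + 3 * q ^ 3 + 9 * q\<^sup>2 + q + 5"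
      using q_pos(1) by (intro add_pos_pos) simp_all
    ultimately have "q ^ 4 * (q ^ 5 + q ^ 3 + 1) < (q ^ 4 - 2 * q ^ 3 + 3 * q\<^sup>2 - 4 * q + 5) * den"
      by (simp add: mult.commute)
    then have "q ^ 4 * (q ^ 5 + q ^ 3 + 1) / den < q ^ 4 - 2 * q ^ 3 + 3 * q\<^sup>2 - 4 * q + 5"
      using den_pos by (simp only: pos_divide_less_eq)
    then show ?thesis unfolding one_minus_coeff using False by simp
  qed
  then show ?thesis unfolding size_bound_def F by simp
qed

lemma F_bound_integral:
  assumes "2 \<le> m"
  shows "F_bound m \<in> \<int>"
proof -
  have "(\<Sum>i<7. real m ^ i) = (real m ^ 7 - 1) / (real m - 1)"
    using assms geometric_sum[of "real m" 7] by simp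
  then have "gauss_bracket1 7 m \<in> \<int>"
    unfolding gauss_bracket1_def by (metis Ints_of_nat Ints_power Ints_sum)
  then show ?thesis unfolding F_bound_def by auto
qed

theorem theorem2:
  fixes q :: nat
  assumes "primepow q" and "2 \<le> q" and "q \<le> 101"
    and "CARD('a::{field,finite}) = q"
  shows "real (A_max TYPE('a) TYPE(7) 4) \<le> F_bound q"
proof -
  let ?S = "{card C | C :: ('a ^ 7) set set. subspace_code 4 C}"
  have bound: "real (card C) \<le> F_bound q" if "subspace_code 4 C" for C :: "('a ^ 7) set set"
  proof -
    interpret distance_four_code "real q" "TYPE('a)" C
      by standard (use assms(4) that in simp_all)
    \<comment> \<open>A strict bound by \<open>F_bound q + 1\<close> suffices, because
      \<open>F_bound q\<close> is an integer.\<close>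
    have "real (card C) < F_bound q + 1"
      using card_code_le size_bound_less[OF refl] by linarith
    moreover obtain i where i: "F_bound q = of_int i"
      using F_bound_integral[OF assms(2)] by (auto elim: Ints_cases)
    ultimately have "real_of_int (int (card C)) < real_of_int (i + 1)" by simp
    then have "int (card C) \<le> i" by (simp only: of_int_less_iff zless_add1_eq order_le_less)
    then have "real_of_int (int (card C)) \<le> real_of_int i" by (simp only: of_int_le_iff)
    then show ?thesis using i by simp
  qed
  have "?S \<subseteq> card ` (UNIV :: ('a ^ 7) set set set)" by auto
  then have "finite ?S" by (rule finite_subset) simp
  moreover have "card ({} :: ('a ^ 7) set set) \<in> ?S"
    by (intro CollectI exI[of _ "{}"]) (simp add: subspace_code_def)
  ultimately have "Max ?S \<in> ?S" by (intro Max_in) auto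
  then obtain C :: "('a ^ 7) set set" where "Max ?S = card C" "subspace_code 4 C" by auto
  then show ?thesis unfolding A_max_def using bound by simp
qed



end
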